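(* Let $T:\mathbb{T}^2\to\mathbb{T}^2$ be a real-analytic Anosov diffeomorphism satisfying the (sec) condition for some $P\in \mathrm{GL}_2(\mathbb{R})$, and let $w:\mathbb{T}^2\to\mathbb{C}$ be analytic. Then there exist $\alpha,\gamma\in\mathbb{R}^2_{>0}$ such that the weighted composition operator $$f\mapsto w\cdot f\circ T$$ is a well-defined trace-class operator on $H_{P,\alpha,-\gamma}$ (whose weight $\nu_{P,\alpha,-\gamma}$ is a cone-wise exponential function on $\mathbb{Z}^2$).
   Context: Notation. $\mathbb{T}^2=\{z\in\mathbb{C}^2:|z_1|=|z_2|=1\}$, $M=(\mathbb{R}/2\pi\mathbb{Z})^2$, $\pi(x_1,x_2)=(e^{ix_1},e^{ix_2})$. A diffeomorphism $T$ of $\mathbb{T}^2$ corresponds to the diffeomorphism $\tilde T$ of $M$ with $T\circ\pi=\pi\circ\tilde T$; tangent spaces $T_xM$ are identified with $\mathbb{R}^2$. $\Sigma=\{\sigma=(\sigma_1,\sigma_2):\sigma_i\in\{\pm1\}\}$, $\Sigma^{\ell}=\{\sigma\in\Sigma:\sigma_1\sigma_2=\ell\}$ for $\ell\in\{\pm1\}$, $I^\sigma=\mathrm{diag}(\sigma_1,\sigma_2)$. For $P\in\mathrm{GL}_2(\mathbb{R})$, $\delta\in\mathbb{R}^2$, $\sigma\in\Sigma$: $v^\sigma_{P,\delta}=PI^\sigma\delta$ and $\Lambda^\sigma_{P,\delta}=PI^\sigma(\mathbb{R}^2_{>0}+\delta)$; $K^u_\delta=\bigcup_{\sigma\in\Sigma^1}\Lambda^\sigma_{P,\delta}$,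 $K^s_\delta=\bigcup_{\sigma\in\Sigma^{-1}}\Lambda^\sigma_{P,\delta}$. $\tilde T$ has $P$-induced constant invariant cone fields if it is Anosov with the constant cones $K^u=K^u_0$, $K^s=K^s_0$, i.e. there are a (continuous) family of norms $\|\cdot\|$ on the $T_xM$ and $\lambda>1$ such that for all $x\in M$: $D_x\tilde T(\overline{K^u})\subset K^u\cup\{0\}$, $D_x\tilde T^{-1}(\overline{K^s})\subset K^s\cup\{0\}$, $\|D_x\tilde T v\|>\lambda\|v\|$ for $0\ne v\in\overline{K^u}$ and $\|D_x\tilde T^{-1}v\|>\lambda\|v\|$ for $0\neq v\in\overline{K^s}$. $T$ satisfies the (sec) condition (strongly expanding constant invariant cone fields) for $P$ if $\tilde T$ has $P$-induced constant invariant cone fields and there are $\delta,\tilde\delta\in\mathbb{R}^2_{>0}$, $\sigma\in\Sigma^1$, $\tilde\sigma\in\Sigma^{-1}$ such that for all $x\in M$: $(D_x\tilde T)v^\sigma_{P,\delta}\in K^u_\delta$ and $(D_x\tilde T^{-1})v^{\tilde\sigma}_{P,\tilde\delta}\in K^s_{\tilde\delta}$. For $x\in\mathbb{R}^2$, $|x|=(|x_1|,|x_2|)$. For $P\in\mathrm{GL}_2(\mathbb{R})$ and $\alpha,\gamma\in\mathbb{R}^2$ put, with $m=P^Tn$, $\nu_{P,\alpha,-\gamma}(n)=\exp(-\langle\alpha,|m|\rangle)$ if $m_1m_2\ge0$ and $\nu_{P,\alpha,-\gamma}(n)=\exp(\langle\gamma,|m|\rangle)$ if $m_1m_2<0$ ($n\in\mathbb{Z}^2$).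 $H_{P,\alpha,-\gamma}$ is the Hilbert space completion of the Laurent polynomials $f=\sum_n f_nz^n$ on $\mathbb{T}^2$ with respect to $\langle f,g\rangle_\nu=\sum_{n\in\mathbb{Z}^2}f_n\overline{g_n}\nu(n)^2$, $\nu=\nu_{P,\alpha,-\gamma}$. A weight is cone-wise exponential if it is $e^{f}$ with $f$ piecewise linear, the pieces being cones in $\mathbb{R}^2$. A function analytic near $\mathbb{T}^2$ is identified with its Fourier series; the operator $f\mapsto w\cdot f\circ T$ on $H_{P,\alpha,-\gamma}$ is the continuous extension of its restriction to Laurent polynomials. *)

theory Defs
  imports "HOL-Analysis.Analysis"
begin

section \<open>Analytic torus diffeomorphisms\<close>

definition torus :: "(complex^2) set" where
  "torus = {z. \<forall>i. cmod (z$i) = 1}"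

text \<open>Points and tangent vectors of \<open>M = (\<real>/2\<pi>\<int>)\<^sup>2\<close> are represented by elements of \<^typ>\<open>real^2\<close>;
  two of them represent the same point of \<open>M\<close> iff \<open>torus_proj\<close> identifies them.\<close>

definition torus_proj :: "real^2 \<Rightarrow> complex^2" where
  "torus_proj x = (\<chi> i. cis (x$i))"

definition real_analytic :: "(real^2 \<Rightarrow> 'b::real_normed_vector) \<Rightarrow> bool" where
  "real_analytic f \<longleftrightarrow>
     (\<forall>a. \<exists>r>0. \<exists>c :: nat \<times> nat \<Rightarrow> 'b. \<forall>x. dist x a < r \<longrightarrow>
        ((\<lambda>(j, k). ((x$1 - a$1)^j * (x$2 - a$2)^k) *\<^sub>R c (j, k)) has_sum f x) UNIV)"

definition torus_analytic :: "(complex^2 \<Rightarrow> 'b::real_normed_vector) \<Rightarrow> bool" where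
  "torus_analytic g \<longleftrightarrow> real_analytic (g \<circ> torus_proj)"

definition torus_inv :: "(complex^2 \<Rightarrow> complex^2) \<Rightarrow> complex^2 \<Rightarrow> complex^2" where
  "torus_inv T = inv_into torus T"

definition torus_analytic_diffeo :: "(complex^2 \<Rightarrow> complex^2) \<Rightarrow> bool" where
  "torus_analytic_diffeo T \<longleftrightarrow>
     bij_betw T torus torus \<and> torus_analytic T \<and> torus_analytic (torus_inv T)"

text \<open>A differentiable map of \<open>M\<close> is represented by a differentiable lift to \<open>\<real>\<^sup>2\<close>. Lifts of the same
  map differ by a constant in \<open>2\<pi>\<int>\<^sup>2\<close>, so the choice of the lift affects neither the derivative nor
  the represented point of \<open>M\<close>.\<close>

definition torus_lift :: "(complex^2 \<Rightarrow> complex^2) \<Rightarrow> (real^2 \<Rightarrow> real^2) \<Rightarrow> bool" where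
  "torus_lift T F \<longleftrightarrow>
     (\<forall>x. F differentiable (at x)) \<and> (\<forall>x. T (torus_proj x) = torus_proj (F x))"

abbreviation tangent_map :: "(real^2 \<Rightarrow> real^2) \<Rightarrow> real^2 \<Rightarrow> real^2 \<Rightarrow> real^2" where
  "tangent_map F x \<equiv> frechet_derivative F (at x)"

section \<open>Cones and the (sec) condition\<close>

definition signs :: "real \<Rightarrow> (real^2) set" where
  "signs l = {\<sigma>. (\<forall>i. \<sigma>$i \<in> {-1, 1}) \<and> \<sigma>$1 * \<sigma>$2 = l}"

definition sign_matrix :: "real^2 \<Rightarrow> real^2^2" where
  "sign_matrix \<sigma> = (\<chi> i j. if i = j then \<sigma>$i else 0)"

definition pos_vecs :: "(real^2) set" where
  "pos_vecs = {x. \<forall>i. 0 < x$i}"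

definition cone_apex :: "real^2^2 \<Rightarrow> real^2 \<Rightarrow> real^2 \<Rightarrow> real^2" where
  "cone_apex P \<delta> \<sigma> = (P ** sign_matrix \<sigma>) *v \<delta>"

definition shifted_sector :: "real^2^2 \<Rightarrow> real^2 \<Rightarrow> real^2 \<Rightarrow> (real^2) set" where
  "shifted_sector P \<delta> \<sigma> = {(P ** sign_matrix \<sigma>) *v (y + \<delta>) | y. y \<in> pos_vecs}"

definition unstable_cone :: "real^2^2 \<Rightarrow> real^2 \<Rightarrow> (real^2) set" where
  "unstable_cone P \<delta> = (\<Union>\<sigma>\<in>signs 1. shifted_sector P \<delta> \<sigma>)"

definition stable_cone :: "real^2^2 \<Rightarrow> real^2 \<Rightarrow> (real^2) set" where
  "stable_cone P \<delta> = (\<Union>\<sigma>\<in>signs (-1). shifted_sector P \<delta> \<sigma>)"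

text \<open>A continuous family of norms on the tangent spaces of \<open>M\<close>; the last conjunct says that it
  descends from \<open>\<real>\<^sup>2\<close> to \<open>M\<close>.\<close>

definition norm_family :: "(real^2 \<Rightarrow> real^2 \<Rightarrow> real) \<Rightarrow> bool" where
  "norm_family N \<longleftrightarrow>
     (\<forall>x v. 0 \<le> N x v) \<and>
     (\<forall>x v. N x v = 0 \<longleftrightarrow> v = 0) \<and>
     (\<forall>x c v. N x (c *\<^sub>R v) = \<bar>c\<bar> * N x v) \<and>
     (\<forall>x u v. N x (u + v) \<le> N x u + N x v) \<and>
     continuous_on UNIV (\<lambda>(x, v). N x v) \<and>
     (\<forall>x y. torus_proj x = torus_proj y \<longrightarrow> N x = N y)"

text \<open>\<open>F\<close> and \<open>G\<close> are lifts of a diffeomorphism and of its inverse, respectively.\<close>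

definition anosov_const_cones ::
    "(real^2) set \<Rightarrow> (real^2) set \<Rightarrow> (real^2 \<Rightarrow> real^2) \<Rightarrow> (real^2 \<Rightarrow> real^2) \<Rightarrow> bool" where
  "anosov_const_cones Ku Ks F G \<longleftrightarrow>
     (\<exists>N l. norm_family N \<and> 1 < l \<and>
        (\<forall>x. tangent_map F x ` closure Ku \<subseteq> Ku \<union> {0} \<and>
             tangent_map G x ` closure Ks \<subseteq> Ks \<union> {0} \<and>
             (\<forall>v \<in> closure Ku - {0}. N (F x) (tangent_map F x v) > l * N x v) \<and>
             (\<forall>v \<in> closure Ks - {0}. N (G x) (tangent_map G x v) > l * N x v)))"

definition induced_cone_fields ::
    "real^2^2 \<Rightarrow> (real^2 \<Rightarrow> real^2) \<Rightarrow> (real^2 \<Rightarrow> real^2) \<Rightarrow> bool" where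
  "induced_cone_fields P F G \<longleftrightarrow> anosov_const_cones (unstable_cone P 0) (stable_cone P 0) F G"

text \<open>Being Anosov is part of \<open>sec_condition\<close>, through \<open>anosov_const_cones\<close>.\<close>

definition sec_condition :: "real^2^2 \<Rightarrow> (complex^2 \<Rightarrow> complex^2) \<Rightarrow> bool" where
  "sec_condition P T \<longleftrightarrow>
     (\<exists>F G. torus_lift T F \<and> torus_lift (torus_inv T) G \<and>
        induced_cone_fields P F G \<and>
        (\<exists>\<delta>\<in>pos_vecs. \<exists>\<delta>'\<in>pos_vecs. \<exists>\<sigma>\<in>signs 1. \<exists>\<sigma>'\<in>signs (-1). \<forall>x.
           tangent_map F x (cone_apex P \<delta> \<sigma>) \<in> unstable_cone P \<delta> \<and>
           tangent_map G x (cone_apex P \<delta>' \<sigma>') \<in> stable_cone P \<delta>'))"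

section \<open>Cone-wise exponential weights\<close>

definition real_vec :: "int^2 \<Rightarrow> real^2" where
  "real_vec n = (\<chi> i. real_of_int (n$i))"

text \<open>The third parameter enters with the sign convention of \<open>\<nu>\<^bsub>P,\<alpha>,-\<gamma>\<^esub>\<close>:
  \<open>cone_weight P \<alpha> (- \<gamma>)\<close> equals \<open>exp (\<gamma> \<bullet> |m|)\<close> where \<open>m$1 * m$2 < 0\<close>.\<close>

definition cone_weight :: "real^2^2 \<Rightarrow> real^2 \<Rightarrow> real^2 \<Rightarrow> int^2 \<Rightarrow> real" where
  "cone_weight P \<alpha> \<beta> n =
     (let m = transpose P *v real_vec n; a = (\<chi> i. \<bar>m$i\<bar>)
      in if m$1 * m$2 \<ge> 0 then exp (- (\<alpha> \<bullet> a)) else exp (- (\<beta> \<bullet> a)))"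

definition piecewise_linear_on_cones :: "(real^2 \<Rightarrow> real) \<Rightarrow> bool" where
  "piecewise_linear_on_cones f \<longleftrightarrow>
     (\<exists>\<C>. finite \<C> \<and> \<Union>\<C> = UNIV \<and>
        (\<forall>C\<in>\<C>. cone C \<and> convex C \<and> (\<exists>g. linear g \<and> (\<forall>x\<in>C. f x = g x))))"

definition cone_wise_exponential :: "(int^2 \<Rightarrow> real) \<Rightarrow> bool" where
  "cone_wise_exponential \<nu> \<longleftrightarrow>
     (\<exists>f. piecewise_linear_on_cones f \<and> (\<forall>n. \<nu> n = exp (f (real_vec n))))"

section \<open>The weighted Hilbert space\<close>

text \<open>Laurent polynomials, and more generally the elements of the Hilbert space, are represented by
  their families of (Fourier) coefficients.\<close>

definition laurent_poly :: "(int^2 \<Rightarrow> complex) \<Rightarrow> bool" where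
  "laurent_poly f \<longleftrightarrow> finite {n. f n \<noteq> 0}"

definition laurent_eval :: "(int^2 \<Rightarrow> complex) \<Rightarrow> complex^2 \<Rightarrow> complex" where
  "laurent_eval f z = (\<Sum>n | f n \<noteq> 0. f n * (z$1 powi (n$1) * z$2 powi (n$2)))"

definition fourier_coeff :: "(complex^2 \<Rightarrow> complex) \<Rightarrow> int^2 \<Rightarrow> complex" where
  "fourier_coeff g n =
     complex_of_real (1 / (2 * pi)^2) *
     integral (cbox 0 (\<chi> i. 2 * pi)) (\<lambda>x. g (torus_proj x) * cis (- (real_vec n \<bullet> x)))"

definition winner :: "(int^2 \<Rightarrow> real) \<Rightarrow> (int^2 \<Rightarrow> complex) \<Rightarrow> (int^2 \<Rightarrow> complex) \<Rightarrow> complex" where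
  "winner \<nu> f g = (\<Sum>\<^sub>\<infinity>n. f n * cnj (g n) * complex_of_real ((\<nu> n)\<^sup>2))"

definition wnorm :: "(int^2 \<Rightarrow> real) \<Rightarrow> (int^2 \<Rightarrow> complex) \<Rightarrow> real" where
  "wnorm \<nu> f = sqrt (Re (winner \<nu> f f))"

text \<open>The completion of the Laurent polynomials, realised as a weighted \<open>\<ell>\<^sup>2\<close> space. That it is
  a completion is the content of \<open>laurent_poly_in_wspace\<close>, \<open>laurent_poly_dense\<close> and
  \<open>wspace_complete\<close> below.\<close>

definition wspace :: "(int^2 \<Rightarrow> real) \<Rightarrow> (int^2 \<Rightarrow> complex) set" where
  "wspace \<nu> = {f. (\<lambda>n. (cmod (f n))\<^sup>2 * (\<nu> n)\<^sup>2) summable_on UNIV}"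

lemma winner_self:
  "winner \<nu> f f = complex_of_real (\<Sum>\<^sub>\<infinity>n. (cmod (f n))\<^sup>2 * (\<nu> n)\<^sup>2)"
proof -
  have "f n * cnj (f n) * complex_of_real ((\<nu> n)\<^sup>2) = complex_of_real ((cmod (f n))\<^sup>2 * (\<nu> n)\<^sup>2)" for n
    by (simp add: complex_norm_square[symmetric])
  moreover
  have "(\<lambda>n. complex_of_real (h n)) summable_on UNIV \<longleftrightarrow> h summable_on UNIV" for h :: "int^2 \<Rightarrow> real"
    using summable_on_bounded_linear[OF bounded_linear_Re, of "\<lambda>n. complex_of_real (h n)" UNIV]
      summable_on_of_real[of h UNIV, where 'a = complex] by auto
  then have "(\<Sum>\<^sub>\<infinity>n. complex_of_real (h n)) = complex_of_real (infsum h UNIV)" for h :: "int^2 \<Rightarrow> real"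
    by (rule infsum_bounded_linear_strong[OF _ bounded_linear_of_real])
  ultimately show ?thesis
    unfolding winner_def by (simp only:)
qed

lemma wnorm_eq: "wnorm \<nu> f = sqrt (\<Sum>\<^sub>\<infinity>n. (cmod (f n))\<^sup>2 * (\<nu> n)\<^sup>2)"
  by (simp add: wnorm_def winner_self)

lemma wnorm_nonneg: "0 \<le> wnorm \<nu> f"
  unfolding wnorm_eq by (intro real_sqrt_ge_zero infsum_nonneg) auto

lemma wspace_finite_sum_le:
  assumes "f \<in> wspace \<nu>" "finite A"
  shows "(\<Sum>n\<in>A. (cmod (f n))\<^sup>2 * (\<nu> n)\<^sup>2) \<le> (wnorm \<nu> f)\<^sup>2"
proof -
  have "(wnorm \<nu> f)\<^sup>2 = (\<Sum>\<^sub>\<infinity>n. (cmod (f n))\<^sup>2 * (\<nu> n)\<^sup>2)"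
    unfolding wnorm_eq by (intro real_sqrt_pow2 infsum_nonneg) auto
  then show ?thesis
    using assms by (auto simp: wspace_def intro!: finite_sum_le_infsum)
qed

lemma wspace_of_finite_sums:
  assumes "0 \<le> C" "\<And>A. finite A \<Longrightarrow> (\<Sum>n\<in>A. (cmod (f n))\<^sup>2 * (\<nu> n)\<^sup>2) \<le> C\<^sup>2"
  shows "f \<in> wspace \<nu>" "wnorm \<nu> f \<le> C"
proof -
  let ?h = "\<lambda>n. (cmod (f n))\<^sup>2 * (\<nu> n)\<^sup>2"
  have s: "?h summable_on UNIV"
    by (rule nonneg_bdd_above_summable_on) (use assms(2) in \<open>auto intro!: bdd_aboveI[of _ "C\<^sup>2"]\<close>)
  then show "f \<in> wspace \<nu>" by (simp add: wspace_def)
  have "infsum ?h UNIV \<le> C\<^sup>2"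
    by (rule infsum_le_finite_sums[OF s]) (use assms(2) in auto)
  then show "wnorm \<nu> f \<le> C"
    unfolding wnorm_eq using assms(1) by (simp add: real_le_lsqrt)
qed

lemma wspace_diff:
  assumes "f \<in> wspace \<nu>" "g \<in> wspace \<nu>"
  shows "(\<lambda>n. f n - g n) \<in> wspace \<nu>" "wnorm \<nu> (\<lambda>n. f n - g n) \<le> wnorm \<nu> f + wnorm \<nu> g"
proof -
  have *: "(\<Sum>n\<in>A. (cmod (f n - g n))\<^sup>2 * (\<nu> n)\<^sup>2) \<le> (wnorm \<nu> f + wnorm \<nu> g)\<^sup>2" if A: "finite A" for A
  proof -
    have L: "L2_set (\<lambda>n. cmod (h n) * \<bar>\<nu> n\<bar>) A \<le> wnorm \<nu> h" if "h \<in> wspace \<nu>" for h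
      unfolding L2_set_def using wspace_finite_sum_le[OF that A] wnorm_nonneg[of \<nu> h]
      by (simp add: power_mult_distrib real_le_lsqrt)
    have "L2_set (\<lambda>n. cmod (f n - g n) * \<bar>\<nu> n\<bar>) A
          \<le> L2_set (\<lambda>n. cmod (f n) * \<bar>\<nu> n\<bar> + cmod (g n) * \<bar>\<nu> n\<bar>) A"
    proof (rule L2_set_mono)
      fix n
      have "cmod (f n - g n) * \<bar>\<nu> n\<bar> \<le> (cmod (f n) + cmod (g n)) * \<bar>\<nu> n\<bar>"
        by (intro mult_right_mono norm_triangle_ineq4) auto
      then show "cmod (f n - g n) * \<bar>\<nu> n\<bar> \<le> cmod (f n) * \<bar>\<nu> n\<bar> + cmod (g n) * \<bar>\<nu> n\<bar>"
        by (simp add: distrib_right)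
    qed auto
    also have "\<dots> \<le> wnorm \<nu> f + wnorm \<nu> g"
      using L2_set_triangle_ineq[of "\<lambda>n. cmod (f n) * \<bar>\<nu> n\<bar>" "\<lambda>n. cmod (g n) * \<bar>\<nu> n\<bar>" A]
        L[OF assms(1)] L[OF assms(2)] by linarith
    finally have "(L2_set (\<lambda>n. cmod (f n - g n) * \<bar>\<nu> n\<bar>) A)\<^sup>2 \<le> (wnorm \<nu> f + wnorm \<nu> g)\<^sup>2"
      by (intro power_mono) (auto simp: L2_set_nonneg)
    then show ?thesis
      by (simp add: L2_set_def power_mult_distrib sum_nonneg)
  qed
  have "0 \<le> wnorm \<nu> f + wnorm \<nu> g" by (simp add: wnorm_nonneg)
  from wspace_of_finite_sums[OF this *] show
    "(\<lambda>n. f n - g n) \<in> wspace \<nu>" "wnorm \<nu> (\<lambda>n. f n - g n) \<le> wnorm \<nu> f + wnorm \<nu> g" by auto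
qed

lemma laurent_poly_in_wspace:
  assumes "laurent_poly f" shows "f \<in> wspace \<nu>"
  unfolding wspace_def mem_Collect_eq
  by (rule finite_nonzero_values_imp_summable_on)
     (rule finite_subset[OF _ assms[unfolded laurent_poly_def]], auto)

lemma laurent_poly_dense:
  assumes f: "f \<in> wspace \<nu>" and e: "0 < e"
  obtains g where "laurent_poly g" "wnorm \<nu> (\<lambda>n. f n - g n) < e"
proof -
  let ?h = "\<lambda>n. (cmod (f n))\<^sup>2 * (\<nu> n)\<^sup>2"
  have s: "?h summable_on UNIV" using f by (simp add: wspace_def)
  obtain X where X: "finite X" "dist (sum ?h X) (infsum ?h UNIV) \<le> (e/2)\<^sup>2"
    using infsum_finite_approximation[OF s, of "(e/2)\<^sup>2"] e by auto
  define g where "g n = (if n \<in> X then f n else 0)" for n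
  have "(\<Sum>n\<in>A. (cmod (f n - g n))\<^sup>2 * (\<nu> n)\<^sup>2) \<le> (e/2)\<^sup>2" if A: "finite A" for A
  proof -
    have "(\<Sum>n\<in>A. (cmod (f n - g n))\<^sup>2 * (\<nu> n)\<^sup>2) = sum ?h (A - X)"
      using A by (intro sum.mono_neutral_cong_right) (auto simp: g_def)
    also have "\<dots> = sum ?h ((A - X) \<union> X) - sum ?h X"
      using A X by (subst sum.union_disjoint) auto
    also have "\<dots> \<le> infsum ?h UNIV - sum ?h X"
      using A X s by (intro diff_right_mono finite_sum_le_infsum) auto
    also have "\<dots> \<le> (e/2)\<^sup>2" using X(2) by (simp add: dist_real_def)
    finally show ?thesis .
  qed
  then have "wnorm \<nu> (\<lambda>n. f n - g n) \<le> e/2"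
    using e by (intro wspace_of_finite_sums(2)) auto
  moreover have "laurent_poly g"
    unfolding laurent_poly_def by (rule finite_subset[OF _ X(1)]) (auto simp: g_def)
  ultimately show ?thesis using that e by force
qed

lemma wspace_complete:
  assumes pos: "\<And>n. 0 < \<nu> n" and F: "\<And>k::nat. F k \<in> wspace \<nu>"
    and Cauchy: "\<And>e. 0 < e \<Longrightarrow> \<exists>N. \<forall>i\<ge>N. \<forall>j\<ge>N. wnorm \<nu> (\<lambda>n. F i n - F j n) < e"
  obtains f where "f \<in> wspace \<nu>" "(\<lambda>k. wnorm \<nu> (\<lambda>n. F k n - f n)) \<longlonglongrightarrow> 0"
proof -
  have "\<exists>l. (\<lambda>k. F k n) \<longlonglongrightarrow> l" for n
  proof -
    have "Cauchy (\<lambda>k. F k n)"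
    proof (rule CauchyI)
      fix e :: real assume e: "0 < e"
      obtain N where N: "\<And>i j. i \<ge> N \<Longrightarrow> j \<ge> N \<Longrightarrow> wnorm \<nu> (\<lambda>n. F i n - F j n) < e * \<nu> n"
        using Cauchy[of "e * \<nu> n"] e pos[of n] by auto
      have "cmod (F i n - F j n) < e" if "i \<ge> N" "j \<ge> N" for i j
      proof -
        have "(cmod (F i n - F j n) * \<nu> n)\<^sup>2 \<le> (wnorm \<nu> (\<lambda>n. F i n - F j n))\<^sup>2"
          using wspace_finite_sum_le[OF wspace_diff(1)[OF F F], of "{n}" i j]
          by (simp add: power_mult_distrib)
        then have "cmod (F i n - F j n) * \<nu> n \<le> wnorm \<nu> (\<lambda>n. F i n - F j n)"
          by (rule power2_le_imp_le) (rule wnorm_nonneg)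
        also have "\<dots> < e * \<nu> n" using N that by blast
        finally show ?thesis using pos[of n] by simp
      qed
      then show "\<exists>M. \<forall>m\<ge>M. \<forall>k\<ge>M. cmod (F m n - F k n) < e" by blast
    qed
    then show ?thesis by (simp add: Cauchy_convergent_iff convergent_def)
  qed
  then obtain f where f: "\<And>n. (\<lambda>k. F k n) \<longlonglongrightarrow> f n" by metis
  have lim: "\<exists>N. \<forall>i\<ge>N. (\<lambda>n. F i n - f n) \<in> wspace \<nu> \<and> wnorm \<nu> (\<lambda>n. F i n - f n) \<le> e"
    if e: "0 < e" for e
  proof -
    obtain N where N: "\<And>i j. i \<ge> N \<Longrightarrow> j \<ge> N \<Longrightarrow> wnorm \<nu> (\<lambda>n. F i n - F j n) < e"
      using Cauchy[OF e] by auto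
    have "(\<Sum>n\<in>A. (cmod (F i n - f n))\<^sup>2 * (\<nu> n)\<^sup>2) \<le> e\<^sup>2" if i: "i \<ge> N" and A: "finite A" for i A
    proof (rule tendsto_upperbound)
      show "((\<lambda>j. \<Sum>n\<in>A. (cmod (F i n - F j n))\<^sup>2 * (\<nu> n)\<^sup>2) \<longlongrightarrow>
              (\<Sum>n\<in>A. (cmod (F i n - f n))\<^sup>2 * (\<nu> n)\<^sup>2)) sequentially"
        by (intro tendsto_intros f)
      show "\<forall>\<^sub>F j in sequentially. (\<Sum>n\<in>A. (cmod (F i n - F j n))\<^sup>2 * (\<nu> n)\<^sup>2) \<le> e\<^sup>2"
      proof (rule eventually_sequentiallyI)
        fix j assume "N \<le> j"
        then have "(wnorm \<nu> (\<lambda>n. F i n - F j n))\<^sup>2 \<le> e\<^sup>2"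
          using N[OF i, of j] wnorm_nonneg by (intro power_mono) auto
        then show "(\<Sum>n\<in>A. (cmod (F i n - F j n))\<^sup>2 * (\<nu> n)\<^sup>2) \<le> e\<^sup>2"
          using wspace_finite_sum_le[OF wspace_diff(1)[OF F F] A, of i j] by linarith
      qed
    qed simp
    note * = this
    show ?thesis
    proof (intro exI[of _ N] allI impI conjI)
      fix i assume i: "N \<le> i"
      show "(\<lambda>n. F i n - f n) \<in> wspace \<nu>"
        by (rule wspace_of_finite_sums(1)[of e]) (use e *[OF i] in auto)
      show "wnorm \<nu> (\<lambda>n. F i n - f n) \<le> e"
        by (rule wspace_of_finite_sums(2)) (use e *[OF i] in auto)
    qed
  qed
  obtain i where "(\<lambda>n. F i n - f n) \<in> wspace \<nu>" using lim[of 1] by auto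
  from wspace_diff(1)[OF F[of i] this] have "f \<in> wspace \<nu>" by simp
  moreover have "(\<lambda>k. wnorm \<nu> (\<lambda>n. F k n - f n)) \<longlonglongrightarrow> 0"
  proof (rule LIMSEQ_I)
    fix r :: real assume r: "0 < r"
    then obtain N where N: "\<And>k. k \<ge> N \<Longrightarrow> wnorm \<nu> (\<lambda>n. F k n - f n) \<le> r/2"
      using lim[of "r/2"] by auto
    have "norm (wnorm \<nu> (\<lambda>n. F k n - f n) - 0) < r" if "k \<ge> N" for k
      using N[OF that] r wnorm_nonneg[of \<nu> "\<lambda>n. F k n - f n"] by simp
    then show "\<exists>no. \<forall>k\<ge>no. norm (wnorm \<nu> (\<lambda>n. F k n - f n) - 0) < r" by blast
  qed
  ultimately show ?thesis by (rule that)
qed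

section \<open>Trace-class operators\<close>

text \<open>Operators on \<open>wspace \<nu>\<close> are functions on coefficient families of which only the values on
  \<open>wspace \<nu>\<close> matter.\<close>

type_synonym coeff_op = "(int^2 \<Rightarrow> complex) \<Rightarrow> (int^2 \<Rightarrow> complex)"

definition bounded_op :: "(int^2 \<Rightarrow> real) \<Rightarrow> coeff_op \<Rightarrow> bool" where
  "bounded_op \<nu> A \<longleftrightarrow>
     (\<forall>f\<in>wspace \<nu>. A f \<in> wspace \<nu>) \<and>
     (\<forall>f\<in>wspace \<nu>. \<forall>g\<in>wspace \<nu>. A (\<lambda>n. f n + g n) = (\<lambda>n. A f n + A g n)) \<and>
     (\<forall>c. \<forall>f\<in>wspace \<nu>. A (\<lambda>n. c * f n) = (\<lambda>n. c * A f n)) \<and>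
     (\<exists>C. \<forall>f\<in>wspace \<nu>. wnorm \<nu> (A f) \<le> C * wnorm \<nu> f)"

definition op_norm :: "(int^2 \<Rightarrow> real) \<Rightarrow> coeff_op \<Rightarrow> real" where
  "op_norm \<nu> A = Sup {wnorm \<nu> (A f) | f. f \<in> wspace \<nu> \<and> wnorm \<nu> f \<le> 1}"

definition rank_at_most :: "(int^2 \<Rightarrow> real) \<Rightarrow> nat \<Rightarrow> coeff_op \<Rightarrow> bool" where
  "rank_at_most \<nu> k A \<longleftrightarrow>
     (\<exists>g :: nat \<Rightarrow> int^2 \<Rightarrow> complex. \<forall>f\<in>wspace \<nu>. \<exists>c. A f = (\<lambda>n. \<Sum>j<k. c j * g j n))"

text \<open>Singular values, defined as approximation numbers (distances to the operators of rank at
  most \<open>k\<close>) and indexed from 0.\<close>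

definition singular_value :: "(int^2 \<Rightarrow> real) \<Rightarrow> coeff_op \<Rightarrow> nat \<Rightarrow> real" where
  "singular_value \<nu> A k =
     Inf {op_norm \<nu> (\<lambda>f n. A f n - B f n) | B. bounded_op \<nu> B \<and> rank_at_most \<nu> k B}"

definition trace_class :: "(int^2 \<Rightarrow> real) \<Rightarrow> coeff_op \<Rightarrow> bool" where
  "trace_class \<nu> A \<longleftrightarrow> bounded_op \<nu> A \<and> summable (singular_value \<nu> A)"

section \<open>Weighted composition operators\<close>

definition weighted_comp :: "(complex^2 \<Rightarrow> complex) \<Rightarrow> (complex^2 \<Rightarrow> complex^2) \<Rightarrow> coeff_op" where
  "weighted_comp w T f = fourier_coeff (\<lambda>z. w z * laurent_eval f (T z))"

definition continuous_extension :: "(int^2 \<Rightarrow> real) \<Rightarrow> coeff_op \<Rightarrow> coeff_op \<Rightarrow> bool" where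
  "continuous_extension \<nu> L A \<longleftrightarrow>
     bounded_op \<nu> A \<and> (\<forall>f. laurent_poly f \<longrightarrow> A f = L f)"

end

theory Submission
  imports Defs "HOL-Complex_Analysis.Conformal_Mappings"
begin

text \<open>Let \<open>F\<close> be a lift of \<open>T\<close>. In the basis of Fourier modes the operator has the matrix entries
  \<open>\<integral> w(x) e\<^bsup>i m\<cdot>F(x)\<^esup> e\<^bsup>-i n\<cdot>x\<^esup> dx\<close>, up to a constant. The integrand is the restriction of a
  holomorphic function, so \<open>x\<close> may be replaced by \<open>x + i t \<eta>\<close>; this bounds the entry by a constant times
  \<open>exp (t n\<cdot>\<eta> - t m\<cdot>DF(x)\<eta> + O(t\<^sup>2|m|))\<close>, maximised over \<open>x\<close>. The substitution \<open>x = G(y)\<close>, where \<open>G\<close> lifts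
  \<open>T\<^sup>-\<^sup>1\<close>, turns the entry into one for \<open>G\<close> with \<open>(m, n)\<close> replaced by \<open>(-n, -m)\<close> and hence gives the
  dual bound. Let \<open>p = P\<^sup>T n\<close> and \<open>q = P\<^sup>T m\<close>. If \<open>q\<close> lies in the cone \<open>q\<^sub>1q\<^sub>2 \<ge> 0\<close>, then \<open>\<eta> = \<plusminus>P\<delta>\<close> and the
  (sec) condition for \<open>T\<close> give a gain of \<open>(1 + \<kappa>) \<delta>\<cdot>|q|\<close> against a loss of \<open>\<delta>\<cdot>|p|\<close>; this is compensated
  by the weights if both \<open>p\<close> and \<open>q\<close> lie in that cone, and dually if neither does. If only \<open>q\<close> does,
  the weights grow, but shifts along the edges of the cones lose nothing and yield decay in \<open>q\<close>
  and, dually, in \<open>p\<close>, at a rate that does not depend on the weights. If only \<open>p\<close> does, the weights alone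
  suffice. Altogether the matrix decays exponentially, which makes the operator trace class.\<close>

text \<open>Write D for \<open>Pinv\<close> DF P, the derivative in the coordinates of
  \<open>P\<close>. Cone invariance gives the two coordinates of D v, for nonzero v in the closed
  quadrant, a common sign, but no growth. What (sec) adds is one vector \<delta> such that both
  coordinates of D \<delta>, up to a common sign, exceed those of \<delta>. The inequality is
  strict: compactness turns it into a uniform margin, which absorbs the quadratic error for small t,
  and connectedness makes the sign independent of x, so that a single shift serves the whole
  integral. Gain and loss are then multiples of the same form \<delta>\<cdot>|.|, and this dictates
  the weights: \<alpha> = r \<delta> and \<gamma> = r \<delta>' with r = s (1 + \<kappa>/2), halfway
  between the loss rate s and the gain rate s (1 + \<kappa>). All this holds for every small s, and
  that freedom is essential: where the weights grow, the decay rate c is found before s, and s is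
  then taken so small that the growth stays below c. The cone estimates are proved for an abstract
  derivative and matrix, so that they serve \<open>T\<close> with \<open>P\<close> and its inverse
  with a reflected \<open>P\<close>.\<close>

abbreviation l1 :: "real^2 \<Rightarrow> real" where
  "l1 q \<equiv> \<bar>q$1\<bar> + \<bar>q$2\<bar>"

section \<open>Holomorphic functions depending on a parameter\<close>

text \<open>Puts Cauchy's formula over the fixed box \<open>cbox 0 1\<close>, where the theorems on
  integrals with a parameter apply. The factor 2 pi i in the velocity of the circle cancels the one
  in front.\<close>

lemma deriv_eq_circle_integral:
  assumes "continuous_on (cball z r) f" "f holomorphic_on ball z r" "w \<in> ball z r"
  shows "deriv f w = integral (cbox 0 1)
           (\<lambda>t. f (circlepath z r t) / (circlepath z r t - w)\<^sup>2 * (of_real r * exp (2 * of_real pi * \<i> * of_real t)))"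
proof -
  have "deriv f w = 1 / (2 * of_real pi * \<i>) * contour_integral (circlepath z r) (\<lambda>u. f u / (u - w)\<^sup>2)"
    using Cauchy_derivative_integral_circlepath(2)[OF assms] by (rule DERIV_imp_deriv)
  also have "\<dots> = integral (cbox 0 1) (\<lambda>t. 1 / (2 * of_real pi * \<i>) * (f (circlepath z r t) / (circlepath z r t - w)\<^sup>2 * vector_derivative (circlepath z r) (at t)))"
    unfolding contour_integral_integral cbox_interval integral_mult_right by (rule refl)
  also have "\<dots> = integral (cbox 0 1)
           (\<lambda>t. f (circlepath z r t) / (circlepath z r t - w)\<^sup>2 * (of_real r * exp (2 * of_real pi * \<i> * of_real t)))"
    by (rule integral_cong) (auto simp: vector_derivative_circlepath field_simps)
  finally show ?thesis .
qed

text \<open>Cauchy's formula turns the derivative into an integral over a circle, and its integrand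
  is continuous in \<open>x\<close> and \<open>z\<close> jointly.\<close>

lemma continuous_on_deriv_param:
  fixes f :: "'a::topological_space \<Rightarrow> complex \<Rightarrow> complex"
  assumes "open U" and cont: "continuous_on (S \<times> U) (\<lambda>(x, z). f x z)"
    and hol: "\<And>x. x \<in> S \<Longrightarrow> f x holomorphic_on U"
  shows "continuous_on (S \<times> U) (\<lambda>(x, z). deriv (f x) z)"
  unfolding continuous_on_def
proof
  fix p assume p: "p \<in> S \<times> U"
  obtain x0 z0 where [simp]: "p = (x0, z0)" by fastforce
  from p have "z0 \<in> U" "x0 \<in> S" by auto
  with \<open>open U\<close> obtain r where r: "r > 0" "cball z0 r \<subseteq> U" by (meson open_contains_cball)
  let ?F = "\<lambda>p t. f (fst p) (circlepath z0 r t) / (circlepath z0 r t - snd p)\<^sup>2 * (of_real r * exp (2 * of_real pi * \<i> * of_real t))"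
  have mem: "circlepath z0 r t \<in> cball z0 r" for t
    using r by (simp add: circlepath dist_norm norm_mult)
  have ne: "circlepath z0 r t \<noteq> w" if "w \<in> ball z0 r" for t w
    using r that by (auto simp: circlepath dist_norm norm_mult)
  have contp: "continuous_on ((S \<times> ball z0 r) \<times> cbox 0 1) (\<lambda>y. f (fst (fst y)) (circlepath z0 r (snd y)))"
  proof -
    have "continuous_on ((S \<times> ball z0 r) \<times> cbox 0 1) (\<lambda>y. (\<lambda>(x, z). f x z) (fst (fst y), circlepath z0 r (snd y)))"
      by (rule continuous_on_compose2[OF cont])
         (use mem r in \<open>auto simp: circlepath intro!: continuous_intros\<close>)
    then show ?thesis by simp
  qed
  have "continuous_on ((S \<times> ball z0 r) \<times> cbox 0 1) (\<lambda>(p, t). ?F p t)"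
    unfolding case_prod_beta
    by (intro continuous_intros contp) (use ne in \<open>auto simp: circlepath intro!: continuous_intros\<close>)
  then have "continuous_on (S \<times> ball z0 r) (\<lambda>p. integral (cbox 0 1) (?F p))"
    by (rule integral_continuous_on_param)
  moreover have "integral (cbox 0 1) (?F p) = (case p of (x, z) \<Rightarrow> deriv (f x) z)" if "p \<in> S \<times> ball z0 r" for p
  proof -
    have h: "f (fst p) holomorphic_on U" and m: "snd p \<in> ball z0 r" using that hol by auto
    show ?thesis
      unfolding case_prod_beta
      using r by (intro deriv_eq_circle_integral[symmetric] holomorphic_on_imp_continuous_on m
          holomorphic_on_subset[OF h]) auto
  qed
  ultimately have "continuous_on (S \<times> ball z0 r) (\<lambda>(x, z). deriv (f x) z)"
    by (simp cong: continuous_on_cong)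
  then have "((\<lambda>(x, z). deriv (f x) z) \<longlongrightarrow> (\<lambda>(x, z). deriv (f x) z) p) (at p within (S \<times> ball z0 r))"
    using p r unfolding continuous_on_def by auto
  moreover have "at p within (S \<times> ball z0 r) = at p within S \<times> U"
    by (rule at_within_nhd[of _ "UNIV \<times> ball z0 r"]) (use r in \<open>auto simp: open_Times\<close>)
  ultimately show "((\<lambda>(x, z). deriv (f x) z) \<longlongrightarrow> (\<lambda>(x, z). deriv (f x) z) p) (at p within (S \<times> U))"
    by simp
qed

text \<open>Differentiation under the integral asks for a jointly continuous z-derivative of the
  integrand; \<open>continuous_on_deriv_param\<close> derives this from joint continuity and
  holomorphy in \<open>z\<close>.\<close>

lemma holomorphic_on_integral_param:
  fixes f :: "complex \<Rightarrow> 'b::euclidean_space \<Rightarrow> complex"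
  assumes "open U" "convex U" and cont: "continuous_on (U \<times> cbox a b) (\<lambda>(z, x). f z x)"
    and hol: "\<And>x. x \<in> cbox a b \<Longrightarrow> (\<lambda>z. f z x) holomorphic_on U"
  shows "(\<lambda>z. integral (cbox a b) (f z)) holomorphic_on U"
proof (rule leibniz_rule_holomorphic[where fx = "\<lambda>z x. deriv (\<lambda>z. f z x) z"])
  show "((\<lambda>z. f z x) has_field_derivative deriv (\<lambda>z. f z x) z) (at z within U)" if "z \<in> U" "x \<in> cbox a b" for z x
    using hol[OF that(2)] that \<open>open U\<close>
    by (meson DERIV_deriv_iff_field_differentiable has_field_derivative_at_within holomorphic_on_imp_differentiable_at)
  show "f z integrable_on cbox a b" if "z \<in> U" for z
  proof (rule integrable_continuous)
    have "continuous_on (cbox a b) (\<lambda>x. (\<lambda>(z, x). f z x) (z, x))"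
      by (rule continuous_on_compose2[OF cont]) (use that in \<open>auto intro!: continuous_intros\<close>)
    then show "continuous_on (cbox a b) (f z)" by simp
  qed
  have "continuous_on (cbox a b \<times> U) (\<lambda>y. (\<lambda>(z, x). f z x) (snd y, fst y))"
    by (rule continuous_on_compose2[OF cont]) (auto intro!: continuous_intros)
  then have "continuous_on (cbox a b \<times> U) (\<lambda>(x, z). (\<lambda>z. f z x) z)"
    by (simp add: case_prod_beta)
  then have c: "continuous_on (cbox a b \<times> U) (\<lambda>(x, z). deriv (\<lambda>z. f z x) z)"
    using continuous_on_deriv_param[OF \<open>open U\<close>, of "cbox a b" "\<lambda>x z. f z x"] hol by blast
  have "continuous_on (U \<times> cbox a b) (\<lambda>y. (\<lambda>(x, z). deriv (\<lambda>z. f z x) z) (snd y, fst y))"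
    by (rule continuous_on_compose2[OF c]) (auto intro!: continuous_intros)
  then show "continuous_on (U \<times> cbox a b) (\<lambda>(z, x). deriv (\<lambda>z. f z x) z)"
    by (simp add: case_prod_beta)
qed fact

text \<open>Cauchy's formula in \<open>z\<close> exhibits the derivative as an integral whose
  integrand is holomorphic in \<open>w\<close>.\<close>

lemma holomorphic_on_deriv_param:
  fixes f :: "complex \<Rightarrow> complex \<Rightarrow> complex"
  assumes "open U" "convex U" "open V" "z \<in> V"
    and cont: "continuous_on (U \<times> V) (\<lambda>(w, z). f w z)"
    and hol1: "\<And>z. z \<in> V \<Longrightarrow> (\<lambda>w. f w z) holomorphic_on U"
    and hol2: "\<And>w. w \<in> U \<Longrightarrow> f w holomorphic_on V"
  shows "(\<lambda>w. deriv (f w) z) holomorphic_on U"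
proof -
  obtain r where r: "r > 0" "cball z r \<subseteq> V" using assms by (meson open_contains_cball)
  let ?F = "\<lambda>w t. f w (circlepath z r t) / (circlepath z r t - z)\<^sup>2 * (of_real r * exp (2 * of_real pi * \<i> * of_real t))"
  have mem: "circlepath z r t \<in> V" for t
  proof -
    have "circlepath z r t \<in> cball z r"
      using r by (simp add: circlepath dist_norm norm_mult)
    then show ?thesis using r by blast
  qed
  have ne: "circlepath z r t \<noteq> z" for t
    using r by (auto simp: circlepath dist_norm norm_mult)
  have contp: "continuous_on (U \<times> cbox 0 1) (\<lambda>y. f (fst y) (circlepath z r (snd y)))"
  proof -
    have "continuous_on (U \<times> cbox 0 1) (\<lambda>y. (\<lambda>(x, z). f x z) (fst y, circlepath z r (snd y)))"
      by (rule continuous_on_compose2[OF cont])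
         (use mem r in \<open>auto simp: circlepath intro!: continuous_intros\<close>)
    then show ?thesis by simp
  qed
  have "(\<lambda>w. integral (cbox 0 1) (?F w)) holomorphic_on U"
  proof (rule holomorphic_on_integral_param)
    show "continuous_on (U \<times> cbox 0 1) (\<lambda>(p, t). ?F p t)"
      unfolding case_prod_beta
      by (intro continuous_intros contp) (use ne in \<open>auto simp: circlepath intro!: continuous_intros\<close>)
    show "(\<lambda>w. ?F w t) holomorphic_on U" for t
      using ne by (intro holomorphic_intros hol1 mem) auto
  qed (use assms in auto)
  moreover have "integral (cbox 0 1) (?F w) = deriv (f w) z" if "w \<in> U" for w
    using r by (intro deriv_eq_circle_integral[symmetric] holomorphic_on_imp_continuous_on
        holomorphic_on_subset[OF hol2[OF that]]) auto
  ultimately show ?thesis by (simp cong: holomorphic_cong)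
qed

section \<open>Holomorphic functions of two variables\<close>

text \<open>Joint holomorphy: a Frechet derivative of the form A h1 + B h2 is complex linear. It is
  taken \<open>at z\<close> and not within \<open>D\<close>, so the notion passes to subsets and is
  local.\<close>

definition holo2 :: "(complex \<times> complex) set \<Rightarrow> (complex \<times> complex \<Rightarrow> complex) \<Rightarrow> bool" where
  "holo2 D H \<longleftrightarrow> (\<forall>z\<in>D. \<exists>A B. (H has_derivative (\<lambda>h. A * fst h + B * snd h)) (at z))"

lemma open_contains_ball_prod:
  assumes "open D" "p \<in> D"
  obtains r where "r > 0" "ball (fst p) r \<times> ball (snd p) r \<subseteq> D"
proof -
  obtain X Y where XY: "open X" "open Y" "p \<in> X \<times> Y" "X \<times> Y \<subseteq> D"
    using assms by (rule open_prod_elim)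
  then have "fst p \<in> X" "snd p \<in> Y" by auto
  then obtain r1 r2 where r: "r1 > 0" "ball (fst p) r1 \<subseteq> X" "r2 > 0" "ball (snd p) r2 \<subseteq> Y"
    using XY(1,2) unfolding open_contains_ball by meson
  then have "ball (fst p) (min r1 r2) \<subseteq> X" "ball (snd p) (min r1 r2) \<subseteq> Y" by auto
  then have "ball (fst p) (min r1 r2) \<times> ball (snd p) (min r1 r2) \<subseteq> D"
    using XY(4) by blast
  then show ?thesis using r by (intro that[of "min r1 r2"]) auto
qed

lemma holo2_local:
  assumes "\<And>p. p \<in> D \<Longrightarrow> \<exists>E. p \<in> E \<and> holo2 E K"
  shows "holo2 D K"
  unfolding holo2_def
proof
  fix p assume "p \<in> D"
  then obtain E where "p \<in> E" "holo2 E K" using assms by blast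
  then show "\<exists>A B. (K has_derivative (\<lambda>h. A * fst h + B * snd h)) (at p)"
    unfolding holo2_def by blast
qed

lemma holo2_continuous_on: "holo2 D H \<Longrightarrow> continuous_on D H"
  unfolding holo2_def
  by (blast intro: continuous_at_imp_continuous_on has_derivative_continuous)

lemma holo2_subset: "holo2 D H \<Longrightarrow> E \<subseteq> D \<Longrightarrow> holo2 E H"
  unfolding holo2_def by blast

lemma has_field_derivative_holo2_line:
  assumes "(H has_derivative (\<lambda>h. A * fst h + B * snd h)) (at (a z, b z))"
    and "(a has_field_derivative a') (at z)" "(b has_field_derivative b') (at z)"
  shows "((\<lambda>z. H (a z, b z)) has_field_derivative (A * a' + B * b')) (at z)"
proof -
  have "((\<lambda>z. (a z, b z)) has_derivative (\<lambda>h. (a' * h, b' * h))) (at z)"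
    using assms(2,3) unfolding has_field_derivative_def by (rule has_derivative_Pair)
  from has_derivative_compose[OF this assms(1)]
  have "((\<lambda>z. H (a z, b z)) has_derivative (\<lambda>h. A * (a' * h) + B * (b' * h))) (at z)" by simp
  moreover have "(\<lambda>h. A * (a' * h) + B * (b' * h)) = (*) (A * a' + B * b')"
    by (rule ext) (simp add: algebra_simps)
  ultimately show ?thesis unfolding has_field_derivative_def by simp
qed

lemma holo2_holomorphic_on:
  assumes "holo2 D H" "a holomorphic_on S" "b holomorphic_on S" "open S"
    "\<And>z. z \<in> S \<Longrightarrow> (a z, b z) \<in> D"
  shows "(\<lambda>z. H (a z, b z)) holomorphic_on S"
  unfolding holomorphic_on_open[OF assms(4)]
proof
  fix z assume z: "z \<in> S"
  then obtain A B where "(H has_derivative (\<lambda>h. A * fst h + B * snd h)) (at (a z, b z))"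
    using assms(1,5) unfolding holo2_def by blast
  from has_field_derivative_holo2_line[where a = a and b = b and z = z, OF this
      holomorphic_derivI[OF assms(2,4) z] holomorphic_derivI[OF assms(3,4) z]]
  show "\<exists>f'. ((\<lambda>z. H (a z, b z)) has_field_derivative f') (at z)" by blast
qed

text \<open>Osgood's lemma. By Cauchy's formula the partial derivative in the second variable is
  jointly continuous, and together with the existence of the other partial derivative this gives
  differentiability.\<close>

lemma holo2I_separately:
  assumes D: "open D" and cont: "continuous_on D H"
    and hol1: "\<And>U y. open U \<Longrightarrow> U \<times> {y} \<subseteq> D \<Longrightarrow> (\<lambda>s. H (s, y)) holomorphic_on U"
    and hol2: "\<And>V s. open V \<Longrightarrow> {s} \<times> V \<subseteq> D \<Longrightarrow> (\<lambda>y. H (s, y)) holomorphic_on V"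
  shows "holo2 D H"
  unfolding holo2_def
proof
  fix p assume p: "p \<in> D"
  obtain s0 y0 where [simp]: "p = (s0, y0)" by fastforce
  obtain r where r: "r > 0" "ball (fst p) r \<times> ball (snd p) r \<subseteq> D"
    using D p by (rule open_contains_ball_prod)
  define X Y where "X = ball s0 r" and "Y = ball y0 r"
  have XY: "open X" "open Y" "s0 \<in> X" "y0 \<in> Y" "X \<times> Y \<subseteq> D" "convex Y"
    using r by (auto simp: X_def Y_def)
  have hX: "(\<lambda>s. H (s, y)) holomorphic_on X" if "y \<in> Y" for y
    using XY that by (intro hol1) auto
  have hY: "(\<lambda>y. H (s, y)) holomorphic_on Y" if "s \<in> X" for s
    using XY that by (intro hol2) auto
  have c: "continuous_on (X \<times> Y) (\<lambda>(s, y). H (s, y))"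
    using continuous_on_subset[OF cont XY(5)] by (simp add: case_prod_beta)
  have c': "continuous_on (X \<times> Y) (\<lambda>(s, y). deriv (\<lambda>y. H (s, y)) y)"
    by (rule continuous_on_deriv_param[OF XY(2) c hY])
  have "((\<lambda>(s, y). H (s, y)) has_derivative
      (\<lambda>(ts, ty). deriv (\<lambda>s. H (s, y0)) s0 * ts + blinfun_apply (blinfun_mult_right (deriv (\<lambda>y. H (s0, y)) y0)) ty)) (at (s0, y0) within X \<times> Y)"
  proof (rule has_derivative_partialsI)
    show "((\<lambda>s. H (s, y0)) has_derivative (\<lambda>ts. deriv (\<lambda>s. H (s, y0)) s0 * ts)) (at s0 within X)"
      using holomorphic_derivI[OF hX[OF XY(4)] XY(1) XY(3)]
      by (simp add: has_field_derivative_def has_derivative_at_withinI)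
    show "((\<lambda>y. H (s, y)) has_derivative blinfun_apply (blinfun_mult_right (deriv (\<lambda>y. H (s, y)) y))) (at y within Y)"
      if "s \<in> X" "y \<in> Y" for s y
      using holomorphic_derivI[OF hY[OF that(1)] XY(2) that(2)]
      by (simp add: has_field_derivative_def has_derivative_at_withinI)
    have "continuous_on (X \<times> Y) (\<lambda>p. blinfun_mult_right ((\<lambda>(s, y). deriv (\<lambda>y. H (s, y)) y) p))"
      by (intro bounded_linear.continuous_on[OF bounded_linear_blinfun_mult_right] c')
    then show "continuous (at (s0, y0) within X \<times> Y) (\<lambda>(s, y). blinfun_mult_right (deriv (\<lambda>y. H (s, y)) y))"
      using XY by (auto simp: continuous_on_eq_continuous_within split_beta')
  qed (use XY in auto)
  then have "(H has_derivative
      (\<lambda>h. deriv (\<lambda>s. H (s, y0)) s0 * fst h + deriv (\<lambda>y. H (s0, y)) y0 * snd h)) (at p within X \<times> Y)"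
    by (simp add: split_beta')
  moreover have "at p within X \<times> Y = at p"
    using XY by (intro at_within_open) (auto simp: open_Times)
  ultimately show "\<exists>A B. (H has_derivative (\<lambda>h. A * fst h + B * snd h)) (at p)" by auto
qed

lemma holo2_const: "holo2 D (\<lambda>z. c)"
  unfolding holo2_def
  by (intro ballI exI[of _ 0]) auto

lemma holo2_fst: "holo2 D fst"
  unfolding holo2_def
  by (intro ballI exI[of _ 1] exI[of _ 0]) (auto intro!: derivative_eq_intros)

lemma holo2_snd: "holo2 D snd"
  unfolding holo2_def
  by (intro ballI exI[of _ 0] exI[of _ 1]) (auto intro!: derivative_eq_intros)

lemma holo2_add: "holo2 D H \<Longrightarrow> holo2 D K \<Longrightarrow> holo2 D (\<lambda>z. H z + K z)"
  unfolding holo2_def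
proof
  fix z assume a: "\<forall>z\<in>D. \<exists>A B. (H has_derivative (\<lambda>h. A * fst h + B * snd h)) (at z)"
      "\<forall>z\<in>D. \<exists>A B. (K has_derivative (\<lambda>h. A * fst h + B * snd h)) (at z)" and z: "z \<in> D"
  then obtain A B A' B' where "(H has_derivative (\<lambda>h. A * fst h + B * snd h)) (at z)"
    "(K has_derivative (\<lambda>h. A' * fst h + B' * snd h)) (at z)" by blast
  from has_derivative_add[OF this]
  have "((\<lambda>z. H z + K z) has_derivative (\<lambda>h. (A + A') * fst h + (B + B') * snd h)) (at z)"
    by (simp add: algebra_simps)
  then show "\<exists>A B. ((\<lambda>z. H z + K z) has_derivative (\<lambda>h. A * fst h + B * snd h)) (at z)" by blast
qed

lemma holo2_mult: "holo2 D H \<Longrightarrow> holo2 D K \<Longrightarrow> holo2 D (\<lambda>z. H z * K z)"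
  unfolding holo2_def
proof
  fix z assume a: "\<forall>z\<in>D. \<exists>A B. (H has_derivative (\<lambda>h. A * fst h + B * snd h)) (at z)"
      "\<forall>z\<in>D. \<exists>A B. (K has_derivative (\<lambda>h. A * fst h + B * snd h)) (at z)" and z: "z \<in> D"
  then obtain A B A' B' where "(H has_derivative (\<lambda>h. A * fst h + B * snd h)) (at z)"
    "(K has_derivative (\<lambda>h. A' * fst h + B' * snd h)) (at z)" by blast
  from has_derivative_mult[OF this]
  have "((\<lambda>z. H z * K z) has_derivative (\<lambda>h. (H z * A' + A * K z) * fst h + (H z * B' + B * K z) * snd h)) (at z)"
    by (simp add: algebra_simps)
  then show "\<exists>A B. ((\<lambda>z. H z * K z) has_derivative (\<lambda>h. A * fst h + B * snd h)) (at z)" by blast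
qed

lemma holo2_compose_holomorphic:
  assumes "holo2 D H" "f holomorphic_on S" "open S" "\<And>z. z \<in> D \<Longrightarrow> H z \<in> S"
  shows "holo2 D (\<lambda>z. f (H z))"
  unfolding holo2_def
proof
  fix z assume z: "z \<in> D"
  then obtain A B where AB: "(H has_derivative (\<lambda>h. A * fst h + B * snd h)) (at z)"
    using assms unfolding holo2_def by blast
  have "(f has_field_derivative deriv f (H z)) (at (H z))"
    by (rule holomorphic_derivI[OF assms(2,3) assms(4)[OF z]])
  from has_derivative_compose[OF AB this[unfolded has_field_derivative_def]]
  have "((\<lambda>z. f (H z)) has_derivative (\<lambda>h. (deriv f (H z) * A) * fst h + (deriv f (H z) * B) * snd h)) (at z)"
    by (simp add: algebra_simps)
  then show "\<exists>A B. ((\<lambda>z. f (H z)) has_derivative (\<lambda>h. A * fst h + B * snd h)) (at z)" by blast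
qed

lemma holo2_compose:
  assumes "holo2 E K" "holo2 D H1" "holo2 D H2" "\<And>z. z \<in> D \<Longrightarrow> (H1 z, H2 z) \<in> E"
  shows "holo2 D (\<lambda>z. K (H1 z, H2 z))"
  unfolding holo2_def
proof
  fix z assume z: "z \<in> D"
  then obtain A B where AB: "(K has_derivative (\<lambda>h. A * fst h + B * snd h)) (at (H1 z, H2 z))"
    using assms unfolding holo2_def by blast
  obtain A1 B1 A2 B2 where 1: "(H1 has_derivative (\<lambda>h. A1 * fst h + B1 * snd h)) (at z)"
    and 2: "(H2 has_derivative (\<lambda>h. A2 * fst h + B2 * snd h)) (at z)"
    using assms(2,3) z unfolding holo2_def by blast
  from has_derivative_compose[OF has_derivative_Pair[OF 1 2] AB]
  have "((\<lambda>z. K (H1 z, H2 z)) has_derivative (\<lambda>h. (A * A1 + B * A2) * fst h + (A * B1 + B * B2) * snd h)) (at z)"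
    by (simp add: algebra_simps)
  then show "\<exists>A B. ((\<lambda>z. K (H1 z, H2 z)) has_derivative (\<lambda>h. A * fst h + B * snd h)) (at z)" by blast
qed

text \<open>Near a point the partial derivative is continuous and holomorphic in each variable: in
  the first as the derivative of a holomorphic function, in the second by Cauchy's formula with a
  parameter. \<open>holo2I_separately\<close> combines this.\<close>

lemma holo2_deriv_fst:
  assumes H: "holo2 D H" and D: "open D"
  shows "holo2 D (\<lambda>z. deriv (\<lambda>s. H (s, snd z)) (fst z))"
proof -
  have c: "continuous_on D H" by (rule holo2_continuous_on[OF H])
  have hol1: "(\<lambda>s. H (s, y)) holomorphic_on U" if "open U" "U \<times> {y} \<subseteq> D" for U y
    using that by (intro holo2_holomorphic_on[OF H]) (auto intro: holomorphic_intros)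
  have hol2: "(\<lambda>y. H (s, y)) holomorphic_on V" if "open V" "{s} \<times> V \<subseteq> D" for V s
    using that by (intro holo2_holomorphic_on[OF H]) (auto intro: holomorphic_intros)
  show "holo2 D (\<lambda>z. deriv (\<lambda>s. H (s, snd z)) (fst z))"
  proof (rule holo2_local)
    fix p assume "p \<in> D"
    then obtain r where r: "r > 0" "ball (fst p) r \<times> ball (snd p) r \<subseteq> D" by (rule open_contains_ball_prod[OF D])
    define X Y where "X = ball (fst p) r" and "Y = ball (snd p) r"
    have XY: "open X" "open Y" "convex X" "convex Y" "p \<in> X \<times> Y" "X \<times> Y \<subseteq> D"
      using r by (auto simp: X_def Y_def mem_Times_iff)
    have cYX: "continuous_on (Y \<times> X) (\<lambda>(y, s). H (s, y))"
      unfolding case_prod_beta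
      by (rule continuous_on_compose2[OF c]) (use XY in \<open>auto intro!: continuous_intros\<close>)
    have h1: "(\<lambda>s. H (s, y)) holomorphic_on X" if "y \<in> Y" for y using XY that by (intro hol1) auto
    have h2: "(\<lambda>y. H (s, y)) holomorphic_on Y" if "s \<in> X" for s using XY that by (intro hol2) auto
    have cd: "continuous_on (Y \<times> X) (\<lambda>(y, s). deriv (\<lambda>s. H (s, y)) s)"
      by (rule continuous_on_deriv_param[OF XY(1) cYX h1])
    have "holo2 (X \<times> Y) (\<lambda>z. deriv (\<lambda>s. H (s, snd z)) (fst z))"
    proof (rule holo2I_separately)
      have "continuous_on (X \<times> Y) (\<lambda>z. (\<lambda>(y, s). deriv (\<lambda>s. H (s, y)) s) (snd z, fst z))"
        by (rule continuous_on_compose2[OF cd]) (auto intro!: continuous_intros)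
      then show "continuous_on (X \<times> Y) (\<lambda>z. deriv (\<lambda>s. H (s, snd z)) (fst z))" by simp
      show "(\<lambda>s. deriv (\<lambda>s'. H (s', snd (s, y))) (fst (s, y))) holomorphic_on U"
        if "open U" "U \<times> {y} \<subseteq> X \<times> Y" for U y
      \<comment> \<open>For empty \<open>U\<close> the inclusion does not place \<open>y\<close> in
        \<open>Y\<close>, so \<open>h1\<close> does not apply; the claim is then vacuous.\<close>
      proof (cases "U = {}")
        case False
        then have "(\<lambda>s. H (s, y)) holomorphic_on U" using that by (intro holomorphic_on_subset[OF h1]) auto
        then show ?thesis using that by (simp add: holomorphic_deriv)
      next
        case True
        then show ?thesis by (simp add: holomorphic_on_def)
      qed
      show "(\<lambda>y. deriv (\<lambda>s. H (s, snd (s', y))) (fst (s', y))) holomorphic_on V"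
        if "open V" "{s'} \<times> V \<subseteq> X \<times> Y" for V s'
      proof (cases "V = {}")
        case False
        have "(\<lambda>y. deriv (\<lambda>s. H (s, y)) s') holomorphic_on Y"
          by (rule holomorphic_on_deriv_param[OF XY(2,4,1) _ cYX h2 h1]) (use that False in auto)
        then show ?thesis using that False by (auto intro: holomorphic_on_subset)
      next
        case True
        then show ?thesis by (simp add: holomorphic_on_def)
      qed
    qed (use XY in \<open>auto simp: open_Times\<close>)
    then show "\<exists>E. p \<in> E \<and> holo2 E (\<lambda>z. deriv (\<lambda>s. H (s, snd z)) (fst z))"
      using XY by (intro exI[of _ "X \<times> Y"]) (auto simp: open_Times)
  qed
qed

lemma holo2_deriv_snd:
  assumes H: "holo2 D H" and D: "open D"
  shows "holo2 D (\<lambda>z. deriv (\<lambda>y. H (fst z, y)) (snd z))"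
proof -
  define E where "E = prod.swap -` D"
  have "open E" unfolding E_def by (intro open_vimage D continuous_on_swap)
  moreover have "holo2 E (\<lambda>z. H (snd z, fst z))"
    by (rule holo2_compose[OF H holo2_snd holo2_fst]) (auto simp: E_def prod.swap_def)
  ultimately have "holo2 E (\<lambda>z. deriv (\<lambda>s. H (snd z, s)) (fst z))"
    using holo2_deriv_fst[of E "\<lambda>z. H (snd z, fst z)"] by simp
  from holo2_compose[OF this holo2_snd holo2_fst, of D]
  show ?thesis by (simp add: E_def)
qed

section \<open>Complex extensions of real-analytic functions\<close>

definition cvec :: "real^2 \<Rightarrow> complex \<times> complex" where
  "cvec x = (of_real (x$1), of_real (x$2))"

text \<open>A continuous left inverse of \<open>cvec\<close>: preimages under it turn a
  neighbourhood of a real point into an open set of complex points.\<close>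

definition rvec :: "complex \<times> complex \<Rightarrow> real^2" where
  "rvec z = (\<chi> i. if i = 1 then Re (fst z) else Re (snd z))"

lemma rvec_cvec [simp]: "rvec (cvec x) = x"
  by (simp add: rvec_def cvec_def vec_eq_iff forall_2)

lemma open_rvec_vimage: "open N \<Longrightarrow> open (rvec -` N)"
proof -
  have "continuous_on UNIV rvec"
    unfolding rvec_def
  proof (rule continuous_on_vec_lambda)
    show "continuous_on UNIV (\<lambda>z. if i = 1 then Re (fst z) else Re (snd z))" for i :: 2
      by (cases "i = 1") (auto intro!: continuous_intros)
  qed
  then show "open N \<Longrightarrow> open (rvec -` N)" by (simp add: open_vimage)
qed

text \<open>This is equivalent to real analyticity, but evidently stable under products, composition and
  differentiation.\<close>

definition extends_holo :: "(real^2 \<Rightarrow> complex) \<Rightarrow> bool" where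
  "extends_holo g \<longleftrightarrow>
     (\<forall>a. \<exists>D H. open D \<and> cvec a \<in> D \<and> holo2 D H \<and> (\<forall>x. cvec x \<in> D \<longrightarrow> H (cvec x) = g x))"

lemma extends_holoE:
  assumes "extends_holo g"
  obtains D H where "open D" "cvec a \<in> D" "holo2 D H" "\<And>x. cvec x \<in> D \<Longrightarrow> H (cvec x) = g x"
  using assms unfolding extends_holo_def by blast

text \<open>Absolute summability at the radii (r, r) is the majorant for Weierstrass' test on the
  whole bidisc. The sum is unordered, so limits run along the filter of finite index sets.\<close>

lemma holo2_powser:
  fixes c :: "nat \<times> nat \<Rightarrow> complex"
  assumes r: "r > 0" and summ: "(\<lambda>(j, k). r^j * r^k * norm (c (j, k))) summable_on UNIV"
  shows "holo2 (ball a r \<times> ball b r) (\<lambda>z. \<Sum>\<^sub>\<infinity>(j, k). (fst z - a)^j * (snd z - b)^k * c (j, k))"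
proof -
  define H where "H = (\<lambda>z. \<Sum>\<^sub>\<infinity>(j, k). (fst z - a)^j * (snd z - b)^k * c (j, k))"
  define D where "D = ball a r \<times> ball b r"
  let ?f = "\<lambda>p z. (fst z - a)^fst p * (snd z - b)^snd p * c p"
  have ul: "uniform_limit D (\<lambda>X z. \<Sum>p\<in>X. ?f p z) H (finite_subsets_at_top UNIV)"
    unfolding H_def case_prod_unfold prod.collapse
  proof (rule Weierstrass_m_test_general)
    fix p z assume "z \<in> D"
    then have *: "norm (fst z - a) \<le> r" "norm (snd z - b) \<le> r"
      by (auto simp: D_def dist_norm norm_minus_commute)
    show "norm (?f p z) \<le> r^fst p * r^snd p * norm (c p)"
      unfolding norm_mult norm_power using * r
      by (intro mult_mono power_mono) auto
  qed (use summ in \<open>simp add: case_prod_unfold\<close>)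
  have "continuous_on D H"
    by (rule uniform_limit_theorem[OF _ ul]) (auto intro!: always_eventually continuous_intros)
  \<comment> \<open>Stated along a holomorphic curve \<phi>, so that both kinds of coordinate
    section are instances.\<close>
  moreover have hol: "(\<lambda>t. H (\<phi> t)) holomorphic_on U"
    if U: "open U" "\<phi> ` U \<subseteq> D" and \<phi>: "(\<lambda>t. fst (\<phi> t)) holomorphic_on U" "(\<lambda>t. snd (\<phi> t)) holomorphic_on U"
    for U and \<phi> :: "complex \<Rightarrow> complex \<times> complex"
    unfolding holomorphic_on_open[OF U(1)]
  proof
    fix t assume "t \<in> U"
    then obtain e where e: "e > 0" "cball t e \<subseteq> U" using U(1) by (meson open_contains_cball)
    have h: "(\<lambda>t. \<Sum>p\<in>X. ?f p (\<phi> t)) holomorphic_on U" for X by (intro holomorphic_intros \<phi>)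
    have ul': "uniform_limit (cball t e) (\<lambda>X t. \<Sum>p\<in>X. ?f p (\<phi> t)) (\<lambda>t. H (\<phi> t)) (finite_subsets_at_top UNIV)"
      using uniform_limit_compose'[OF ul, of \<phi> "cball t e"] U e by auto
    obtain "(\<lambda>t. H (\<phi> t)) holomorphic_on ball t e"
    proof (rule holomorphic_uniform_limit[OF _ ul'])
      show "\<forall>\<^sub>F X in finite_subsets_at_top UNIV. continuous_on (cball t e) (\<lambda>t. \<Sum>p\<in>X. ?f p (\<phi> t)) \<and>
          (\<lambda>t. \<Sum>p\<in>X. ?f p (\<phi> t)) holomorphic_on ball t e"
      proof (intro always_eventually allI conjI)
        fix X
        show "continuous_on (cball t e) (\<lambda>t. \<Sum>p\<in>X. ?f p (\<phi> t))"
          by (rule holomorphic_on_imp_continuous_on[OF holomorphic_on_subset[OF h e(2)]])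
        show "(\<lambda>t. \<Sum>p\<in>X. ?f p (\<phi> t)) holomorphic_on ball t e"
          by (rule holomorphic_on_subset[OF h]) (use e(2) in auto)
      qed
    qed auto
    then show "\<exists>f'. ((\<lambda>t. H (\<phi> t)) has_field_derivative f') (at t)"
      using e(1) holomorphic_derivI open_ball centre_in_ball by blast
  qed
  ultimately have "holo2 D H"
    by (intro holo2I_separately hol) (auto simp: D_def open_Times intro!: holomorphic_intros)
  then show ?thesis by (simp add: D_def H_def)
qed

text \<open>A convergent unordered sum of complex numbers converges absolutely, so convergence at
  the single real corner point \<open>x0\<close> already controls the series on a complex
  bidisc.\<close>

lemma real_analytic_imp_extends_holo:
  fixes f :: "real^2 \<Rightarrow> complex"
  assumes "real_analytic f"
  shows "extends_holo f"
  unfolding extends_holo_def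
proof
  fix a :: "real^2"
  obtain r c where r: "r > 0" and c: "\<And>x. dist x a < r \<Longrightarrow>
      ((\<lambda>(j, k). ((x$1 - a$1)^j * (x$2 - a$2)^k) *\<^sub>R c (j, k)) has_sum f x) UNIV"
    using assms unfolding real_analytic_def by meson
  \<comment> \<open>With a third of \<open>r\<close> the corner \<open>x0\<close>, at l1 distance 2
    r / 3 from \<open>a\<close>, still lies where the series converges.\<close>
  define \<rho> where "\<rho> = r / 3"
  have \<rho>: "\<rho> > 0" using r by (simp add: \<rho>_def)
  have d: "dist x a < r" if "\<bar>x$1 - a$1\<bar> \<le> \<rho>" "\<bar>x$2 - a$2\<bar> \<le> \<rho>" for x :: "real^2"
  proof -
    have "dist x a \<le> l1 (x - a)"
      using norm_le_l1_cart[of "x - a"] by (simp add: dist_norm sum_2)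
    then show ?thesis using that r by (simp add: \<rho>_def)
  qed
  define x0 :: "real^2" where "x0 = a + (\<chi> i. \<rho>)"
  have "((\<lambda>(j, k). (\<rho>^j * \<rho>^k) *\<^sub>R c (j, k)) has_sum f x0) UNIV"
    using c[OF d, of x0] \<rho> by (simp add: x0_def)
  then have "(\<lambda>p. norm ((\<lambda>(j, k). (\<rho>^j * \<rho>^k) *\<^sub>R c (j, k)) p)) summable_on UNIV"
    using summable_on_iff_abs_summable_on_complex has_sum_imp_summable by blast
  then have s: "(\<lambda>(j, k). \<rho>^j * \<rho>^k * norm (c (j, k))) summable_on UNIV"
    using \<rho> by (simp add: case_prod_unfold)
  let ?H = "\<lambda>z. \<Sum>\<^sub>\<infinity>(j, k). (fst z - of_real (a$1))^j * (snd z - of_real (a$2))^k * c (j, k)"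
  let ?D = "ball (of_real (a$1)) \<rho> \<times> ball (of_real (a$2)) \<rho> :: (complex \<times> complex) set"
  have "?H (cvec x) = f x" if "cvec x \<in> ?D" for x
  proof -
    from that have "\<bar>x$1 - a$1\<bar> \<le> \<rho>" "\<bar>x$2 - a$2\<bar> \<le> \<rho>"
      by (auto simp: cvec_def dist_norm abs_minus_commute simp flip: of_real_diff)
    from c[OF d[OF this]] have "f x = (\<Sum>\<^sub>\<infinity>(j, k). ((x$1 - a$1)^j * (x$2 - a$2)^k) *\<^sub>R c (j, k))"
      by (rule infsumI[symmetric])
    also have "\<dots> = ?H (cvec x)"
      by (rule infsum_cong) (auto simp: cvec_def scaleR_conv_of_real)
    finally show ?thesis by simp
  qed
  with holo2_powser[OF \<rho> s, of "of_real (a$1)" "of_real (a$2)"] \<rho>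
  show "\<exists>D H. open D \<and> cvec a \<in> D \<and> holo2 D H \<and> (\<forall>x. cvec x \<in> D \<longrightarrow> H (cvec x) = f x)"
    by (intro exI[of _ ?D] exI[of _ ?H] conjI) (auto simp: open_Times, simp add: cvec_def)
qed

lemma extends_holo_const: "extends_holo (\<lambda>x. c)"
  unfolding extends_holo_def by (intro allI exI[of _ UNIV] exI[of _ "\<lambda>_. c"]) (auto simp: holo2_const)

lemma extends_holo_binop:
  assumes "extends_holo f" "extends_holo g"
    and op: "\<And>D H K. holo2 D H \<Longrightarrow> holo2 D K \<Longrightarrow> holo2 D (\<lambda>z. op (H z) (K z))"
  shows "extends_holo (\<lambda>x. op (f x) (g x))"
  unfolding extends_holo_def
proof
  fix a
  obtain D H where D: "open D" "cvec a \<in> D" "holo2 D H" "\<And>x. cvec x \<in> D \<Longrightarrow> H (cvec x) = f x"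
    using extends_holoE[OF assms(1)] by blast
  obtain E K where E: "open E" "cvec a \<in> E" "holo2 E K" "\<And>x. cvec x \<in> E \<Longrightarrow> K (cvec x) = g x"
    using extends_holoE[OF assms(2)] by blast
  have "holo2 (D \<inter> E) (\<lambda>z. op (H z) (K z))"
    by (intro op holo2_subset[OF D(3)] holo2_subset[OF E(3)]) auto
  then show "\<exists>D H. open D \<and> cvec a \<in> D \<and> holo2 D H \<and> (\<forall>x. cvec x \<in> D \<longrightarrow> H (cvec x) = op (f x) (g x))"
    using D E by (intro exI[of _ "D \<inter> E"] exI[of _ "\<lambda>z. op (H z) (K z)"]) auto
qed

lemma extends_holo_add: "extends_holo f \<Longrightarrow> extends_holo g \<Longrightarrow> extends_holo (\<lambda>x. f x + g x)"
  by (rule extends_holo_binop) (auto intro: holo2_add)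

lemma extends_holo_mult: "extends_holo f \<Longrightarrow> extends_holo g \<Longrightarrow> extends_holo (\<lambda>x. f x * g x)"
  by (rule extends_holo_binop) (auto intro: holo2_mult)

lemma extends_holo_compose:
  fixes F :: "real^2 \<Rightarrow> real^2"
  assumes g: "extends_holo g" and F: "\<And>i. extends_holo (\<lambda>x. of_real (F x $ i))"
  shows "extends_holo (\<lambda>x. g (F x))"
  unfolding extends_holo_def
proof
  fix a
  obtain E K where E: "open E" "cvec (F a) \<in> E" "holo2 E K" "\<And>x. cvec x \<in> E \<Longrightarrow> K (cvec x) = g x"
    using extends_holoE[OF g] by blast
  obtain D1 H1 where D1: "open D1" "cvec a \<in> D1" "holo2 D1 H1" "\<And>x. cvec x \<in> D1 \<Longrightarrow> H1 (cvec x) = of_real (F x $ 1)"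
    using extends_holoE[OF F[of 1]] by blast
  obtain D2 H2 where D2: "open D2" "cvec a \<in> D2" "holo2 D2 H2" "\<And>x. cvec x \<in> D2 \<Longrightarrow> H2 (cvec x) = of_real (F x $ 2)"
    using extends_holoE[OF F[of 2]] by blast
  define D where "D = (D1 \<inter> D2) \<inter> (\<lambda>z. (H1 z, H2 z)) -` E"
  have h: "holo2 (D1 \<inter> D2) H1" "holo2 (D1 \<inter> D2) H2"
    using D1 D2 by (auto intro: holo2_subset)
  have "open D"
    unfolding D_def using D1 D2 E
    by (intro continuous_open_preimage continuous_on_Pair holo2_continuous_on h) auto
  moreover have "cvec a \<in> D" using D1 D2 E by (auto simp: D_def cvec_def)
  moreover have "holo2 D (\<lambda>z. K (H1 z, H2 z))"
    by (rule holo2_compose[OF E(3) holo2_subset[OF h(1)] holo2_subset[OF h(2)]]) (auto simp: D_def)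
  moreover have "K (H1 (cvec x), H2 (cvec x)) = g (F x)" if "cvec x \<in> D" for x
    using that D1(4)[of x] D2(4)[of x] E(4)[of "F x"] by (auto simp: D_def cvec_def)
  ultimately show "\<exists>D H. open D \<and> cvec a \<in> D \<and> holo2 D H \<and> (\<forall>x. cvec x \<in> D \<longrightarrow> H (cvec x) = g (F x))"
    by blast
qed

lemma extends_holo_transform:
  assumes "\<And>a. \<exists>N g'. open N \<and> a \<in> N \<and> extends_holo g' \<and> (\<forall>x\<in>N. g x = g' x)"
  shows "extends_holo g"
  unfolding extends_holo_def
proof
  fix a
  obtain N g' where N: "open N" "a \<in> N" "extends_holo g'" "\<forall>x\<in>N. g x = g' x" using assms by blast
  obtain D H where D: "open D" "cvec a \<in> D" "holo2 D H" "\<And>x. cvec x \<in> D \<Longrightarrow> H (cvec x) = g' x"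
    using extends_holoE[OF N(3)] by blast
  then show "\<exists>D H. open D \<and> cvec a \<in> D \<and> holo2 D H \<and> (\<forall>x. cvec x \<in> D \<longrightarrow> H (cvec x) = g x)"
    using N open_rvec_vimage[OF N(1)] holo2_subset[OF D(3), of "D \<inter> rvec -` N"]
    by (intro exI[of _ "D \<inter> rvec -` N"] exI[of _ H]) auto
qed

text \<open>The real derivative is a combination of the complex partial derivatives of a local
  extension, which are holomorphic again.\<close>

lemma extends_holo_has_derivative:
  assumes "extends_holo g"
  shows "g differentiable (at x)" and "extends_holo (\<lambda>x. frechet_derivative g (at x) v)"
proof -
  have *: "\<exists>D H. open D \<and> cvec a \<in> D \<and> holo2 D H \<and> (\<forall>x. cvec x \<in> D \<longrightarrow>
      (g has_derivative (\<lambda>v. of_real (v$1) * deriv (\<lambda>s. H (s, snd (cvec x))) (fst (cvec x))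
           + of_real (v$2) * deriv (\<lambda>y. H (fst (cvec x), y)) (snd (cvec x)))) (at x))" for a
  proof -
    obtain D H where D: "open D" "cvec a \<in> D" "holo2 D H" "\<And>x. cvec x \<in> D \<Longrightarrow> H (cvec x) = g x"
      using extends_holoE[OF assms] by blast
    have "(g has_derivative (\<lambda>v. of_real (v$1) * deriv (\<lambda>s. H (s, snd (cvec x))) (fst (cvec x))
           + of_real (v$2) * deriv (\<lambda>y. H (fst (cvec x), y)) (snd (cvec x)))) (at x)" if x: "cvec x \<in> D" for x
    proof -
      obtain A B where AB: "(H has_derivative (\<lambda>h. A * fst h + B * snd h)) (at (cvec x))"
        using D(3) x unfolding holo2_def by blast
      \<comment> \<open>Restriction to the coordinate lines identifies \<open>A\<close> and
        \<open>B\<close> with partial derivatives of \<open>H\<close>, so that one formula for the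
        derivative is valid on all of \<open>D\<close>.\<close>
      have A: "deriv (\<lambda>s. H (s, snd (cvec x))) (fst (cvec x)) = A"
        using has_field_derivative_holo2_line[where a = "\<lambda>s. s" and b = "\<lambda>s. snd (cvec x)" and z = "fst (cvec x)", of H A B 1 0] AB
        by (intro DERIV_imp_deriv) (auto intro!: derivative_eq_intros)
      have B: "deriv (\<lambda>y. H (fst (cvec x), y)) (snd (cvec x)) = B"
        using has_field_derivative_holo2_line[where a = "\<lambda>s. fst (cvec x)" and b = "\<lambda>s. s" and z = "snd (cvec x)", of H A B 0 1] AB
        by (intro DERIV_imp_deriv) (auto intro!: derivative_eq_intros)
      have bl: "bounded_linear cvec"
        unfolding cvec_def
        by (intro bounded_linear_Pair bounded_linear_compose[OF bounded_linear_of_real] bounded_linear_vec_nth)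
      have "((\<lambda>x. H (cvec x)) has_derivative (\<lambda>v. A * fst (cvec v) + B * snd (cvec v))) (at x)"
        by (rule has_derivative_compose[OF bounded_linear_imp_has_derivative[OF bl] AB])
      moreover have "open (cvec -` D)"
        using D(1) bl by (intro open_vimage linear_continuous_on) auto
      ultimately have "(g has_derivative (\<lambda>v. A * fst (cvec v) + B * snd (cvec v))) (at x)"
        by (rule has_derivative_transform_within_open) (use x D in auto)
      then show ?thesis unfolding A B by (simp add: cvec_def mult.commute)
    qed
    then show ?thesis using D by blast
  qed
  show "g differentiable (at x)" using *[of x] unfolding differentiable_def by blast
  show "extends_holo (\<lambda>x. frechet_derivative g (at x) v)"
    unfolding extends_holo_def
  proof
    fix a
    obtain D H where D: "open D" "cvec a \<in> D" "holo2 D H" "\<And>x. cvec x \<in> D \<Longrightarrow>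
      (g has_derivative (\<lambda>v. of_real (v$1) * deriv (\<lambda>s. H (s, snd (cvec x))) (fst (cvec x))
           + of_real (v$2) * deriv (\<lambda>y. H (fst (cvec x), y)) (snd (cvec x)))) (at x)"
      using * by blast
    let ?H = "\<lambda>z. of_real (v$1) * deriv (\<lambda>s. H (s, snd z)) (fst z) + of_real (v$2) * deriv (\<lambda>y. H (fst z, y)) (snd z)"
    have "holo2 D ?H"
      by (intro holo2_add holo2_mult holo2_const holo2_deriv_fst holo2_deriv_snd D)
    moreover have "?H (cvec x) = frechet_derivative g (at x) v" if "cvec x \<in> D" for x
      by (rule fun_cong[OF frechet_derivative_at[OF D(4)[OF that]], of v])
    ultimately show "\<exists>D H. open D \<and> cvec a \<in> D \<and> holo2 D H \<and> (\<forall>x. cvec x \<in> D \<longrightarrow> H (cvec x) = frechet_derivative g (at x) v)"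
      using D(1,2) by blast
  qed
qed

text \<open>\<open>F\<close> is recovered from \<open>cis (F x)\<close> by a branch of the
  logarithm; continuity of \<open>F\<close> excludes jumps by multiples of 2 pi.\<close>

lemma extends_holo_lift:
  assumes u: "extends_holo (\<lambda>x. cis (F x))" and F: "continuous_on UNIV F"
  shows "extends_holo (\<lambda>x. of_real (F x))"
  unfolding extends_holo_def
proof
  fix a
  obtain D H where D: "open D" "cvec a \<in> D" "holo2 D H" "\<And>x. cvec x \<in> D \<Longrightarrow> H (cvec x) = cis (F x)"
    using extends_holoE[OF u] by blast
  \<comment> \<open>The first condition keeps the argument of \<open>Ln\<close> in a disc off the
    negative axis. The second, |F x - F a| < pi, makes the principal value the right one.\<close>
  define D' where "D' = (D \<inter> (\<lambda>z. H z / cis (F a)) -` ball 1 1) \<inter> rvec -` (F -` ball (F a) pi)"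
  have "open (F -` ball (F a) pi)" using F by (intro open_vimage) auto
  then have "open D'"
    unfolding D'_def using D
    by (intro open_Int continuous_open_preimage open_rvec_vimage continuous_on_divide holo2_continuous_on continuous_on_const) auto
  have h: "holo2 D' (\<lambda>z. of_real (F a) + (- \<i>) * Ln (inverse (cis (F a)) * H z))"
  proof (intro holo2_add holo2_mult holo2_const holo2_compose_holomorphic[where f = Ln and S = "ball 1 1"])
    show "holo2 D' H" by (rule holo2_subset[OF D(3)]) (auto simp: D'_def)
    have "z \<notin> \<real>\<^sub>\<le>\<^sub>0" if "dist 1 z < 1" for z :: complex
    proof
      assume "z \<in> \<real>\<^sub>\<le>\<^sub>0"
      then have "Re z \<le> 0" by (simp add: complex_nonpos_Reals_iff)
      then have "1 \<le> norm (1 - z)" using abs_Re_le_cmod[of "1 - z"] by simp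
      then show False using that by (simp add: dist_norm)
    qed
    then show "Ln holomorphic_on ball 1 1" by (intro holomorphic_intros) auto
  qed (auto simp: D'_def field_simps)
  have "of_real (F a) + (- \<i>) * Ln (inverse (cis (F a)) * H (cvec x)) = of_real (F x)" if x: "cvec x \<in> D'" for x
  proof -
    have "inverse (cis (F a)) * H (cvec x) = exp (\<i> * of_real (F x - F a))"
      using D(4)[of x] x by (simp add: D'_def cis_conv_exp exp_diff divide_inverse mult.commute algebra_simps)
    moreover have "\<bar>F x - F a\<bar> < pi" using x by (simp add: D'_def dist_real_def abs_minus_commute)
    ultimately have "Ln (inverse (cis (F a)) * H (cvec x)) = \<i> * of_real (F x - F a)"
      by (simp add: Ln_exp abs_less_iff del: of_real_diff)
    then have eq: "(- \<i>) * Ln (inverse (cis (F a)) * H (cvec x)) = of_real (F x - F a)"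
      by (simp del: of_real_diff)
    then show ?thesis unfolding eq by simp
  qed
  moreover have "cvec a \<in> D'" using D by (auto simp: D'_def)
  ultimately show "\<exists>D H. open D \<and> cvec a \<in> D \<and> holo2 D H \<and> (\<forall>x. cvec x \<in> D \<longrightarrow> H (cvec x) = of_real (F x))"
    using \<open>open D'\<close> h by blast
qed

lemma extends_holo_continuous_on: "extends_holo g \<Longrightarrow> continuous_on S g"
  using extends_holo_has_derivative(1)
  by (meson continuous_at_imp_continuous_on differentiable_imp_continuous_within)

text \<open>A continuous function without zeros has locally constant sign, so its modulus is locally
  plus or minus the function. Needed for the modulus of a Jacobian.\<close>

lemma extends_holo_abs:
  assumes g: "extends_holo (\<lambda>x. of_real (g x))" and nz: "\<And>x. g x \<noteq> 0"
  shows "extends_holo (\<lambda>x. of_real \<bar>g x\<bar>)"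
proof (rule extends_holo_transform)
  fix a
  have "continuous_on UNIV (\<lambda>x. Re (of_real (g x)))"
    by (intro continuous_intros extends_holo_continuous_on g)
  then have c: "continuous_on UNIV g" by simp
  show "\<exists>N g'. open N \<and> a \<in> N \<and> extends_holo g' \<and> (\<forall>x\<in>N. of_real \<bar>g x\<bar> = g' x)"
  proof (cases "g a > 0")
    case True
    then show ?thesis
      using open_vimage[OF _ c, of "{0<..}"] g
      by (intro exI[of _ "g -` {0<..}"] exI[of _ "\<lambda>x. of_real (g x)"]) auto
  next
    case False
    with nz[of a] have "g a < 0" by simp
    then show ?thesis
      using open_vimage[OF _ c, of "{..<0}"] extends_holo_mult[OF extends_holo_const[of "-1"] g]
      by (intro exI[of _ "g -` {..<0}"] exI[of _ "\<lambda>x. -1 * of_real (g x)"]) auto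
  qed
qed

section \<open>Complex shifts of the integration variable\<close>

lemma holomorphic_eq_from_reals:
  assumes "f holomorphic_on ball 0 r" "g holomorphic_on ball 0 r" "r > 0"
    and eq: "\<And>t. \<bar>t\<bar> < r \<Longrightarrow> f (of_real t) = g (of_real t)" and "z \<in> ball 0 r"
  shows "f z = g z"
proof -
  have "0 islimpt complex_of_real ` {-r<..<r}"
    unfolding islimpt_approachable
  proof (intro allI impI)
    fix e :: real assume "e > 0"
    then show "\<exists>x'\<in>complex_of_real ` {-r<..<r}. x' \<noteq> 0 \<and> dist x' 0 < e"
      using \<open>r > 0\<close> by (intro bexI[OF _ imageI[of "min e r / 2"]]) auto
  qed
  then have "(\<lambda>z. f z - g z) z = 0"
    by (rule analytic_continuation[where f = "\<lambda>z. f z - g z" and S = "ball 0 r", rotated 5])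
       (use assms in \<open>auto intro!: holomorphic_intros\<close>)
  then show ?thesis by simp
qed

text \<open>Discs of radius r/4 about points of modulus at most r/2 stay inside the domain, and
  there Cauchy's estimate bounds the second derivative by 2 B / (r/4)^2 = 32 B / r^2.\<close>

lemma holomorphic_Taylor1:
  assumes f: "f holomorphic_on ball 0 r" and r: "r > 0"
    and B: "\<And>z. z \<in> ball 0 r \<Longrightarrow> norm (f z) < B" and z: "norm z \<le> r / 2"
  shows "norm (f z - f 0 - deriv f 0 * z) \<le> 32 * B / r\<^sup>2 * (norm z)\<^sup>2"
proof -
  have hd: "(deriv ^^ i) f holomorphic_on ball 0 r" for i
    using f by (rule holomorphic_higher_deriv) auto
  have "norm ((deriv ^^ 0) f z - (\<Sum>i\<le>1. (deriv ^^ i) f 0 * (z - 0) ^ i / fact i))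
       \<le> 32 * B / r\<^sup>2 * norm (z - 0) ^ Suc 1 / fact 1"
  proof (rule complex_Taylor[where S = "cball 0 (r/2)"])
    fix i x assume "x \<in> cball (0::complex) (r/2)"
    then have "x \<in> ball 0 r" using r by auto
    then show "((deriv ^^ i) f has_field_derivative (deriv ^^ Suc i) f x) (at x within cball 0 (r / 2))"
      using holomorphic_derivI[OF hd[of i], of x] by (auto intro: has_field_derivative_at_within)
  next
    fix x assume "x \<in> cball (0::complex) (r/2)"
    then have *: "cball x (r/4) \<subseteq> ball 0 r"
    proof (intro subsetI)
      fix y assume "x \<in> cball (0::complex) (r/2)" "y \<in> cball x (r/4)"
      then have "dist 0 y \<le> r/2 + r/4" using dist_triangle[of 0 y x] by simp
      then show "y \<in> ball 0 r" using r by simp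
    qed
    have "norm ((deriv ^^ 2) f x) \<le> fact 2 * B / (r/4)^2"
    proof (rule Cauchy_higher_deriv_bound[where y = 0])
      show "f holomorphic_on ball x (r/4)"
        by (rule holomorphic_on_subset[OF f]) (use * in auto)
      show "continuous_on (cball x (r/4)) f"
        by (rule holomorphic_on_imp_continuous_on[OF holomorphic_on_subset[OF f *]])
      show "f w \<in> ball 0 B" if "w \<in> ball x (r/4)" for w
        using B[of w] * that by (auto simp: subset_iff)
    qed (use r in auto)
    then show "norm ((deriv ^^ Suc 1) f x) \<le> 32 * B / r\<^sup>2"
      by (simp add: power_divide numeral_2_eq_2)
  qed (use r z in auto)
  then show ?thesis by (simp add: algebra_simps power2_eq_square)
qed

text \<open>Finitely many local extensions cover the compact set \<open>Q\<close> and give a common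
  radius. Two of them agree for real \<open>t\<close>, hence on the disc, so choosing one
  arbitrarily for each \<open>x\<close> still gives joint continuity.\<close>

lemma directional_extension:
  fixes \<eta> :: "real^2"
  assumes g: "extends_holo g" and Q: "compact Q"
  obtains r G where "r > 0" "continuous_on (Q \<times> ball 0 r) (\<lambda>(x, z). G x z)"
    "\<And>x. x \<in> Q \<Longrightarrow> G x holomorphic_on ball 0 r"
    "\<And>x t. x \<in> Q \<Longrightarrow> \<bar>t\<bar> < r \<Longrightarrow> G x (of_real t) = g (x + t *\<^sub>R \<eta>)"
proof -
  define \<phi> where "\<phi> = (\<lambda>p :: (real^2) \<times> complex. (of_real (fst p $ 1) + snd p * of_real (\<eta>$1), of_real (fst p $ 2) + snd p * of_real (\<eta>$2)))"
  have \<phi>c: "continuous_on UNIV \<phi>" unfolding \<phi>_def by (intro continuous_intros)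
  have \<phi>r: "\<phi> (x, of_real t) = cvec (x + t *\<^sub>R \<eta>)" for x t
    by (simp add: \<phi>_def cvec_def)
  have "\<exists>H e. e > 0 \<and> continuous_on (\<phi> ` (ball a e \<times> ball 0 e)) H \<and>
       (\<forall>x\<in>ball a e. (\<lambda>z. H (\<phi> (x, z))) holomorphic_on ball 0 e \<and>
          (\<forall>t. \<bar>t\<bar> < e \<longrightarrow> H (\<phi> (x, of_real t)) = g (x + t *\<^sub>R \<eta>)))" for a
  proof -
    obtain D H where D: "open D" "cvec a \<in> D" "holo2 D H" "\<And>x. cvec x \<in> D \<Longrightarrow> H (cvec x) = g x"
      using extends_holoE[OF g] by blast
    have "open (\<phi> -` D)" using D(1) \<phi>c by (rule open_vimage)
    moreover have "(a, 0) \<in> \<phi> -` D" using D(2) \<phi>r[of a 0] by simp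
    ultimately obtain e where e: "e > 0" "ball (fst (a, 0 :: complex)) e \<times> ball (snd (a, 0 :: complex)) e \<subseteq> \<phi> -` D"
      by (rule open_contains_ball_prod)
    have "continuous_on (\<phi> ` (ball a e \<times> ball 0 e)) H"
      by (rule continuous_on_subset[OF holo2_continuous_on[OF D(3)]]) (use e in auto)
    moreover have "(\<lambda>z. H (\<phi> (x, z))) holomorphic_on ball 0 e" if "x \<in> ball a e" for x
      unfolding \<phi>_def fst_conv snd_conv
      by (rule holo2_holomorphic_on[OF D(3)])
         (use e that in \<open>auto simp: \<phi>_def subset_iff intro!: holomorphic_intros\<close>)
    moreover have "H (\<phi> (x, of_real t)) = g (x + t *\<^sub>R \<eta>)" if "x \<in> ball a e" "\<bar>t\<bar> < e" for x t
    proof -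
      have "(x, of_real t) \<in> ball a e \<times> ball (0 :: complex) e" using that by simp
      moreover have "ball a e \<times> ball 0 e \<subseteq> \<phi> -` D" using e(2) by simp
      ultimately have "\<phi> (x, of_real t) \<in> D" by blast
      then show ?thesis unfolding \<phi>r by (rule D(4))
    qed
    ultimately show ?thesis using e(1) by blast
  qed
  then obtain H e where e: "\<And>a. e a > 0" and Hc: "\<And>a. continuous_on (\<phi> ` (ball a (e a) \<times> ball 0 (e a))) (H a)"
    and Hh: "\<And>a x. x \<in> ball a (e a) \<Longrightarrow> (\<lambda>z. H a (\<phi> (x, z))) holomorphic_on ball 0 (e a)"
    and Hr: "\<And>a x t. x \<in> ball a (e a) \<Longrightarrow> \<bar>t\<bar> < e a \<Longrightarrow> H a (\<phi> (x, of_real t)) = g (x + t *\<^sub>R \<eta>)"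
    by metis
  have "Q \<subseteq> (\<Union>a\<in>Q. ball a (e a))" using e by force
  then obtain C where C: "C \<subseteq> Q" "finite C" "Q \<subseteq> (\<Union>a\<in>C. ball a (e a))"
    by (rule compactE_image[OF Q open_ball])
  \<comment> \<open>The element 1 gives \<open>Min\<close> a value when \<open>Q\<close>, and with
    it \<open>C\<close>, is empty.\<close>
  define r where "r = Min (insert 1 (e ` C))"
  have r: "r > 0" using C e by (auto simp: r_def)
  have re: "r \<le> e a" if "a \<in> C" for a using that C by (auto simp: r_def)
  define idx where "idx x = (SOME a. a \<in> C \<and> x \<in> ball a (e a))" for x
  have idx: "idx x \<in> C \<and> x \<in> ball (idx x) (e (idx x))" if "x \<in> Q" for x
    unfolding idx_def by (rule someI_ex) (use C(3) that in blast)
  define G where "G x z = H (idx x) (\<phi> (x, z))" for x z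
  have Hh': "(\<lambda>z. H a (\<phi> (x, z))) holomorphic_on ball 0 r" if "a \<in> C" "x \<in> ball a (e a)" for a x
    by (rule holomorphic_on_subset[OF Hh[OF that(2)]]) (use re[OF that(1)] in auto)
  have Geq: "G x z = H a (\<phi> (x, z))" if "x \<in> Q" "a \<in> C" "x \<in> ball a (e a)" "z \<in> ball 0 r" for x a z
    unfolding G_def
  proof (rule holomorphic_eq_from_reals[OF _ _ r _ that(4)])
    show "H (idx x) (\<phi> (x, of_real t)) = H a (\<phi> (x, of_real t))" if "\<bar>t\<bar> < r" for t
    proof -
      have "\<bar>t\<bar> < e (idx x)" "\<bar>t\<bar> < e a" using that re idx[OF \<open>x \<in> Q\<close>] \<open>a \<in> C\<close> by fastforce+
      then show ?thesis using Hr idx[OF \<open>x \<in> Q\<close>] \<open>x \<in> ball a (e a)\<close> by metis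
    qed
  qed (use that idx in \<open>auto intro!: Hh'\<close>)
  show ?thesis
  proof (rule that[OF r])
    show "continuous_on (Q \<times> ball 0 r) (\<lambda>(x, z). G x z)"
      unfolding continuous_on_eq_continuous_within
    proof
      fix p assume p: "p \<in> Q \<times> ball (0 :: complex) r"
      then obtain a where a: "a \<in> C" "fst p \<in> ball a (e a)" using C by auto
      define S where "S = (Q \<inter> ball a (e a)) \<times> ball (0 :: complex) r"
      have "continuous_on S (\<lambda>p. H a (\<phi> p))"
        by (rule continuous_on_compose2[OF Hc continuous_on_subset[OF \<phi>c]]) (use re[OF a(1)] in \<open>auto simp: S_def\<close>)
      then have "continuous_on S (\<lambda>(x, z). G x z)"
        by (rule continuous_on_eq) (use Geq a in \<open>auto simp: S_def\<close>)
      moreover have "p \<in> S" using p a by (auto simp: S_def)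
      ultimately have "continuous (at p within S) (\<lambda>(x, z). G x z)"
        by (simp add: continuous_on_eq_continuous_within)
      moreover have "at p within S = at p within Q \<times> ball 0 r"
        by (rule at_within_nhd[of _ "ball a (e a) \<times> UNIV"]) (use a p in \<open>auto simp: S_def open_Times mem_Times_iff\<close>)
      ultimately show "continuous (at p within Q \<times> ball 0 r) (\<lambda>(x, z). G x z)" by simp
    qed
    show "G x holomorphic_on ball 0 r" if "x \<in> Q" for x
      unfolding G_def using idx[OF that] by (intro Hh') auto
    show "G x (of_real t) = g (x + t *\<^sub>R \<eta>)" if "x \<in> Q" "\<bar>t\<bar> < r" for x t
      unfolding G_def using idx[OF that(1)] re that by (intro Hr) fastforce+
  qed
qed

text \<open>The outcome of a complex shift, detached from the integral. The constants depend on the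
  direction \<eta> but not on the frequencies, and \<open>B\<close> bounds the first-order term over
  all of \<open>Q\<close> because the integral is estimated by the supremum. Frequencies are
  confined to \<open>M\<close>, where the integrand is periodic; \<open>t\<close> may have either
  sign.\<close>

definition shift_bound ::
    "(real^2) set \<Rightarrow> (real^2) set \<Rightarrow> (real^2 \<Rightarrow> real^2 \<Rightarrow> real^2) \<Rightarrow> (real^2 \<Rightarrow> real^2 \<Rightarrow> real) \<Rightarrow> bool" where
  "shift_bound Q M D I \<longleftrightarrow> (\<forall>\<eta>. \<exists>C K t0. 0 < t0 \<and> 0 \<le> C \<and> 0 \<le> K \<and>
     (\<forall>t. \<forall>m\<in>M. \<forall>n\<in>M. \<forall>B. \<bar>t\<bar> \<le> t0 \<longrightarrow> (\<forall>x\<in>Q. - t * (m \<bullet> D x \<eta>) \<le> B) \<longrightarrow>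
        I m n \<le> C * exp (t * (n \<bullet> \<eta>) + B + K * t\<^sup>2 * l1 m)))"

text \<open>The integral of the extended integrand over \<open>x + z \<eta>\<close> is holomorphic in \<open>z\<close> and, by \<open>inv\<close>, constant
  for real \<open>z\<close>; it is therefore constant, and estimated at \<open>z = i t\<close>.\<close>

lemma norm_integral_shift_bound:
  fixes F :: "real^2 \<Rightarrow> real^2" and w :: "real^2 \<Rightarrow> complex" and M :: "(real^2) set"
  defines "\<Phi> \<equiv> \<lambda>m n x. w x * cis (m \<bullet> F x) * cis (- (n \<bullet> x))"
  assumes w: "extends_holo w" and F: "\<And>i. extends_holo (\<lambda>x. of_real (F x $ i))"
    and diff: "\<And>x. F differentiable (at x)"
    and inv: "\<And>m n v. m \<in> M \<Longrightarrow> n \<in> M \<Longrightarrow> integral (cbox a b) (\<lambda>x. \<Phi> m n (x + v)) = integral (cbox a b) (\<Phi> m n)"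
  shows "shift_bound (cbox a b) M (\<lambda>x. tangent_map F x) (\<lambda>m n. norm (integral (cbox a b) (\<Phi> m n)))"
  unfolding shift_bound_def
proof
  fix \<eta> :: "real^2"
  let ?Q = "cbox a b"
  obtain r1 W where W: "r1 > 0" "continuous_on (?Q \<times> ball 0 r1) (\<lambda>(x, z). W x z)"
    "\<And>x. x \<in> ?Q \<Longrightarrow> W x holomorphic_on ball 0 r1"
    "\<And>x t. x \<in> ?Q \<Longrightarrow> \<bar>t\<bar> < r1 \<Longrightarrow> W x (of_real t) = w (x + t *\<^sub>R \<eta>)"
    using directional_extension[OF w compact_cbox, of a b \<eta>] by blast
  have "\<exists>r G. r > 0 \<and> continuous_on (?Q \<times> ball 0 r) (\<lambda>(x, z). G x z) \<and>
    (\<forall>x\<in>?Q. G x holomorphic_on ball 0 r \<and> (\<forall>t. \<bar>t\<bar> < r \<longrightarrow> G x (of_real t) = of_real (F (x + t *\<^sub>R \<eta>) $ i)))" for i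
    using directional_extension[OF F[of i] compact_cbox[of a b], where \<eta> = \<eta>] by metis
  then obtain r2 G where G: "\<And>i. r2 i > 0" "\<And>i. continuous_on (?Q \<times> ball 0 (r2 i)) (\<lambda>(x, z). G i x z)"
    "\<And>i x. x \<in> ?Q \<Longrightarrow> G i x holomorphic_on ball 0 (r2 i)"
    "\<And>i x t. x \<in> ?Q \<Longrightarrow> \<bar>t\<bar> < r2 i \<Longrightarrow> G i x (of_real t) = of_real (F (x + t *\<^sub>R \<eta>) $ i)"
    by metis
  define r where "r = min r1 (min (r2 1) (r2 2))"
  have r: "r > 0" "r \<le> r1" "r \<le> r2 i" for i using W(1) G(1) exhaust_2[of i] by (auto simp: r_def)
  define s where "s = r / 2"
  have s: "s > 0" "s < r" using r by (auto simp: s_def)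
  have comp: "compact (?Q \<times> cball (0::complex) s)" by (intro compact_Times) auto
  have "bounded ((\<lambda>(x, z). W x z) ` (?Q \<times> cball 0 s))"
    by (intro compact_imp_bounded compact_continuous_image continuous_on_subset[OF W(2)] comp)
       (use r s in auto)
  then obtain CW where CW: "\<And>x z. x \<in> ?Q \<Longrightarrow> z \<in> cball 0 s \<Longrightarrow> norm (W x z) \<le> CW"
    unfolding bounded_iff by force
  have "\<exists>B. \<forall>x\<in>?Q. \<forall>z\<in>cball 0 s. norm (G i x z) \<le> B" for i
  proof -
    have "bounded ((\<lambda>(x, z). G i x z) ` (?Q \<times> cball 0 s))"
      by (intro compact_imp_bounded compact_continuous_image continuous_on_subset[OF G(2)] comp)
         (use r(3)[of i] s in auto)
    then show ?thesis unfolding bounded_iff by force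
  qed
  then obtain BG where BG: "\<And>i x z. x \<in> ?Q \<Longrightarrow> z \<in> cball 0 s \<Longrightarrow> norm (G i x z) \<le> BG i" by metis
  define B0 where "B0 = \<bar>BG 1\<bar> + \<bar>BG 2\<bar> + 1"
  have B0: "B0 > 0" "BG i < B0" for i using exhaust_2[of i] by (auto simp: B0_def)
  define K where "K = 32 * B0 / s\<^sup>2"
  have K: "K \<ge> 0" using B0(1) by (simp add: K_def)
  \<comment> \<open>\<open>holomorphic_Taylor1\<close> on the disc of radius \<open>s\<close> is
    valid up to \<open>s / 2\<close>; \<open>s\<close> was taken below \<open>r\<close> so that the
    extensions are bounded on the closed disc.\<close>
  define t0 where "t0 = s / 2"
  have t0: "t0 > 0" using s by (simp add: t0_def)
  \<comment> \<open>To first order G(i t) = F + i t DF \<eta> with F and DF \<eta> real, so the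
    imaginary part is t DF \<eta> up to the Taylor remainder.\<close>
  have Im_bound: "\<bar>Im (G i x (\<i> * of_real t)) - t * (tangent_map F x \<eta> $ i)\<bar> \<le> K * t\<^sup>2"
    if x: "x \<in> ?Q" and t: "\<bar>t\<bar> \<le> t0" for i x t
  proof -
    have hol: "G i x holomorphic_on ball 0 r"
      by (rule holomorphic_on_subset[OF G(3)[OF x]]) (use r(3)[of i] in auto)
    have G0: "G i x 0 = of_real (F x $ i)" using G(4)[OF x, of 0 i] G(1)[of i] by simp
    have "((\<lambda>t. F (x + t *\<^sub>R \<eta>)) has_derivative (\<lambda>h. tangent_map F x (h *\<^sub>R \<eta>))) (at 0)"
      by (rule has_derivative_compose[where f = "\<lambda>t. x + t *\<^sub>R \<eta>"])
         (use diff[of x] in \<open>auto intro!: derivative_eq_intros simp: frechet_derivative_works\<close>)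
    then have "((\<lambda>t. F (x + t *\<^sub>R \<eta>)) has_vector_derivative tangent_map F x \<eta>) (at 0)"
      unfolding has_vector_derivative_def
      using linear_frechet_derivative[OF diff[of x]] by (simp add: linear_cmul)
    then have "((\<lambda>t. complex_of_real (F (x + t *\<^sub>R \<eta>) $ i)) has_vector_derivative of_real (tangent_map F x \<eta> $ i)) (at 0)"
      by (intro bounded_linear.has_vector_derivative[OF bounded_linear_of_real]
                bounded_linear.has_vector_derivative[OF bounded_linear_vec_nth])
    then have 1: "((\<lambda>t. G i x (of_real t)) has_vector_derivative of_real (tangent_map F x \<eta> $ i)) (at 0)"
    proof (rule has_vector_derivative_transform_within_open[where S = "{-r<..<r}"])
      show "complex_of_real (F (x + t *\<^sub>R \<eta>) $ i) = G i x (of_real t)" if "t \<in> {-r<..<r}" for t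
        using G(4)[OF x, of t i] r(3)[of i] that by auto
    qed (use r in auto)
    have "(G i x has_field_derivative deriv (G i x) 0) (at (of_real 0))"
      using holomorphic_derivI[OF hol] r by simp
    then have 2: "((\<lambda>t. G i x (of_real t)) has_vector_derivative deriv (G i x) 0) (at 0)"
      by (rule has_vector_derivative_real_field)
    have dG: "deriv (G i x) 0 = of_real (tangent_map F x \<eta> $ i)"
      using vector_derivative_unique_at[OF 2 1] .
    have "norm (G i x (\<i> * of_real t) - G i x 0 - deriv (G i x) 0 * (\<i> * of_real t)) \<le> 32 * B0 / s\<^sup>2 * (norm (\<i> * of_real t))\<^sup>2"
    proof (rule holomorphic_Taylor1)
      show "G i x holomorphic_on ball 0 s" by (rule holomorphic_on_subset[OF hol]) (use s in auto)
      show "norm (G i x z) < B0" if "z \<in> ball 0 s" for z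
        using BG[OF x, of z i] B0(2)[of i] that by fastforce
    qed (use s t in \<open>auto simp: norm_mult t0_def\<close>)
    then have "norm (G i x (\<i> * of_real t) - G i x 0 - deriv (G i x) 0 * (\<i> * of_real t)) \<le> K * t\<^sup>2"
      by (simp add: norm_mult K_def)
    moreover have "Im (G i x (\<i> * of_real t) - G i x 0 - deriv (G i x) 0 * (\<i> * of_real t))
        = Im (G i x (\<i> * of_real t)) - t * (tangent_map F x \<eta> $ i)"
      unfolding dG G0 by simp
    ultimately show ?thesis using abs_Im_le_cmod by (metis order_trans)
  qed
  \<comment> \<open>The continuation of \<Phi> along x + z \<eta>: \<open>cis\<close> becomes
    \<open>exp\<close> of a complex argument.\<close>
  define \<Psi> where "\<Psi> m n x z = W x z * exp (\<i> * (of_real (m$1) * G 1 x z + of_real (m$2) * G 2 x z))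
      * exp (- (\<i> * (of_real (n \<bullet> x) + z * of_real (n \<bullet> \<eta>))))" for m n :: "real^2" and x z
  have \<Psi>_real: "\<Psi> m n x (of_real t) = \<Phi> m n (x + t *\<^sub>R \<eta>)" if "x \<in> ?Q" "\<bar>t\<bar> < r" for m n x t
  proof -
    have "G i x (of_real t) = of_real (F (x + t *\<^sub>R \<eta>) $ i)" for i
      using G(4)[OF that(1), of t i] r(3)[of i] that(2) by auto
    moreover have "W x (of_real t) = w (x + t *\<^sub>R \<eta>)"
      using W(4)[OF that(1), of t] r(2) that(2) by auto
    ultimately show ?thesis
      by (simp add: \<Psi>_def \<Phi>_def cis_conv_exp inner_vec_def sum_2 algebra_simps)
  qed
  have \<Psi>_hol: "\<Psi> m n x holomorphic_on ball 0 r" if "x \<in> ?Q" for m n x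
    unfolding \<Psi>_def
    by (intro holomorphic_intros holomorphic_on_subset[OF W(3)[OF that]] holomorphic_on_subset[OF G(3)[OF that]])
       (use r in \<open>auto simp: r_def\<close>)
  have cW: "continuous_on (ball 0 r \<times> ?Q) (\<lambda>p. W (snd p) (fst p))"
  proof -
    have "continuous_on (ball 0 r \<times> ?Q) (\<lambda>p. (\<lambda>(x, z). W x z) (snd p, fst p))"
      by (rule continuous_on_compose2[OF W(2)]) (use r(2) in \<open>auto intro!: continuous_intros\<close>)
    then show ?thesis by simp
  qed
  have cG: "continuous_on (ball 0 r \<times> ?Q) (\<lambda>p. G i (snd p) (fst p))" for i
  proof -
    have "continuous_on (ball 0 r \<times> ?Q) (\<lambda>p. (\<lambda>(x, z). G i x z) (snd p, fst p))"
      by (rule continuous_on_compose2[OF G(2)[of i]]) (use r(3)[of i] in \<open>auto intro!: continuous_intros\<close>)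
    then show ?thesis by simp
  qed
  have \<Psi>_cont: "continuous_on (ball 0 r \<times> ?Q) (\<lambda>(z, x). \<Psi> m n x z)" for m n
    unfolding \<Psi>_def case_prod_beta by (intro continuous_intros cW cG)
  have shift: "integral ?Q (\<Phi> m n) = integral ?Q (\<lambda>x. \<Psi> m n x z)"
    if "m \<in> M" "n \<in> M" "z \<in> ball 0 r" for m n z
  proof (rule holomorphic_eq_from_reals[OF _ _ r(1) _ that(3), where f = "\<lambda>_. integral ?Q (\<Phi> m n)"])
    show "(\<lambda>z. integral ?Q (\<lambda>x. \<Psi> m n x z)) holomorphic_on ball 0 r"
      using \<Psi>_cont \<Psi>_hol by (intro holomorphic_on_integral_param) auto
    show "integral ?Q (\<Phi> m n) = integral ?Q (\<lambda>x. \<Psi> m n x (of_real t))" if t: "\<bar>t\<bar> < r" for t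
    proof -
      have "integral ?Q (\<lambda>x. \<Psi> m n x (of_real t)) = integral ?Q (\<lambda>x. \<Phi> m n (x + t *\<^sub>R \<eta>))"
        by (rule integral_cong) (use \<Psi>_real t in auto)
      then show ?thesis using inv[OF \<open>m \<in> M\<close> \<open>n \<in> M\<close>] by simp
    qed
  qed auto
  define C where "C = \<bar>CW\<bar> * measure lborel ?Q"
  have "norm (integral ?Q (\<Phi> m n)) \<le> C * exp (t * (n \<bullet> \<eta>) + B + K * t\<^sup>2 * l1 m)"
    if t: "\<bar>t\<bar> \<le> t0" and mn: "m \<in> M" "n \<in> M"
      and B: "\<forall>x\<in>?Q. - t * (m \<bullet> tangent_map F x \<eta>) \<le> B" for t m n B
  proof -
    let ?z = "\<i> * of_real t"
    have z: "?z \<in> cball 0 s" using t s by (simp add: norm_mult t0_def)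
    have "norm (\<Psi> m n x ?z) \<le> \<bar>CW\<bar> * exp (t * (n \<bullet> \<eta>) + B + K * t\<^sup>2 * l1 m)" if x: "x \<in> ?Q" for x
    proof -
      let ?d = "\<lambda>i. Im (G i x ?z) - t * (tangent_map F x \<eta> $ i)"
      have "\<bar>m$i * ?d i\<bar> \<le> \<bar>m$i\<bar> * (K * t\<^sup>2)" for i
        unfolding abs_mult by (intro mult_left_mono Im_bound x t) auto
      then have "- (m$i * ?d i) \<le> \<bar>m$i\<bar> * (K * t\<^sup>2)" for i
        using abs_le_iff by blast
      from add_mono[OF this[of 1] this[of 2]]
      have "- (m$1 * Im (G 1 x ?z) + m$2 * Im (G 2 x ?z)) \<le> - t * (m \<bullet> tangent_map F x \<eta>) + K * t\<^sup>2 * l1 m"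
        by (simp add: inner_vec_def sum_2 algebra_simps)
      also have "\<dots> \<le> B + K * t\<^sup>2 * l1 m" using B x by simp
      finally have *: "- (m$1 * Im (G 1 x ?z) + m$2 * Im (G 2 x ?z)) + t * (n \<bullet> \<eta>) \<le> t * (n \<bullet> \<eta>) + B + K * t\<^sup>2 * l1 m"
        by simp
      \<comment> \<open>|exp (i a)| = exp (- Im a); at z = i t the last exponential of \<Psi> has
        modulus exp (t n\<bullet>\<eta>).\<close>
      have "norm (\<Psi> m n x ?z) = norm (W x ?z) * exp (- (m$1 * Im (G 1 x ?z) + m$2 * Im (G 2 x ?z)) + t * (n \<bullet> \<eta>))"
        by (simp add: \<Psi>_def norm_mult exp_add)
      also have "\<dots> \<le> \<bar>CW\<bar> * exp (t * (n \<bullet> \<eta>) + B + K * t\<^sup>2 * l1 m)"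
        using * CW[OF x z] by (intro mult_mono) auto
      finally show ?thesis .
    qed
    moreover have "((\<lambda>x. \<Psi> m n x ?z) has_integral integral ?Q (\<Phi> m n)) ?Q"
    proof -
      have "continuous_on ?Q (\<lambda>x. (\<lambda>(z, x). \<Psi> m n x z) (?z, x))"
        by (rule continuous_on_compose2[OF \<Psi>_cont]) (use z s in \<open>auto intro!: continuous_intros\<close>)
      then have "continuous_on ?Q (\<lambda>x. \<Psi> m n x ?z)" by simp
      moreover have "?z \<in> ball 0 r" using z s by auto
      ultimately show ?thesis
        using shift[OF mn, of ?z] integrable_continuous integrable_integral by metis
    qed
    ultimately have "norm (integral ?Q (\<Phi> m n)) \<le> \<bar>CW\<bar> * exp (t * (n \<bullet> \<eta>) + B + K * t\<^sup>2 * l1 m) * measure lborel ?Q"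
      by (intro has_integral_bound) auto
    then show ?thesis by (simp add: C_def mult_ac)
  qed
  moreover have "C \<ge> 0" by (simp add: C_def)
  ultimately show "\<exists>C K t0. 0 < t0 \<and> 0 \<le> C \<and> 0 \<le> K \<and>
     (\<forall>t. \<forall>m\<in>M. \<forall>n\<in>M. \<forall>B. \<bar>t\<bar> \<le> t0 \<longrightarrow> (\<forall>x\<in>?Q. - t * (m \<bullet> tangent_map F x \<eta>) \<le> B) \<longrightarrow>
        norm (integral ?Q (\<Phi> m n)) \<le> C * exp (t * (n \<bullet> \<eta>) + B + K * t\<^sup>2 * l1 m))"
    using t0 K by blast
qed

section \<open>Change of variables on the torus\<close>

definition period_vec :: "int \<times> int \<Rightarrow> real^2" where
  "period_vec k = (\<chi> i. 2 * pi * of_int (if i = 1 then fst k else snd k))"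

lemma period_vec_nth: "period_vec k $ 1 = 2 * pi * of_int (fst k)" "period_vec k $ 2 = 2 * pi * of_int (snd k)"
  by (simp_all add: period_vec_def)

lemma period_vec_uminus: "period_vec (- k) = - period_vec k"
  by (simp add: vec_eq_iff forall_2 period_vec_nth)

lemma period_vec_inject: "period_vec k = period_vec l \<longleftrightarrow> k = l"
  by (simp add: vec_eq_iff forall_2 period_vec_nth prod_eq_iff)

definition fundamental_domain :: "(real^2) set \<Rightarrow> bool" where
  "fundamental_domain A \<longleftrightarrow> (\<forall>x. \<exists>!k. x + period_vec k \<in> A)"

section \<open>Integrals of periodic functions over fundamental domains\<close>

lemma lborel_integral_translate:
  fixes f :: "'a::euclidean_space \<Rightarrow> 'b::{banach, second_countable_topology}"
  assumes [measurable]: "f \<in> borel_measurable borel"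
  shows "(\<integral>x. f (c + x) \<partial>lborel) = (\<integral>x. f x \<partial>lborel)"
proof -
  have "(\<integral>x. f x \<partial>lborel) = (\<integral>x. f x \<partial>distr lborel borel ((+) c))" by (simp add: lborel_distr_plus)
  also have "\<dots> = (\<integral>x. f (c + x) \<partial>lborel)" by (subst integral_distr) auto
  finally show ?thesis by simp
qed

lemma set_integrable_bounded_borel:
  fixes g :: "'a::euclidean_space \<Rightarrow> 'b::euclidean_space"
  assumes A: "A \<in> sets borel" "bounded A" and g: "continuous_on UNIV g"
  shows "set_integrable lborel A g"
proof -
  have "compact (closure A)" using A by simp
  then have "bounded (g ` closure A)"
    using g by (intro compact_imp_bounded compact_continuous_image) (auto intro: continuous_on_subset)
  then obtain B where B: "\<And>x. x \<in> A \<Longrightarrow> norm (g x) \<le> B"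
    using closure_subset unfolding bounded_iff by blast
  have "integrable lborel (\<lambda>x. indicator A x *\<^sub>R g x)"
    by (rule integrableI_bounded_set_indicator[where B = B])
       (use A B g emeasure_bounded_finite[OF A(2)] in \<open>auto intro: borel_measurable_continuous_onI\<close>)
  then show ?thesis by (simp add: set_integrable_def)
qed

text \<open>Cut \<open>A\<close> into the pieces that the various periods carry into
  \<open>B\<close>, and move each piece by its period: the results partition \<open>B\<close>.
  Boundedness leaves finitely many periods to consider.\<close>

lemma integral_fundamental_domain_eq:
  fixes g :: "real^2 \<Rightarrow> complex"
  assumes A: "A \<in> sets borel" "bounded A" "fundamental_domain A"
    and B: "B \<in> sets borel" "bounded B" "fundamental_domain B"
    and g: "continuous_on UNIV g" "\<And>x k. g (x + period_vec k) = g x"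
  shows "integral A g = integral B g"
proof -
  note [measurable] = A(1) B(1)
  have gm [measurable]: "g \<in> borel_measurable borel" by (rule borel_measurable_continuous_onI[OF g(1)])
  obtain R where R: "\<And>x. x \<in> A \<union> B \<Longrightarrow> norm x \<le> R"
    using bounded_Un[of A B] A(2) B(2) unfolding bounded_iff by blast
  \<comment> \<open>If a point and its translate both have norm at most \<open>R\<close>, each
    coordinate of the period is at most 2 R in modulus; since 2 pi >= 2, the integers are at most
    \<open>R\<close>.\<close>
  define K where "K = {-\<lceil>R\<rceil>..\<lceil>R\<rceil>} \<times> {-\<lceil>R\<rceil>..\<lceil>R\<rceil>}"
  have K: "k \<in> K" if "x \<in> A \<union> B" "x + period_vec k \<in> A \<union> B" for x k
  proof -
    have j: "\<bar>real_of_int j\<bar> \<le> R" if j: "\<bar>2 * pi * of_int j\<bar> \<le> 2 * R" for j :: int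
    proof -
      have "2 * \<bar>real_of_int j\<bar> \<le> 2 * pi * \<bar>real_of_int j\<bar>"
        using pi_gt3 by (intro mult_right_mono) auto
      then show ?thesis using j by (simp add: abs_mult)
    qed
    have "\<bar>period_vec k $ i\<bar> \<le> 2 * R" for i
      using component_le_norm_cart[of x i] component_le_norm_cart[of "x + period_vec k" i] R[OF that(1)] R[OF that(2)]
      by simp
    from this[of 1] this[of 2] have "\<bar>real_of_int (fst k)\<bar> \<le> R" "\<bar>real_of_int (snd k)\<bar> \<le> R"
      unfolding period_vec_nth by (auto intro: j)
    then have "\<bar>fst k\<bar> \<le> \<lceil>R\<rceil>" "\<bar>snd k\<bar> \<le> \<lceil>R\<rceil>" by linarith+
    then show ?thesis by (auto simp: K_def mem_Times_iff)
  qed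
  have finK: "finite K" by (simp add: K_def)
  have Kneg: "- k \<in> K \<longleftrightarrow> k \<in> K" for k by (auto simp: K_def mem_Times_iff)
  have one: "(\<Sum>k\<in>K. indicator D (x + period_vec k)) = (1 :: real)"
    if x: "x \<in> A \<union> B" and D: "D = A \<or> D = B" for x D
  proof -
    have "fundamental_domain D" using D A(3) B(3) by auto
    then obtain k0 where k0: "x + period_vec k0 \<in> D" "\<And>k. x + period_vec k \<in> D \<Longrightarrow> k = k0"
      unfolding fundamental_domain_def by blast
    have "indicator D (x + period_vec k) = (if k = k0 then 1 else 0 :: real)" for k
      using k0(1) k0(2)[of k] by (cases "k = k0") (auto simp: indicator_def)
    then have "(\<Sum>k\<in>K. indicator D (x + period_vec k)) = (\<Sum>k\<in>K. if k = k0 then 1 else 0 :: real)"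
      by simp
    moreover have "k0 \<in> K" using K[OF x, of k0] k0(1) D by blast
    ultimately show ?thesis using finK by simp
  qed
  \<comment> \<open>\<open>g\<close> on the part of \<open>A\<close> that
    \<open>period_vec k\<close> carries into \<open>B\<close>. After translation this is the part of
    \<open>B\<close> that the opposite period carries into \<open>A\<close>.\<close>
  define h where "h k x = indicator {x. x + period_vec k \<in> B} x *\<^sub>R (indicator A x *\<^sub>R g x)" for k x
  have hm [measurable]: "h k \<in> borel_measurable borel" for k unfolding h_def by measurable
  have hint: "integrable lborel (h k)" for k
    unfolding h_def
  proof (rule integrable_mult_indicator)
    show "{x. x + period_vec k \<in> B} \<in> sets lborel" by simp
    show "integrable lborel (\<lambda>x. indicator A x *\<^sub>R g x)"
      using set_integrable_bounded_borel[OF A(1,2) g(1)] by (simp add: set_integrable_def)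
  qed
  have int: "set_integrable lborel A g" "set_integrable lborel B g"
    by (intro set_integrable_bounded_borel A B g)+
  have "integral A g = (\<integral>x. indicator A x *\<^sub>R g x \<partial>lborel)"
    using set_borel_integral_eq_integral(2)[OF int(1)] by (simp add: set_lebesgue_integral_def)
  also have "\<dots> = (\<integral>x. (\<Sum>k\<in>K. h k x) \<partial>lborel)"
  proof (rule Bochner_Integration.integral_cong[OF refl])
    fix x
    have "(\<Sum>k\<in>K. h k x) = (\<Sum>k\<in>K. indicator B (x + period_vec k)) *\<^sub>R (indicator A x *\<^sub>R g x)"
      unfolding scaleR_left.sum h_def by (intro sum.cong refl) (auto simp: indicator_def)
    then show "indicator A x *\<^sub>R g x = (\<Sum>k\<in>K. h k x)"
      using one[of x B] by (cases "x \<in> A") auto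
  qed
  also have "\<dots> = (\<Sum>k\<in>K. \<integral>x. h k x \<partial>lborel)" by (rule Bochner_Integration.integral_sum[OF hint])
  also have "\<dots> = (\<Sum>k\<in>K. \<integral>x. h k (- period_vec k + x) \<partial>lborel)"
    by (intro sum.cong refl lborel_integral_translate[symmetric]) measurable
  also have "\<dots> = (\<integral>x. (\<Sum>k\<in>K. h k (- period_vec k + x)) \<partial>lborel)"
  proof (rule Bochner_Integration.integral_sum[symmetric])
    fix k
    have "integrable (distr lborel borel ((+) (- period_vec k))) (h k)"
      unfolding lborel_distr_plus by (rule hint)
    then show "integrable lborel (\<lambda>x. h k (- period_vec k + x))"
      by (subst (asm) integrable_distr_eq) auto
  qed
  also have "\<dots> = (\<integral>x. indicator B x *\<^sub>R g x \<partial>lborel)"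
  proof (rule Bochner_Integration.integral_cong[OF refl])
    fix x
    have "h k (- period_vec k + x) = indicator A (x + period_vec (- k)) *\<^sub>R (indicator B x *\<^sub>R g x)" for k
    proof -
      have e1: "- period_vec k + x = x + period_vec (- k)" and e2: "x + period_vec (- k) + period_vec k = x"
        by (simp_all add: period_vec_uminus)
      show ?thesis unfolding h_def e1 by (auto simp: indicator_def e2 g(2))
    qed
    then have "(\<Sum>k\<in>K. h k (- period_vec k + x)) = (\<Sum>k\<in>K. indicator A (x + period_vec (- k))) *\<^sub>R (indicator B x *\<^sub>R g x)"
      unfolding scaleR_left.sum by (intro sum.cong refl)
    also have "(\<Sum>k\<in>K. indicator A (x + period_vec (- k))) = (\<Sum>k\<in>K. indicator A (x + period_vec k) :: real)"
      by (rule sum.reindex_bij_witness[of _ uminus uminus]) (auto simp: Kneg)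
    finally show "(\<Sum>k\<in>K. h k (- period_vec k + x)) = indicator B x *\<^sub>R g x"
      using one[of x A] by (cases "x \<in> B") auto
  qed
  also have "\<dots> = integral B g"
    using set_borel_integral_eq_integral(2)[OF int(2)] by (simp add: set_lebesgue_integral_def)
  finally show ?thesis .
qed

definition period_cell :: "(real^2) set" where
  "period_cell = {x. \<forall>i. 0 \<le> x$i \<and> x$i < 2 * pi}"

lemma fundamental_domain_period_cell: "fundamental_domain period_cell"
  unfolding fundamental_domain_def
proof
  fix x :: "real^2"
  have *: "0 \<le> y + 2 * pi * of_int j \<and> y + 2 * pi * of_int j < 2 * pi \<longleftrightarrow> j = - \<lfloor>y / (2 * pi)\<rfloor>" for y j
  proof -
    have e1: "of_int (- j) \<le> y / (2 * pi) \<longleftrightarrow> of_int (- j) * (2 * pi) \<le> y"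
      by (rule pos_le_divide_eq) simp
    have e2: "y / (2 * pi) < of_int (- j) + 1 \<longleftrightarrow> y < (of_int (- j) + 1) * (2 * pi)"
      by (rule pos_divide_less_eq) simp
    have e3: "(of_int (- j) + 1) * (2 * pi) = 2 * pi - 2 * pi * of_int j" "of_int (- j) * (2 * pi) = - (2 * pi * of_int j)"
      by (simp_all add: algebra_simps)
    have "0 \<le> y + 2 * pi * of_int j \<and> y + 2 * pi * of_int j < 2 * pi \<longleftrightarrow>
        of_int (- j) \<le> y / (2 * pi) \<and> y / (2 * pi) < of_int (- j) + 1"
      unfolding e1 e2 e3 by (rule iffI; elim conjE; intro conjI; linarith)
    also have "\<dots> \<longleftrightarrow> \<lfloor>y / (2 * pi)\<rfloor> = - j" by (rule floor_eq_iff[symmetric])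
    finally show ?thesis by auto
  qed
  have "x + period_vec k \<in> period_cell \<longleftrightarrow> k = (- \<lfloor>x$1 / (2 * pi)\<rfloor>, - \<lfloor>x$2 / (2 * pi)\<rfloor>)" for k
    unfolding period_cell_def mem_Collect_eq forall_2 vector_add_component period_vec_nth * prod_eq_iff fst_conv snd_conv ..
  then show "\<exists>!k. x + period_vec k \<in> period_cell" by simp
qed

text \<open>Shows that the half-open cell is sigma-compact, so that its continuous images are
  countable unions of compact sets and hence Borel.\<close>

lemma period_cell_Union: "period_cell = (\<Union>n. cbox 0 (\<chi> i. 2 * pi - inverse (real (Suc n))))"
proof (intro equalityI subsetI)
  fix x assume x: "x \<in> period_cell"
  then have "0 < min (2 * pi - x$1) (2 * pi - x$2)" by (auto simp: period_cell_def)
  then obtain n where n: "inverse (real (Suc n)) < min (2 * pi - x$1) (2 * pi - x$2)"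
    using reals_Archimedean by blast
  then have "x \<in> cbox 0 (\<chi> i. 2 * pi - inverse (real (Suc n)))"
    using x by (auto simp: period_cell_def mem_box_cart forall_2)
  then show "x \<in> (\<Union>n. cbox 0 (\<chi> i. 2 * pi - inverse (real (Suc n))))" by blast
next
  fix x :: "real^2" assume "x \<in> (\<Union>n. cbox 0 (\<chi> i. 2 * pi - inverse (real (Suc n))))"
  then obtain n where n: "x \<in> cbox 0 (\<chi> i. 2 * pi - inverse (real (Suc n)))" by blast
  have "0 \<le> x$i \<and> x$i < 2 * pi" for i
  proof -
    have "0 \<le> x$i" "x$i \<le> 2 * pi - inverse (real (Suc n))" using n by (auto simp: mem_box_cart)
    moreover have "inverse (real (Suc n)) > 0" by simp
    ultimately show ?thesis by linarith
  qed
  then show "x \<in> period_cell" by (simp add: period_cell_def)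
qed

lemma period_cell_subset: "period_cell \<subseteq> cbox 0 (\<chi> i. 2 * pi)"
  by (auto simp: period_cell_def mem_box_cart less_eq_real_def)

lemma borel_image_period_cell:
  assumes "continuous_on UNIV G"
  shows "G ` period_cell \<in> sets borel" "bounded (G ` period_cell)"
proof -
  have "compact (G ` cbox a b)" for a b
    using assms by (intro compact_continuous_image) (auto intro: continuous_on_subset)
  then have "closed (G ` cbox a b)" for a b by (rule compact_imp_closed)
  then show "G ` period_cell \<in> sets borel"
    unfolding period_cell_Union image_UN by (intro sets.countable_UN) auto
  show "bounded (G ` period_cell)"
    by (rule bounded_subset[OF compact_imp_bounded[OF \<open>\<And>a b. compact (G ` cbox a b)\<close>] image_mono[OF period_cell_subset]])
qed

lemma integral_period_cell: "integral (cbox 0 (\<chi> i. 2 * pi)) g = integral period_cell (g :: real^2 \<Rightarrow> 'a::banach)"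
proof (rule integral_subset_negligible[OF period_cell_subset, symmetric])
  have "negligible ({x :: real^2. x$1 = 2 * pi} \<union> {x. x$2 = 2 * pi})"
    by (simp add: cart_eq_inner_axis negligible_standard_hyperplane)
  then show "negligible (cbox 0 (\<chi> i. 2 * pi) - period_cell)"
    by (rule negligible_subset) (auto simp: period_cell_def mem_box_cart forall_2)
qed

lemma torus_proj_eq_iff: "torus_proj x = torus_proj y \<longleftrightarrow> (\<exists>k. y = x + period_vec k)"
proof -
  have *: "cis a = cis b \<longleftrightarrow> (\<exists>j::int. b = a + 2 * pi * of_int j)" for a b
  proof
    assume "cis a = cis b"
    then obtain n :: int where "\<i> * complex_of_real a = \<i> * complex_of_real b + (of_int (2 * n) * pi) * \<i>"
      unfolding cis_conv_exp exp_eq by blast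
    then have "Im (\<i> * complex_of_real a) = Im (\<i> * complex_of_real b + (of_int (2 * n) * pi) * \<i>)" by simp
    then have "b = a + 2 * pi * of_int (- n)" by simp
    then show "\<exists>j::int. b = a + 2 * pi * of_int j" by blast
  next
    assume "\<exists>j::int. b = a + 2 * pi * of_int j"
    then obtain j :: int where "b = a + 2 * pi * of_int j" by blast
    then show "cis a = cis b" by (simp add: cis_mult[symmetric] cis_multiple_2pi)
  qed
  show ?thesis
    by (auto simp: torus_proj_def vec_eq_iff forall_2 * period_vec_nth)
qed

lemma torus_proj_in_torus: "torus_proj x \<in> torus"
  by (simp add: torus_proj_def torus_def)

lemma torus_projE:
  assumes "z \<in> torus" obtains x where "z = torus_proj x"
proof -
  have "cis (Arg (z$i)) = z$i" for i
  proof -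
    have "norm (z$i) = 1" using assms by (simp add: torus_def)
    then have "z$i \<noteq> 0" "sgn (z$i) = z$i" by (auto simp: sgn_div_norm)
    then show ?thesis by (simp add: cis_Arg)
  qed
  then have "z = torus_proj (\<chi> i. Arg (z$i))"
    by (simp add: torus_proj_def vec_eq_iff)
  then show ?thesis by (rule that)
qed

text \<open>Bijectivity of \<open>R\<close> on the torus makes \<open>G\<close> injective on the
  cell and its image \<open>S\<close> another fundamental domain. The substitution rule gives the
  integral over \<open>S\<close>, which by periodicity is the one over the cell. \<open>G\<close>
  itself is not periodic.\<close>

lemma torus_change_of_variables:
  fixes \<psi> :: "complex^2 \<Rightarrow> complex"
  assumes R: "bij_betw R torus torus" and G: "\<And>x. R (torus_proj x) = torus_proj (G x)"
    and diff: "\<And>x. (G has_derivative G' x) (at x)"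
    and \<psi>: "continuous_on UNIV (\<lambda>x. \<psi> (torus_proj x))"
  shows "integral (cbox 0 (\<chi> i. 2 * pi)) (\<lambda>x. \<psi> (torus_proj x)) =
    integral (cbox 0 (\<chi> i. 2 * pi)) (\<lambda>x. \<bar>det (matrix (G' x))\<bar> *\<^sub>R \<psi> (R (torus_proj x)))"
proof -
  let ?g = "\<lambda>x. \<psi> (torus_proj x)"
  have Gc: "continuous_on UNIV G"
    using diff by (meson continuous_at_imp_continuous_on has_derivative_continuous)
  define S where "S = G ` period_cell"
  have S: "S \<in> sets borel" "bounded S" unfolding S_def by (rule borel_image_period_cell[OF Gc])+
  have unit: "id ` period_cell \<in> sets borel" "bounded (id ` period_cell)"
    by (rule borel_image_period_cell, simp add: continuous_on_id')+
  then have cell: "period_cell \<in> sets borel" "bounded period_cell" by simp_all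
  have inj: "inj_on G period_cell"
  proof (rule inj_onI)
    fix x y assume xy: "x \<in> period_cell" "y \<in> period_cell" "G x = G y"
    then have "R (torus_proj x) = R (torus_proj y)" by (simp add: G)
    then have "torus_proj x = torus_proj y"
      using inj_onD[OF bij_betw_imp_inj_on[OF R]] torus_proj_in_torus by blast
    then obtain k where k: "y = x + period_vec k" by (auto simp: torus_proj_eq_iff)
    have "x + period_vec (0, 0) = x" by (simp add: vec_eq_iff forall_2 period_vec_nth)
    then have "k = (0, 0)"
      using fundamental_domain_period_cell xy(1,2) k unfolding fundamental_domain_def by metis
    then show "x = y" using k by (simp add: vec_eq_iff forall_2 period_vec_nth)
  qed
  have "fundamental_domain S"
    unfolding fundamental_domain_def
  proof (intro allI ex_ex1I)
    fix x
    have "torus_proj x \<in> R ` torus"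
      using R torus_proj_in_torus[of x] by (simp add: bij_betw_def)
    then obtain z where z: "z \<in> torus" "R z = torus_proj x" by (metis imageE)
    then obtain y where y: "z = torus_proj y" using torus_projE by blast
    obtain k where k: "y + period_vec k \<in> period_cell"
      using fundamental_domain_period_cell unfolding fundamental_domain_def by blast
    have "torus_proj (y + period_vec k) = torus_proj y" using torus_proj_eq_iff by metis
    then have "torus_proj x = torus_proj (G (y + period_vec k))" using z y G by metis
    then obtain l where "G (y + period_vec k) = x + period_vec l" by (auto simp: torus_proj_eq_iff)
    then show "\<exists>l. x + period_vec l \<in> S" using k unfolding S_def by (metis imageI)
  next
    fix x k l assume kl: "x + period_vec k \<in> S" "x + period_vec l \<in> S"
    then obtain a b where ab: "a \<in> period_cell" "b \<in> period_cell" "G a = x + period_vec k" "G b = x + period_vec l"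
      unfolding S_def by (metis imageE)
    have "R (torus_proj a) = R (torus_proj b)"
      unfolding G ab using torus_proj_eq_iff by metis
    then have "torus_proj a = torus_proj b"
      using inj_onD[OF bij_betw_imp_inj_on[OF R]] torus_proj_in_torus by blast
    then obtain j where j: "b = a + period_vec j" by (auto simp: torus_proj_eq_iff)
    have "a + period_vec (0, 0) = a" by (simp add: vec_eq_iff forall_2 period_vec_nth)
    then have "j = (0, 0)"
      using fundamental_domain_period_cell ab(1,2) j unfolding fundamental_domain_def by metis
    then have "a = b" using j by (simp add: vec_eq_iff forall_2 period_vec_nth)
    then have "period_vec k = period_vec l" using ab by simp
    then show "k = l" by (simp add: period_vec_inject)
  qed
  then have eq1: "integral period_cell ?g = integral S ?g"
  proof (intro integral_fundamental_domain_eq S cell \<psi> fundamental_domain_period_cell)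
    have "torus_proj x = torus_proj (x + period_vec k)" for x k using torus_proj_eq_iff by blast
    then show "?g (x + period_vec k) = ?g x" for x k by simp
  qed
  \<comment> \<open>The substitution rule is used for a \<open>real^2\<close>-valued function:
    \<open>f\<close> holds the real and imaginary parts of the integrand and \<open>L\<close>
    reassembles them.\<close>
  define L :: "real^2 \<Rightarrow> complex" where "L v = Complex (v$1) (v$2)" for v
  define f :: "real^2 \<Rightarrow> real^2" where "f x = (\<chi> i. if i = 1 then Re (?g x) else Im (?g x))" for x
  have L: "bounded_linear L"
  proof -
    have "L = (\<lambda>v. of_real (v$1) + \<i> * of_real (v$2))" by (auto simp: L_def complex_eq_iff)
    then show ?thesis
      by (auto intro!: bounded_linear_add bounded_linear_compose[OF bounded_linear_mult_right]
          bounded_linear_compose[OF bounded_linear_of_real] bounded_linear_vec_nth)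
  qed
  have Lf: "L (f x) = ?g x" for x by (simp add: L_def f_def)
  have fc: "continuous_on UNIV f"
    unfolding f_def
  proof (rule continuous_on_vec_lambda)
    show "continuous_on UNIV (\<lambda>x. if i = 1 then Re (?g x) else Im (?g x))" for i :: 2
      using \<psi> by (cases "i = 1") (auto intro!: continuous_intros)
  qed
  have "integrable lborel (\<lambda>x. indicator S x *\<^sub>R f x)"
    using set_integrable_bounded_borel[OF S fc] by (simp add: set_integrable_def)
  then have fS: "f absolutely_integrable_on S"
    unfolding set_integrable_def by (subst integrable_completion) auto
  have lebesgue: "period_cell \<in> sets lebesgue" using cell(1) by simp
  have der: "(G has_derivative G' x) (at x within period_cell)" for x
    using diff by (rule has_derivative_at_withinI)
  have "integral S f = integral period_cell (\<lambda>x. \<bar>det (matrix (G' x))\<bar> *\<^sub>R f (G x))"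
    using integral_change_of_variables[OF lebesgue der inj, of f] fS unfolding S_def by blast
  moreover have "(\<lambda>x. \<bar>det (matrix (G' x))\<bar> *\<^sub>R f (G x)) absolutely_integrable_on period_cell"
    using absolutely_integrable_change_of_variables[OF lebesgue der inj, of f] fS unfolding S_def by blast
  ultimately have "integral S (L \<circ> f) = integral period_cell (L \<circ> (\<lambda>x. \<bar>det (matrix (G' x))\<bar> *\<^sub>R f (G x)))"
    using integral_linear[OF set_lebesgue_integral_eq_integral(1)[OF fS] L]
      integral_linear[OF set_lebesgue_integral_eq_integral(1) L, of period_cell "\<lambda>x. \<bar>det (matrix (G' x))\<bar> *\<^sub>R f (G x)"]
    by metis
  moreover have "L \<circ> f = ?g" using Lf by auto
  moreover have "L \<circ> (\<lambda>x. \<bar>det (matrix (G' x))\<bar> *\<^sub>R f (G x)) = (\<lambda>x. \<bar>det (matrix (G' x))\<bar> *\<^sub>R \<psi> (R (torus_proj x)))"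
    using Lf G by (auto simp: linear_cmul[OF bounded_linear.linear[OF L]])
  ultimately show ?thesis unfolding integral_period_cell eq1 by simp
qed

section \<open>Trace-class matrix operators\<close>

definition int_l1 :: "int^2 \<Rightarrow> real" where
  "int_l1 n = \<bar>real_of_int (n$1)\<bar> + \<bar>real_of_int (n$2)\<bar>"

definition int_box :: "nat \<Rightarrow> (int^2) set" where
  "int_box R = {n. \<bar>n$1\<bar> \<le> int R \<and> \<bar>n$2\<bar> \<le> int R}"

lemma int_l1_nonneg: "0 \<le> int_l1 n"
  by (simp add: int_l1_def)

lemma inj_on_int_vec_pair: "inj_on (\<lambda>n :: int^2. (n$1, n$2)) S"
  by (auto simp: inj_on_def vec_eq_iff forall_2)

lemma int_box_image: "(\<lambda>n. (n$1, n$2)) ` int_box R \<subseteq> {- int R..int R} \<times> {- int R..int R}"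
  by (auto simp: int_box_def)

lemma finite_int_box: "finite (int_box R)"
  by (rule finite_imageD[OF finite_subset[OF int_box_image] inj_on_int_vec_pair]) simp

lemma card_int_box_le: "card (int_box R) \<le> (2 * R + 1)\<^sup>2"
proof -
  have "card (int_box R) \<le> card ({- int R..int R} \<times> {- int R..int R})"
    by (rule card_inj_on_le[OF inj_on_int_vec_pair int_box_image]) simp
  also have "card {- int R..int R} = 2 * R + 1" by auto
  then have "card ({- int R..int R} \<times> {- int R..int R}) = (2 * R + 1)\<^sup>2"
    by (simp only: card_cartesian_product power2_eq_square)
  finally show ?thesis .
qed

lemma finite_subset_int_box:
  assumes "finite X" obtains R where "X \<subseteq> int_box R"
proof -
  define R where "R = (\<Sum>n\<in>X. nat \<bar>n$1\<bar> + nat \<bar>n$2\<bar>)"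
  have "nat \<bar>n$1\<bar> + nat \<bar>n$2\<bar> \<le> R" if "n \<in> X" for n
    unfolding R_def using assms that by (intro member_le_sum) auto
  then have "X \<subseteq> int_box R" by (fastforce simp: int_box_def)
  then show ?thesis by (rule that)
qed

lemma summable_on_exp_int_l1:
  assumes c: "c > 0" shows "(\<lambda>n. exp (- c * int_l1 n)) summable_on UNIV"
proof (rule nonneg_bdd_above_summable_on)
  define q where "q = exp (- c)"
  have q: "0 < q" "q < 1" using c by (auto simp: q_def)
  \<comment> \<open>Each half-line contributes at most 1 / (1 - q), with 0 counted twice.\<close>
  define s where "s = 2 / (1 - q)"
  have geo: "(\<Sum>j\<in>{- int R..int R}. q ^ nat \<bar>j\<bar>) \<le> s" for R
  proof -
    have fin: "(\<Sum>i\<le>R. q ^ i) \<le> 1 / (1 - q)"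
      using q sum_le_suminf[OF summable_geometric, of q "{..R}"] by (simp add: suminf_geometric)
    have "{- int R..int R} = int ` {..R} \<union> (\<lambda>i. - int i) ` {..R}"
    proof (intro equalityI subsetI)
      fix j assume "j \<in> {- int R..int R}"
      then show "j \<in> int ` {..R} \<union> (\<lambda>i. - int i) ` {..R}"
        by (cases "j \<ge> 0") (auto intro!: image_eqI[of _ _ "nat \<bar>j\<bar>"])
    qed auto
    then have "(\<Sum>j\<in>{- int R..int R}. q ^ nat \<bar>j\<bar>)
        \<le> (\<Sum>j\<in>int ` {..R}. q ^ nat \<bar>j\<bar>) + (\<Sum>j\<in>(\<lambda>i. - int i) ` {..R}. q ^ nat \<bar>j\<bar>)"
      using q by (simp add: sum_Un sum_nonneg)
    also have "\<dots> = 2 * (\<Sum>i\<le>R. q ^ i)"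
      by (simp add: sum.reindex inj_on_def)
    also have "\<dots> \<le> s" using fin by (simp add: s_def)
    finally show ?thesis .
  qed
  have e: "exp (- c * int_l1 n) = q ^ nat \<bar>n$1\<bar> * q ^ nat \<bar>n$2\<bar>" for n
  proof -
    have "exp (- c * \<bar>real_of_int j\<bar>) = q ^ nat \<bar>j\<bar>" for j :: int
    proof -
      have "q ^ nat \<bar>j\<bar> = exp (real (nat \<bar>j\<bar>) * - c)" unfolding q_def by (rule exp_of_nat_mult[symmetric])
      then show ?thesis by (simp add: mult.commute)
    qed
    moreover have "- c * int_l1 n = - c * \<bar>real_of_int (n$1)\<bar> + - c * \<bar>real_of_int (n$2)\<bar>"
      by (simp add: int_l1_def algebra_simps)
    ultimately show ?thesis by (simp only: exp_add)
  qed
  show "bdd_above (sum (\<lambda>n. exp (- c * int_l1 n)) ` {F. F \<subseteq> UNIV \<and> finite F})"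
  proof (rule bdd_aboveI2[where M = "s * s"])
    fix F :: "(int^2) set" assume "F \<in> {F. F \<subseteq> UNIV \<and> finite F}"
    then obtain R where R: "F \<subseteq> int_box R" using finite_subset_int_box[of F] by blast
    let ?I = "{- int R..int R}"
    have "sum (\<lambda>n. exp (- c * int_l1 n)) F \<le> sum (\<lambda>n. exp (- c * int_l1 n)) (int_box R)"
      by (rule sum_mono2[OF finite_int_box R]) auto
    also have "\<dots> = (\<Sum>p\<in>(\<lambda>n. (n$1, n$2)) ` int_box R. q ^ nat \<bar>fst p\<bar> * q ^ nat \<bar>snd p\<bar>)"
      unfolding e sum.reindex[OF inj_on_int_vec_pair] by simp
    also have "\<dots> \<le> (\<Sum>p\<in>?I \<times> ?I. q ^ nat \<bar>fst p\<bar> * q ^ nat \<bar>snd p\<bar>)"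
      by (rule sum_mono2[OF _ int_box_image]) (use q in auto)
    also have "\<dots> = (\<Sum>i\<in>?I. q ^ nat \<bar>i\<bar>) * (\<Sum>j\<in>?I. q ^ nat \<bar>j\<bar>)"
      unfolding sum_product sum.cartesian_product by (simp add: case_prod_unfold)
    also have "\<dots> \<le> s * s"
      using geo[of R] q by (intro mult_mono) (auto simp: s_def intro: sum_nonneg)
    finally show "sum (\<lambda>n. exp (- c * int_l1 n)) F \<le> s * s" .
  qed
qed auto

lemma summable_exp_sqrt:
  assumes b: "b > 0" shows "summable (\<lambda>k. exp (- b * sqrt (real k)))"
proof (rule summable_comparison_test_ev)
  show "summable (\<lambda>k. (4 / b) ^ 4 * inverse (real k ^ 2))"
    by (intro summable_mult inverse_power_summable) simp
  show "\<forall>\<^sub>F k in sequentially. norm (exp (- b * sqrt (real k))) \<le> (4 / b) ^ 4 * inverse (real k ^ 2)"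
  proof (rule eventually_sequentiallyI[of 1])
    fix k :: nat assume k: "1 \<le> k"
    \<comment> \<open>y^4 is at most (exp y)^4 = exp (b sqrt k), which yields decay like
      k^(-2).\<close>
    define y where "y = b * sqrt (real k) / 4"
    have y: "y > 0" using k b by (simp add: y_def)
    have "y ^ 4 \<le> exp y ^ 4" using y exp_ge_add_one_self[of y] by (intro power_mono) linarith+
    also have "exp y ^ 4 = exp (b * sqrt (real k))" by (simp add: y_def flip: exp_of_nat_mult)
    finally have "inverse (exp (b * sqrt (real k))) \<le> inverse (y ^ 4)" using y by (intro le_imp_inverse_le) auto
    also have "y ^ 4 = (b / 4) ^ 4 * (sqrt (real k))\<^sup>2 ^ 2"
      using power_mult[of "sqrt (real k)" 2 2] by (simp add: y_def power_mult_distrib power_divide)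
    also have "\<dots> = (b / 4) ^ 4 * real k ^ 2" by simp
    also have "inverse ((b / 4) ^ 4 * real k ^ 2) = (4 / b) ^ 4 * inverse (real k ^ 2)"
      by (simp add: power_divide inverse_eq_divide)
    finally show "norm (exp (- b * sqrt (real k))) \<le> (4 / b) ^ 4 * inverse (real k ^ 2)"
      by (simp add: exp_minus)
  qed
qed

lemma wspace_coeff_le:
  assumes "f \<in> wspace \<nu>" "0 < \<nu> n" shows "cmod (f n) \<le> wnorm \<nu> f / \<nu> n"
proof -
  have "(cmod (f n) * \<nu> n)\<^sup>2 \<le> (wnorm \<nu> f)\<^sup>2"
    using wspace_finite_sum_le[OF assms(1), of "{n}"] by (simp add: power_mult_distrib)
  then have "cmod (f n) * \<nu> n \<le> wnorm \<nu> f"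
    by (rule power2_le_imp_le) (rule wnorm_nonneg)
  then show ?thesis using assms(2) by (simp add: pos_le_divide_eq)
qed

lemma zero_in_wspace: "(\<lambda>n. 0) \<in> wspace \<nu>" "wnorm \<nu> (\<lambda>n. 0) = 0"
  by (simp_all add: wspace_def wnorm_eq)

lemma wspace_scale:
  assumes "f \<in> wspace \<nu>" shows "(\<lambda>n. c * f n) \<in> wspace \<nu>"
  using summable_on_cmult_right[of "\<lambda>n. (cmod (f n))\<^sup>2 * (\<nu> n)\<^sup>2" UNIV "(cmod c)\<^sup>2"] assms
  by (simp add: wspace_def norm_mult power_mult_distrib mult_ac)

lemma bounded_op_diff:
  assumes A: "bounded_op \<nu> A" and "f \<in> wspace \<nu>" "g \<in> wspace \<nu>"
  shows "A (\<lambda>n. f n - g n) = (\<lambda>n. A f n - A g n)"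
proof -
  have "A (\<lambda>n. f n + h n) = (\<lambda>n. A f n + A h n)" if "h \<in> wspace \<nu>" for h
    using A assms(2) that by (simp add: bounded_op_def)
  from this[OF wspace_scale[OF assms(3), of "- 1"]]
  have "A (\<lambda>n. f n + (- 1) * g n) = (\<lambda>n. A f n + A (\<lambda>n. (- 1) * g n) n)" .
  also have "A (\<lambda>n. (- 1) * g n) = (\<lambda>n. (- 1) * A g n)"
    using A assms(3) by (simp only: bounded_op_def)
  finally show ?thesis by simp
qed

lemma bounded_opE:
  assumes "bounded_op \<nu> A"
  obtains C where "C \<ge> 0" "\<And>f. f \<in> wspace \<nu> \<Longrightarrow> wnorm \<nu> (A f) \<le> C * wnorm \<nu> f"
proof -
  obtain C where C: "\<And>f. f \<in> wspace \<nu> \<Longrightarrow> wnorm \<nu> (A f) \<le> C * wnorm \<nu> f"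
    using assms unfolding bounded_op_def by blast
  have "wnorm \<nu> (A f) \<le> \<bar>C\<bar> * wnorm \<nu> f" if "f \<in> wspace \<nu>" for f
    using C[OF that] mult_right_mono[OF abs_ge_self[of C] wnorm_nonneg[of \<nu> f]] by linarith
  then show ?thesis by (intro that[of "\<bar>C\<bar>"]) auto
qed

text \<open>Both operators are bounded and agree on the dense Laurent polynomials. Agreement is
  claimed on \<open>wspace \<nu>\<close>, since elsewhere the values of a \<open>coeff_op\<close>
  are arbitrary.\<close>

lemma continuous_extension_unique:
  assumes pos: "\<And>n. 0 < \<nu> n" and A: "continuous_extension \<nu> L A" and B: "continuous_extension \<nu> L B"
    and f: "f \<in> wspace \<nu>"
  shows "B f = A f"
proof
  fix n
  have bA: "bounded_op \<nu> A" and bB: "bounded_op \<nu> B" using A B by (auto simp: continuous_extension_def)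
  obtain CA where CA: "CA \<ge> 0" "\<And>f. f \<in> wspace \<nu> \<Longrightarrow> wnorm \<nu> (A f) \<le> CA * wnorm \<nu> f"
    using bounded_opE[OF bA] by blast
  obtain CB where CB: "CB \<ge> 0" "\<And>f. f \<in> wspace \<nu> \<Longrightarrow> wnorm \<nu> (B f) \<le> CB * wnorm \<nu> f"
    using bounded_opE[OF bB] by blast
  have ws: "A g \<in> wspace \<nu>" "B g \<in> wspace \<nu>" if "g \<in> wspace \<nu>" for g
    using bA bB that by (auto simp: bounded_op_def)
  have "cmod (B f n - A f n) * \<nu> n \<le> e" if e: "e > 0" for e
  proof -
    have "e / (CA + CB + 1) > 0" using e CA CB by simp
    then obtain g where g: "laurent_poly g" "wnorm \<nu> (\<lambda>n. f n - g n) < e / (CA + CB + 1)"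
      using laurent_poly_dense[OF f] by blast
    have gw: "g \<in> wspace \<nu>" by (rule laurent_poly_in_wspace[OF g(1)])
    have d: "(\<lambda>n. f n - g n) \<in> wspace \<nu>" by (rule wspace_diff(1)[OF f gw])
    have "A g = B g" using A B g(1) by (simp add: continuous_extension_def)
    then have eq: "(\<lambda>n. B f n - A f n) = (\<lambda>n. B (\<lambda>n. f n - g n) n - A (\<lambda>n. f n - g n) n)"
      unfolding bounded_op_diff[OF bA f gw] bounded_op_diff[OF bB f gw] by simp
    have "wnorm \<nu> (\<lambda>n. B (\<lambda>n. f n - g n) n - A (\<lambda>n. f n - g n) n)
        \<le> CB * wnorm \<nu> (\<lambda>n. f n - g n) + CA * wnorm \<nu> (\<lambda>n. f n - g n)"
      using wspace_diff(2)[OF ws(2)[OF d] ws(1)[OF d]] CA(2)[OF d] CB(2)[OF d] by linarith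
    moreover have "CB * wnorm \<nu> (\<lambda>n. f n - g n) + CA * wnorm \<nu> (\<lambda>n. f n - g n)
        \<le> (CA + CB + 1) * wnorm \<nu> (\<lambda>n. f n - g n)"
      using wnorm_nonneg[of \<nu> "\<lambda>n. f n - g n"] by (simp add: algebra_simps)
    moreover have "(CA + CB + 1) * wnorm \<nu> (\<lambda>n. f n - g n) \<le> e"
      using g(2) CA(1) CB(1) by (simp add: pos_less_divide_eq mult.commute)
    ultimately have "wnorm \<nu> (\<lambda>n. B f n - A f n) \<le> e" unfolding eq by linarith
    moreover have "cmod (B f n - A f n) \<le> wnorm \<nu> (\<lambda>n. B f n - A f n) / \<nu> n"
      by (rule wspace_coeff_le[OF wspace_diff(1)[OF ws(2)[OF f] ws(1)[OF f]] pos])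
    ultimately show ?thesis using pos[of n] by (simp add: pos_le_divide_eq)
  qed
  then have "cmod (B f n - A f n) * \<nu> n \<le> 0" by (rule field_le_epsilon[of _ 0, simplified])
  then show "B f n = A f n" using pos[of n] by (simp add: mult_le_0_iff)
qed

text \<open>Only the columns in \<open>X\<close> are kept: \<open>UNIV\<close> gives the operator, a
  box its finite-rank truncation, and the complement of the box the truncation error.\<close>

definition matrix_op :: "(int^2 \<Rightarrow> int^2 \<Rightarrow> complex) \<Rightarrow> (int^2) set \<Rightarrow> coeff_op" where
  "matrix_op a X f n = (\<Sum>\<^sub>\<infinity>m\<in>X. a n m * f m)"

section \<open>Matrices whose weighted entries decay exponentially\<close>

context
  fixes a :: "int^2 \<Rightarrow> int^2 \<Rightarrow> complex" and \<nu> :: "int^2 \<Rightarrow> real" and C c :: real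
  assumes pos: "\<And>n. 0 < \<nu> n" and C: "0 \<le> C" and c: "0 < c"
    and bound: "\<And>n m. cmod (a n m) * \<nu> n / \<nu> m \<le> C * exp (- c * (int_l1 n + int_l1 m))"
begin

private abbreviation "e n \<equiv> exp (- c * int_l1 n)"

text \<open>\<open>a n m * \<nu> n / \<nu> m\<close> is the entry in the orthonormal basis of
  monomials divided by their weights. Its assumed bound splits into a factor in \<open>n\<close> and
  a factor in \<open>m\<close>.\<close>

lemma entry_bound:
  assumes "f \<in> wspace \<nu>"
  shows "cmod (a n m * f m) \<le> (C * e n * wnorm \<nu> f / \<nu> n) * e m"
proof -
  have "cmod (a n m * f m) \<le> cmod (a n m) * (wnorm \<nu> f / \<nu> m)"
    unfolding norm_mult by (intro mult_left_mono wspace_coeff_le assms pos) auto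
  also have "\<dots> = cmod (a n m) * \<nu> n / \<nu> m * (wnorm \<nu> f / \<nu> n)"
    using pos[of n] by simp
  also have "\<dots> \<le> C * exp (- c * (int_l1 n + int_l1 m)) * (wnorm \<nu> f / \<nu> n)"
    using pos[of n] by (intro mult_right_mono bound) (auto simp: wnorm_nonneg)
  also have "\<dots> = (C * e n * wnorm \<nu> f / \<nu> n) * e m"
    unfolding distrib_left exp_add by (simp only: mult_ac times_divide_eq_left times_divide_eq_right)
  finally show ?thesis .
qed

lemma summable_e: "e summable_on X"
  using summable_on_exp_int_l1[OF c] summable_on_subset_banach by blast

lemma abs_summable_entries:
  assumes "f \<in> wspace \<nu>" shows "(\<lambda>m. norm (a n m * f m)) summable_on X"
  by (rule Infinite_Sum.abs_summable_on_comparison_test'[OF summable_on_cmult_right[OF summable_e] entry_bound[OF assms]])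

lemma summable_entries:
  assumes "f \<in> wspace \<nu>" shows "(\<lambda>m. a n m * f m) summable_on X"
  by (rule abs_summable_summable[OF abs_summable_entries[OF assms]])

text \<open>The factor \<open>infsum e X\<close> is what becomes small for the complement of a large
  box. The factor \<open>infsum e UNIV + 1\<close> is a crude substitute for a square root: S <= (S
  + 1)^2.\<close>

lemma matrix_op_bound:
  assumes "f \<in> wspace \<nu>"
  shows "matrix_op a X f \<in> wspace \<nu>"
    and "wnorm \<nu> (matrix_op a X f) \<le> C * infsum e X * (infsum e UNIV + 1) * wnorm \<nu> f"
proof -
  define D where "D = C * infsum e X * (infsum e UNIV + 1)"
  have X: "0 \<le> infsum e X" and U: "0 \<le> infsum e UNIV" by (auto intro: infsum_nonneg)
  have D: "0 \<le> D" using C X U by (simp add: D_def)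
  have pt: "cmod (matrix_op a X f n) * \<nu> n \<le> C * wnorm \<nu> f * infsum e X * e n" for n
  proof -
    have "cmod (matrix_op a X f n) \<le> (\<Sum>\<^sub>\<infinity>m\<in>X. cmod (a n m * f m))"
      unfolding matrix_op_def by (rule norm_infsum_bound[OF abs_summable_entries[OF assms(1)]])
    also have "\<dots> \<le> (\<Sum>\<^sub>\<infinity>m\<in>X. (C * e n * wnorm \<nu> f / \<nu> n) * e m)"
      by (intro infsum_mono abs_summable_entries[OF assms(1)] summable_on_cmult_right summable_e entry_bound assms(1))
    also have "\<dots> = (C * e n * wnorm \<nu> f / \<nu> n) * infsum e X"
      by (rule infsum_cmult_right') 
    finally show ?thesis using pos[of n] by (simp add: field_simps)
  qed
  have "(\<Sum>n\<in>A. (cmod (matrix_op a X f n))\<^sup>2 * (\<nu> n)\<^sup>2) \<le> (D * wnorm \<nu> f)\<^sup>2" if A: "finite A" for A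
  proof -
    have "(\<Sum>n\<in>A. (cmod (matrix_op a X f n))\<^sup>2 * (\<nu> n)\<^sup>2) \<le> (\<Sum>n\<in>A. (C * wnorm \<nu> f * infsum e X)\<^sup>2 * e n)"
    proof (rule sum_mono)
      fix n
      have "(cmod (matrix_op a X f n) * \<nu> n)\<^sup>2 \<le> (C * wnorm \<nu> f * infsum e X * e n)\<^sup>2"
        using pos[of n] by (intro power_mono pt) simp
      also have "\<dots> = (C * wnorm \<nu> f * infsum e X)\<^sup>2 * (e n * e n)"
        by (simp add: power2_eq_square mult_ac)
      also have "\<dots> \<le> (C * wnorm \<nu> f * infsum e X)\<^sup>2 * (e n * 1)"
        using c int_l1_nonneg[of n] by (intro mult_left_mono) auto
      finally show "(cmod (matrix_op a X f n))\<^sup>2 * (\<nu> n)\<^sup>2 \<le> (C * wnorm \<nu> f * infsum e X)\<^sup>2 * e n"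
        by (simp add: power_mult_distrib)
    qed
    also have "\<dots> = (C * wnorm \<nu> f * infsum e X)\<^sup>2 * (\<Sum>n\<in>A. e n)" by (rule sum_distrib_left[symmetric])
    also have "\<dots> \<le> (C * wnorm \<nu> f * infsum e X)\<^sup>2 * (infsum e UNIV + 1)\<^sup>2"
    proof (rule mult_left_mono)
      have "(\<Sum>n\<in>A. e n) \<le> infsum e UNIV" by (rule finite_sum_le_infsum[OF summable_e A]) auto
      also have "\<dots> \<le> (infsum e UNIV + 1)\<^sup>2" using U by (simp add: power2_eq_square algebra_simps)
      finally show "(\<Sum>n\<in>A. e n) \<le> (infsum e UNIV + 1)\<^sup>2" .
    qed simp
    also have "\<dots> = (D * wnorm \<nu> f)\<^sup>2" by (simp add: D_def power_mult_distrib mult_ac)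
    finally show ?thesis .
  qed
  moreover have "0 \<le> D * wnorm \<nu> f" using D wnorm_nonneg by simp
  ultimately show "matrix_op a X f \<in> wspace \<nu>"
    "wnorm \<nu> (matrix_op a X f) \<le> C * infsum e X * (infsum e UNIV + 1) * wnorm \<nu> f"
    unfolding D_def using wspace_of_finite_sums by blast+
qed

lemma bounded_op_matrix_op: "bounded_op \<nu> (matrix_op a X)"
  unfolding bounded_op_def
proof (intro conjI ballI allI)
  show "matrix_op a X f \<in> wspace \<nu>" if "f \<in> wspace \<nu>" for f by (rule matrix_op_bound(1)[OF that])
  show "matrix_op a X (\<lambda>n. f n + g n) = (\<lambda>n. matrix_op a X f n + matrix_op a X g n)"
    if "f \<in> wspace \<nu>" "g \<in> wspace \<nu>" for f g
    unfolding matrix_op_def distrib_left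
    by (intro ext infsum_add summable_entries that)
  show "matrix_op a X (\<lambda>n. k * f n) = (\<lambda>n. k * matrix_op a X f n)" for k f
    unfolding matrix_op_def infsum_cmult_right'[symmetric] by (simp add: mult_ac)
  show "\<exists>D. \<forall>f\<in>wspace \<nu>. wnorm \<nu> (matrix_op a X f) \<le> D * wnorm \<nu> f"
    using matrix_op_bound(2) by blast
qed

text \<open>A \<open>Sup\<close> dominates the members of its set once the set is bounded above; the
  operator bounds ensure this, and f = 0 supplies a member.\<close>

lemma op_norm_diff_nonneg:
  assumes "bounded_op \<nu> A" "bounded_op \<nu> B" shows "0 \<le> op_norm \<nu> (\<lambda>f n. A f n - B f n)"
proof -
  obtain CA where CA: "CA \<ge> 0" "\<And>f. f \<in> wspace \<nu> \<Longrightarrow> wnorm \<nu> (A f) \<le> CA * wnorm \<nu> f"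
    using bounded_opE[OF assms(1)] by blast
  obtain CB where CB: "CB \<ge> 0" "\<And>f. f \<in> wspace \<nu> \<Longrightarrow> wnorm \<nu> (B f) \<le> CB * wnorm \<nu> f"
    using bounded_opE[OF assms(2)] by blast
  have "wnorm \<nu> (\<lambda>n. A f n - B f n) \<le> CA + CB" if "f \<in> wspace \<nu>" "wnorm \<nu> f \<le> 1" for f
  proof -
    have "A f \<in> wspace \<nu>" "B f \<in> wspace \<nu>" using assms that(1) by (auto simp: bounded_op_def)
    from wspace_diff(2)[OF this] show ?thesis
      using CA(2)[OF that(1)] CB(2)[OF that(1)] mult_left_mono[OF that(2) CA(1)] mult_left_mono[OF that(2) CB(1)]
      by simp
  qed
  then have "bdd_above {wnorm \<nu> (\<lambda>n. A f n - B f n) | f. f \<in> wspace \<nu> \<and> wnorm \<nu> f \<le> 1}"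
    by (intro bdd_aboveI[of _ "CA + CB"]) auto
  then have "wnorm \<nu> (\<lambda>n. A (\<lambda>n. 0) n - B (\<lambda>n. 0) n) \<le> op_norm \<nu> (\<lambda>f n. A f n - B f n)"
    unfolding op_norm_def by (rule cSup_upper[rotated]) (use zero_in_wspace in force)
  then show ?thesis using wnorm_nonneg order_trans by blast
qed

text \<open>The range is spanned by the columns with index in \<open>X\<close>; the list of columns
  is padded with zeros up to length \<open>k\<close>.\<close>

lemma rank_matrix_op:
  assumes X: "finite X" "card X \<le> k" shows "rank_at_most \<nu> k (matrix_op a X)"
proof -
  obtain h where h: "bij_betw h {..<card X} X"
    using X(1) by (metis atLeast0LessThan ex_bij_betw_nat_finite)
  define g where "g j n = (if j < card X then a n (h j) else 0)" for j n
  have "matrix_op a X f = (\<lambda>n. \<Sum>j<k. f (h j) * g j n)" for f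
  proof
    fix n
    have "matrix_op a X f n = (\<Sum>m\<in>X. a n m * f m)" unfolding matrix_op_def using X(1) by simp
    also have "\<dots> = (\<Sum>j<card X. a n (h j) * f (h j))" by (rule sum.reindex_bij_betw[OF h, symmetric])
    also have "\<dots> = (\<Sum>j<k. f (h j) * g j n)"
      by (rule sum.mono_neutral_cong_left) (use X(2) in \<open>auto simp: g_def\<close>)
    finally show "matrix_op a X f n = (\<Sum>j<k. f (h j) * g j n)" .
  qed
  then have "\<exists>c. matrix_op a X f = (\<lambda>n. \<Sum>j<k. c j * g j n)" for f by (rule exI)
  then show ?thesis unfolding rank_at_most_def by (intro exI[of _ g] ballI)
qed

text \<open>Keeping only the columns in a box of radius \<open>R\<close> gives an operator of rank at most \<open>(2R + 1)\<^sup>2\<close> and an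
  error exponentially small in \<open>R\<close>, so the \<open>k\<close>-th singular value decays like \<open>exp (- (c/4) \<surd>k)\<close>.\<close>

lemma trace_class_matrix_op: "trace_class \<nu> (matrix_op a UNIV)"
proof -
  let ?A = "matrix_op a UNIV"
  \<comment> \<open>Half of the decay rate is spent on smallness in \<open>R\<close>, the other half
    on summability.\<close>
  define e' where "e' n = exp (- (c / 2) * int_l1 n)" for n
  have s': "e' summable_on X" for X
    unfolding e'_def using summable_on_exp_int_l1[of "c / 2"] c summable_on_subset_banach by force
  define D where "D = C * infsum e' UNIV * (infsum e UNIV + 1)"
  have nn: "0 \<le> infsum e' UNIV" "0 \<le> infsum e UNIV" by (auto simp: e'_def intro: infsum_nonneg)
  then have D: "0 \<le> D" using C by (simp add: D_def)
  have tail: "infsum e (- int_box R) \<le> exp (- (c / 2) * R) * infsum e' UNIV" for R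
  proof -
    have "e m \<le> exp (- (c / 2) * R) * e' m" if "m \<in> - int_box R" for m
    proof -
      have "real R \<le> int_l1 m" using that by (auto simp: int_box_def int_l1_def)
      then have "- c * int_l1 m \<le> - (c / 2) * R + - (c / 2) * int_l1 m"
        using mult_left_mono[of "real R" "int_l1 m" "c / 2"] c by (simp add: field_simps)
      then show ?thesis unfolding e'_def exp_add[symmetric] by simp
    qed
    then have "infsum e (- int_box R) \<le> (\<Sum>\<^sub>\<infinity>m\<in>- int_box R. exp (- (c / 2) * R) * e' m)"
      by (intro infsum_mono summable_e summable_on_cmult_right s')
    also have "\<dots> = exp (- (c / 2) * R) * infsum e' (- int_box R)" by (rule infsum_cmult_right')
    also have "\<dots> \<le> exp (- (c / 2) * R) * infsum e' UNIV"
      by (intro mult_left_mono infsum_mono_neutral s') (auto simp: e'_def)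
    finally show ?thesis .
  qed
  have nonneg: "0 \<le> singular_value \<nu> ?A k" for k
    unfolding singular_value_def
  proof (rule cInf_greatest)
    have "bounded_op \<nu> (matrix_op a {}) \<and> rank_at_most \<nu> k (matrix_op a {})"
      using bounded_op_matrix_op rank_matrix_op[of "{}" k] by simp
    then show "{op_norm \<nu> (\<lambda>f n. ?A f n - B f n) | B. bounded_op \<nu> B \<and> rank_at_most \<nu> k B} \<noteq> {}" by blast
  qed (use op_norm_diff_nonneg bounded_op_matrix_op in blast)
  have sv: "singular_value \<nu> ?A k \<le> D * exp (- (c / 2) * R)" if "(2 * R + 1)\<^sup>2 \<le> k" for k R
  proof -
    let ?B = "matrix_op a (int_box R)"
    have rank: "rank_at_most \<nu> k ?B"
      using card_int_box_le[of R] that by (intro rank_matrix_op finite_int_box) linarith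
    have "singular_value \<nu> ?A k \<le> op_norm \<nu> (\<lambda>f n. ?A f n - ?B f n)"
      unfolding singular_value_def
    proof (rule cInf_lower)
      show "bdd_below {op_norm \<nu> (\<lambda>f n. ?A f n - B f n) | B. bounded_op \<nu> B \<and> rank_at_most \<nu> k B}"
        by (rule bdd_belowI[of _ 0]) (use op_norm_diff_nonneg bounded_op_matrix_op in blast)
    qed (use rank bounded_op_matrix_op in blast)
    also have "\<dots> \<le> D * exp (- (c / 2) * R)"
      unfolding op_norm_def
    proof (rule cSup_least)
      show "{wnorm \<nu> (\<lambda>n. ?A f n - ?B f n) | f. f \<in> wspace \<nu> \<and> wnorm \<nu> f \<le> 1} \<noteq> {}"
        using zero_in_wspace by force
      fix y assume "y \<in> {wnorm \<nu> (\<lambda>n. ?A f n - ?B f n) | f. f \<in> wspace \<nu> \<and> wnorm \<nu> f \<le> 1}"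
      then obtain f where f: "f \<in> wspace \<nu>" "wnorm \<nu> f \<le> 1" and y: "y = wnorm \<nu> (\<lambda>n. ?A f n - ?B f n)" by blast
      have "?A f n - ?B f n = matrix_op a (- int_box R) f n" for n
        unfolding matrix_op_def Compl_eq_Diff_UNIV
        by (rule infsum_Diff[symmetric]) (use summable_entries[OF f(1)] in auto)
      then have "y = wnorm \<nu> (matrix_op a (- int_box R) f)" unfolding y by simp
      also have "\<dots> \<le> C * infsum e (- int_box R) * (infsum e UNIV + 1) * wnorm \<nu> f"
        by (rule matrix_op_bound(2)[OF f(1)])
      also have "\<dots> \<le> C * (exp (- (c / 2) * R) * infsum e' UNIV) * (infsum e UNIV + 1) * 1"
        using C nn f(2) by (intro mult_mono tail) (auto intro: infsum_nonneg simp: wnorm_nonneg)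
      also have "\<dots> = D * exp (- (c / 2) * R)" by (simp add: D_def)
      finally show "y \<le> D * exp (- (c / 2) * R)" .
    qed
    finally show ?thesis .
  qed
  have "summable (singular_value \<nu> ?A)"
  proof (rule summable_comparison_test_ev)
    show "summable (\<lambda>k. D * exp (3 * c / 4) * exp (- (c / 4) * sqrt (real k)))"
      using c by (intro summable_mult summable_exp_sqrt) simp
    show "\<forall>\<^sub>F k in sequentially. norm (singular_value \<nu> ?A k) \<le> D * exp (3 * c / 4) * exp (- (c / 4) * sqrt (real k))"
    proof (rule eventually_sequentiallyI[of 1])
      fix k :: nat assume k: "1 \<le> k"
      \<comment> \<open>\<open>R\<close> is the largest radius with (2 R + 1)^2 <= k. Rounding down
        costs at most 1, so R >= (sqrt k - 3) / 2, the source of the factor exp (3 c / 4).\<close>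
      define x where "x = (sqrt (real k) - 1) / 2"
      define R where "R = nat \<lfloor>x\<rfloor>"
      have "0 \<le> x" using k by (simp add: x_def)
      then have "real R = of_int \<lfloor>x\<rfloor>" unfolding R_def by simp
      then have "real R \<le> x" "x - 1 \<le> real R" by linarith+
      then have R: "real R \<le> (sqrt (real k) - 1) / 2" "(sqrt (real k) - 3) / 2 \<le> real R"
        by (simp_all add: x_def field_simps)
      have "2 * real R + 1 \<le> sqrt (real k)" using R(1) by simp
      then have "(2 * real R + 1)\<^sup>2 \<le> (sqrt (real k))\<^sup>2" by (intro power_mono) auto
      also have "\<dots> = real k" by simp
      finally have "real ((2 * R + 1)\<^sup>2) \<le> real k" by (simp add: power2_eq_square algebra_simps)
      then have "(2 * R + 1)\<^sup>2 \<le> k" unfolding of_nat_le_iff .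
      from sv[OF this] have "singular_value \<nu> ?A k \<le> D * exp (- (c / 2) * R)" .
      also have "\<dots> \<le> D * exp (3 * c / 4 + - (c / 4) * sqrt (real k))"
      proof -
        have "(c / 2) * ((sqrt (real k) - 3) / 2) \<le> (c / 2) * real R" using c R(2) by (intro mult_left_mono) auto
        then show ?thesis using D by (intro mult_left_mono) (auto simp: algebra_simps)
      qed
      finally show "norm (singular_value \<nu> ?A k) \<le> D * exp (3 * c / 4) * exp (- (c / 4) * sqrt (real k))"
        using nonneg[of k] by (simp only: exp_add real_norm_def abs_of_nonneg mult.assoc)
    qed
  qed
  then show ?thesis using bounded_op_matrix_op by (simp add: trace_class_def)
qed

lemma continuous_extension_matrix_op:
  assumes "\<And>f n. laurent_poly f \<Longrightarrow> L f n = (\<Sum>m | f m \<noteq> 0. a n m * f m)"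
  shows "continuous_extension \<nu> L (matrix_op a UNIV)"
  unfolding continuous_extension_def
proof (intro conjI allI impI bounded_op_matrix_op ext)
  fix f n assume f: "laurent_poly f"
  have "matrix_op a UNIV f n = (\<Sum>\<^sub>\<infinity>m\<in>{m. f m \<noteq> 0}. a n m * f m)"
    unfolding matrix_op_def by (rule infsum_cong_neutral) auto
  also have "\<dots> = L f n" using f assms[OF f] by (simp add: laurent_poly_def)
  finally show "matrix_op a UNIV f n = L f n" .
qed

end

section \<open>Fourier modes of a weighted composition operator\<close>

lemma real_analytic_component:
  fixes f :: "real^2 \<Rightarrow> complex^2"
  assumes "real_analytic f" shows "real_analytic (\<lambda>x. f x $ i)"
  unfolding real_analytic_def
proof
  fix a :: "real^2"
  obtain r c where r: "r > 0" and c: "\<And>x. dist x a < r \<Longrightarrow>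
      ((\<lambda>(j, k). ((x$1 - a$1)^j * (x$2 - a$2)^k) *\<^sub>R c (j, k)) has_sum f x) UNIV"
    using assms unfolding real_analytic_def by meson
  have "((\<lambda>(j, k). ((x$1 - a$1)^j * (x$2 - a$2)^k) *\<^sub>R (c (j, k) $ i)) has_sum f x $ i) UNIV" if "dist x a < r" for x
    using has_sum_bounded_linear[OF bounded_linear_vec_nth c[OF that], of i]
    by (simp add: case_prod_unfold)
  then show "\<exists>r>0. \<exists>c. \<forall>x. dist x a < r \<longrightarrow>
      ((\<lambda>(j, k). ((x$1 - a$1)^j * (x$2 - a$2)^k) *\<^sub>R c (j, k)) has_sum f x $ i) UNIV"
    using r by (intro exI[of _ r] conjI exI[of _ "\<lambda>p. c p $ i"]) auto
qed

lemma torus_lift_differentiable: "torus_lift T F \<Longrightarrow> F differentiable (at x)"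
  by (simp add: torus_lift_def)

lemma torus_lift_proj: "torus_lift T F \<Longrightarrow> T (torus_proj x) = torus_proj (F x)"
  by (simp add: torus_lift_def)

text \<open>A lift is only assumed differentiable. Its analyticity is inherited from
  \<open>T\<close>, whose components are \<open>cis\<close> of the components of the lift.\<close>

lemma extends_holo_torus_lift:
  assumes T: "torus_analytic T" and F: "torus_lift T F"
  shows "extends_holo (\<lambda>x. of_real (F x $ i))"
proof (rule extends_holo_lift)
  have "real_analytic (\<lambda>x. (T \<circ> torus_proj) x $ i)"
    by (rule real_analytic_component[OF T[unfolded torus_analytic_def]])
  moreover have "(\<lambda>x. (T \<circ> torus_proj) x $ i) = (\<lambda>x. cis (F x $ i))"
    by (rule ext) (simp only: o_apply torus_lift_proj[OF F], simp add: torus_proj_def)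
  ultimately show "extends_holo (\<lambda>x. cis (F x $ i))"
    using real_analytic_imp_extends_holo by metis
  have "continuous_on UNIV F"
    using torus_lift_differentiable[OF F]
    by (meson continuous_at_imp_continuous_on differentiable_imp_continuous_within)
  then show "continuous_on UNIV (\<lambda>x. F x $ i)" by (intro continuous_intros)
qed

lemma extends_holo_frechet_component:
  fixes F :: "real^2 \<Rightarrow> real^2"
  assumes F: "\<And>x. F differentiable (at x)" and e: "extends_holo (\<lambda>x. of_real (F x $ i))"
  shows "extends_holo (\<lambda>x. of_real (tangent_map F x v $ i))"
proof -
  have "frechet_derivative (\<lambda>x. complex_of_real (F x $ i)) (at x) v = of_real (tangent_map F x v $ i)" for x
  proof -
    have "(F has_derivative tangent_map F x) (at x)"
      using F[of x] by (simp add: frechet_derivative_works)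
    then have "((\<lambda>x. complex_of_real (F x $ i)) has_derivative (\<lambda>v. of_real (tangent_map F x v $ i))) (at x)"
      by (intro bounded_linear.has_derivative[OF bounded_linear_of_real] bounded_linear.has_derivative[OF bounded_linear_vec_nth])
    from fun_cong[OF frechet_derivative_at[OF this], of v] show ?thesis by simp
  qed
  then show ?thesis using extends_holo_has_derivative(2)[OF e, of v] by simp
qed

lemma continuous_on_frechet_component:
  fixes F :: "real^2 \<Rightarrow> real^2"
  assumes F: "\<And>x. F differentiable (at x)" and e: "\<And>i. extends_holo (\<lambda>x. of_real (F x $ i))"
  shows "continuous_on S (\<lambda>x. tangent_map F x v)"
proof -
  have "continuous_on S (\<lambda>x. Re (of_real (tangent_map F x v $ i)))" for i
    by (intro continuous_on_Re extends_holo_continuous_on extends_holo_frechet_component F e)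
  then have "continuous_on S (\<lambda>x. \<chi> i. tangent_map F x v $ i)"
    by (intro continuous_on_vec_lambda) simp
  then show ?thesis by simp
qed

text \<open>Maps that agree modulo the lattice become equal under exp (i .), and the derivatives can
  be read off there. It serves both F(G(x)) = x modulo periods and the periodicity of the derivative
  of a lift.\<close>

lemma torus_proj_eq_imp_derivative_eq:
  assumes 1: "(u1 has_derivative d1) (at x)" and 2: "(u2 has_derivative d2) (at x)"
    and eq: "\<And>y. torus_proj (u1 y) = torus_proj (u2 y)"
  shows "d1 = d2"
proof (rule ext, subst vec_eq_iff, rule allI)
  fix h i
  have e: "exp (\<i> * of_real (u1 y $ i)) = exp (\<i> * of_real (u2 y $ i))" for y
    using eq[of y] by (simp add: torus_proj_def vec_eq_iff cis_conv_exp)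
  have d: "((\<lambda>y. exp (\<i> * of_real (u y $ i))) has_derivative (\<lambda>h. exp (\<i> * of_real (u x $ i)) * (\<i> * of_real (d h $ i)))) (at x)"
    if "(u has_derivative d) (at x)" for u :: "_ \<Rightarrow> real^2" and d
  proof -
    have "((\<lambda>x. \<i> * complex_of_real (u x $ i)) has_derivative (\<lambda>v. \<i> * of_real (d v $ i))) (at x)"
      by (intro has_derivative_mult_right bounded_linear.has_derivative[OF bounded_linear_of_real]
           bounded_linear.has_derivative[OF bounded_linear_vec_nth] that)
    from has_derivative_compose[OF this DERIV_exp[unfolded has_field_derivative_def]]
    show ?thesis by simp
  qed
  have "(\<lambda>h. exp (\<i> * of_real (u1 x $ i)) * (\<i> * of_real (d1 h $ i))) = (\<lambda>h. exp (\<i> * of_real (u2 x $ i)) * (\<i> * of_real (d2 h $ i)))"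
    using d[OF 1] d[OF 2] unfolding e by (rule has_derivative_unique)
  from fun_cong[OF this, of h] show "d1 h $ i = d2 h $ i" by (simp add: e)
qed

lemma cis_int_inner_periodic:
  assumes "torus_proj x = torus_proj y" shows "cis (real_vec m \<bullet> x) = cis (real_vec m \<bullet> y)"
proof -
  obtain k where y: "y = x + period_vec k" using assms torus_proj_eq_iff by blast
  have "real_vec m \<bullet> y = real_vec m \<bullet> x + 2 * pi * of_int (m$1 * fst k + m$2 * snd k)"
    unfolding y by (simp add: inner_vec_def sum_2 real_vec_def period_vec_nth algebra_simps)
  then show ?thesis by (simp add: cis_mult[symmetric] cis_multiple_2pi del: of_int_add of_int_mult)
qed

lemma real_vec_uminus: "real_vec (- m) = - real_vec m"
  by (simp add: real_vec_def vec_eq_iff)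

lemma periodic_change_of_variables:
  fixes g :: "real^2 \<Rightarrow> complex"
  assumes R: "bij_betw R torus torus" and G: "\<And>x. R (torus_proj x) = torus_proj (G x)"
    and diff: "\<And>x. (G has_derivative G' x) (at x)"
    and g: "continuous_on UNIV g" and per: "\<And>x y. torus_proj x = torus_proj y \<Longrightarrow> g x = g y"
  shows "integral (cbox 0 (\<chi> i. 2 * pi)) g =
    integral (cbox 0 (\<chi> i. 2 * pi)) (\<lambda>x. \<bar>det (matrix (G' x))\<bar> *\<^sub>R g (G x))"
proof -
  \<comment> \<open>The function on the torus that induces \<open>g\<close>; periodicity makes the
    choice of the preimage immaterial.\<close>
  define \<psi> where "\<psi> z = g (SOME x. torus_proj x = z)" for z
  have \<psi>: "\<psi> (torus_proj x) = g x" for x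
    unfolding \<psi>_def by (rule per) (rule someI[of "\<lambda>y. torus_proj y = torus_proj x" x], rule refl)
  show ?thesis
    using torus_change_of_variables[OF R G diff, of \<psi>] g unfolding G \<psi> by simp
qed

text \<open>A translation is the lift of a rotation of the torus, with Jacobian 1.\<close>

lemma periodic_integral_translate:
  fixes g :: "real^2 \<Rightarrow> complex"
  assumes g: "continuous_on UNIV g" and per: "\<And>x y. torus_proj x = torus_proj y \<Longrightarrow> g x = g y"
  shows "integral (cbox 0 (\<chi> i. 2 * pi)) (\<lambda>x. g (x + v)) = integral (cbox 0 (\<chi> i. 2 * pi)) g"
proof -
  define R :: "complex^2 \<Rightarrow> complex^2" where "R z = (\<chi> i. z$i * cis (v$i))" for z
  have "bij_betw R torus torus"
    by (rule bij_betwI[where g = "\<lambda>z. \<chi> i. z$i * cis (- v$i)"])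
       (auto simp: R_def torus_def norm_mult vec_eq_iff mult.assoc cis_mult)
  moreover have "R (torus_proj x) = torus_proj (x + v)" for x
    by (simp add: R_def torus_proj_def cis_mult)
  moreover have "((\<lambda>x. x + v) has_derivative (\<lambda>h. h)) (at x)" for x
    by (auto intro!: derivative_eq_intros)
  ultimately show ?thesis
    using periodic_change_of_variables[OF _ _ _ g per, of R "\<lambda>x. x + v" "\<lambda>x h. h"]
    by (simp add: matrix_id_mat_1[unfolded id_def])
qed

definition mode_integral :: "(real^2 \<Rightarrow> complex) \<Rightarrow> (real^2 \<Rightarrow> real^2) \<Rightarrow> int^2 \<Rightarrow> int^2 \<Rightarrow> complex" where
  "mode_integral w F m n = integral (cbox 0 (\<chi> i. 2 * pi))
     (\<lambda>x. w x * cis (real_vec m \<bullet> F x) * cis (- (real_vec n \<bullet> x)))"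

lemma mode_integrand:
  assumes w: "extends_holo w" "\<And>x y. torus_proj x = torus_proj y \<Longrightarrow> w x = w y"
    and F: "torus_lift T F"
  shows "continuous_on UNIV (\<lambda>x. w x * cis (real_vec m \<bullet> F x) * cis (- (real_vec n \<bullet> x)))"
    and "torus_proj x = torus_proj y \<Longrightarrow>
      w x * cis (real_vec m \<bullet> F x) * cis (- (real_vec n \<bullet> x)) = w y * cis (real_vec m \<bullet> F y) * cis (- (real_vec n \<bullet> y))"
proof -
  have "continuous_on UNIV F"
    using torus_lift_differentiable[OF F]
    by (meson continuous_at_imp_continuous_on differentiable_imp_continuous_within)
  then show "continuous_on UNIV (\<lambda>x. w x * cis (real_vec m \<bullet> F x) * cis (- (real_vec n \<bullet> x)))"
    unfolding cis_conv_exp by (intro continuous_intros extends_holo_continuous_on w)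
  assume xy: "torus_proj x = torus_proj y"
  then have "torus_proj (F x) = torus_proj (F y)" using torus_lift_proj[OF F] by metis
  from cis_int_inner_periodic[OF this, of m] cis_int_inner_periodic[OF xy, of "- n"] w(2)[OF xy]
  show "w x * cis (real_vec m \<bullet> F x) * cis (- (real_vec n \<bullet> x)) = w y * cis (real_vec m \<bullet> F y) * cis (- (real_vec n \<bullet> y))"
    by (simp add: real_vec_uminus)
qed

text \<open>The modulus of \<open>mode_integral\<close> with real frequencies, the form required by
  \<open>shift_bound\<close>; it is used at integer frequencies.\<close>

definition mode_norm :: "(real^2 \<Rightarrow> complex) \<Rightarrow> (real^2 \<Rightarrow> real^2) \<Rightarrow> real^2 \<Rightarrow> real^2 \<Rightarrow> real" where
  "mode_norm w F m n =
     norm (integral (cbox 0 (\<chi> i. 2 * pi)) (\<lambda>x. w x * cis (m \<bullet> F x) * cis (- (n \<bullet> x))))"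

lemma mode_shift_bound:
  assumes T: "torus_analytic T" and F: "torus_lift T F"
    and w: "extends_holo w" "\<And>x y. torus_proj x = torus_proj y \<Longrightarrow> w x = w y"
  shows "shift_bound (cbox 0 (\<chi> i. 2 * pi)) (range real_vec) (tangent_map F) (mode_norm w F)"
proof -
  have inv: "integral (cbox 0 (\<chi> i. 2 * pi)) (\<lambda>x. w (x + v) * cis (m \<bullet> F (x + v)) * cis (- (n \<bullet> (x + v)))) =
      integral (cbox 0 (\<chi> i. 2 * pi)) (\<lambda>x. w x * cis (m \<bullet> F x) * cis (- (n \<bullet> x)))"
    if mn: "m \<in> range real_vec" "n \<in> range real_vec" for m n v
  proof -
    obtain m' n' where [simp]: "m = real_vec m'" "n = real_vec n'" using mn by blast
    show ?thesis unfolding \<open>m = _\<close> \<open>n = _\<close>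
      by (rule periodic_integral_translate[OF mode_integrand[OF w F]])
  qed
  from norm_integral_shift_bound[OF w(1) extends_holo_torus_lift[OF T F] torus_lift_differentiable[OF F], of "range real_vec" 0 "\<chi> i. 2 * pi", OF inv]
  show ?thesis unfolding mode_norm_def[abs_def] .
qed

section \<open>Decay of the modes in cones\<close>

text \<open>The substitution \<open>x = G(y)\<close> exchanges the roles of \<open>T\<close> and its inverse; its Jacobian is absorbed into
  the new multiplier \<open>w'\<close>.\<close>

lemma mode_integral_inverse:
  assumes T: "torus_analytic_diffeo T" and F: "torus_lift T F" and G: "torus_lift (torus_inv T) G"
    and w: "extends_holo w" "\<And>x y. torus_proj x = torus_proj y \<Longrightarrow> w x = w y"
  obtains w' where "extends_holo w'" "\<And>x y. torus_proj x = torus_proj y \<Longrightarrow> w' x = w' y"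
    "\<And>m n. mode_integral w F m n = mode_integral w' G (- n) (- m)"
proof -
  let ?D = "\<lambda>x. frechet_derivative G (at x)"
  define J where "J x = det (matrix (?D x))" for x
  define w' where "w' x = of_real \<bar>J x\<bar> * w (G x)" for x
  have bij: "bij_betw T torus torus" and an: "torus_analytic (torus_inv T)"
    using T by (auto simp: torus_analytic_diffeo_def)
  have bij': "bij_betw (torus_inv T) torus torus"
    unfolding torus_inv_def by (rule bij_betw_inv_into[OF bij])
  have TT: "T (torus_inv T z) = z" if "z \<in> torus" for z
    unfolding torus_inv_def using bij that by (auto simp: bij_betw_def intro: f_inv_into_f)
  have FG: "torus_proj (F (G x)) = torus_proj x" for x
    using TT[OF torus_proj_in_torus, of x] torus_lift_proj[OF F] torus_lift_proj[OF G] by metis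
  have dG: "(G has_derivative ?D x) (at x)" for x
    using torus_lift_differentiable[OF G] by (simp add: frechet_derivative_works)
  have dF: "(F has_derivative tangent_map F x) (at x)" for x
    using torus_lift_differentiable[OF F] by (simp add: frechet_derivative_works)
  have lin: "linear (?D x)" for x
    by (rule linear_frechet_derivative[OF torus_lift_differentiable[OF G]])
  \<comment> \<open>\<open>F\<close> after \<open>G\<close> is the identity modulo periods, so the
    derivative of \<open>F\<close> inverts that of \<open>G\<close> from the left and the Jacobian
    \<open>J\<close> has no zeros.\<close>
  have id: "(\<lambda>h. tangent_map F (G x) (?D x h)) = (\<lambda>h. h)" for x
    by (rule torus_proj_eq_imp_derivative_eq[OF has_derivative_compose[OF dG dF] has_derivative_ident FG])
  have "inj (?D x)" for x
    by (rule inj_on_inverseI[where g = "tangent_map F (G x)"]) (use fun_cong[OF id] in auto)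
  then have Jnz: "J x \<noteq> 0" for x
    unfolding J_def using det_nz_iff_inj[OF lin] by blast
  have eG: "extends_holo (\<lambda>x. of_real (G x $ i))" for i by (rule extends_holo_torus_lift[OF an G])
  have eD: "extends_holo (\<lambda>x. of_real (?D x v $ i))" for v i
    by (rule extends_holo_frechet_component[OF torus_lift_differentiable[OF G] eG])
  have "complex_of_real (J x) = of_real (?D x (axis 1 1) $ 1) * of_real (?D x (axis 2 1) $ 2)
      + (- 1) * (of_real (?D x (axis 2 1) $ 1) * of_real (?D x (axis 1 1) $ 2))" for x
    by (simp add: J_def det_2 matrix_def)
  then have "extends_holo (\<lambda>x. of_real (J x))"
    by (simp only:) (intro extends_holo_add extends_holo_mult extends_holo_const eD)
  then have "extends_holo (\<lambda>x. of_real \<bar>J x\<bar>)" using Jnz by (rule extends_holo_abs)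
  then have w'1: "extends_holo w'"
    unfolding w'_def[abs_def] by (rule extends_holo_mult[OF _ extends_holo_compose[OF w(1) eG]])
  have GG: "torus_proj (G x) = torus_proj (G y)" if "torus_proj x = torus_proj y" for x y
    using that torus_lift_proj[OF G] by metis
  have w'2: "w' x = w' y" if xy: "torus_proj x = torus_proj y" for x y
  proof -
    obtain k where y: "y = x + period_vec k" using xy torus_proj_eq_iff by blast
    have "((\<lambda>x. G (x + period_vec k)) has_derivative (\<lambda>h. ?D (x + period_vec k) h)) (at x)"
      by (rule has_derivative_compose[OF _ dG, of "\<lambda>x. x + period_vec k" "\<lambda>h. h" x])
         (auto intro!: derivative_eq_intros)
    moreover have "torus_proj (G (z + period_vec k)) = torus_proj (G z)" for z
      using GG torus_proj_eq_iff by metis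
    ultimately have "?D y = ?D x"
      unfolding y by (intro torus_proj_eq_imp_derivative_eq[OF _ dG])
    moreover have "w (G x) = w (G y)" by (intro w(2) GG xy)
    ultimately show ?thesis by (simp add: w'_def J_def)
  qed
  have "mode_integral w F m n = mode_integral w' G (- n) (- m)" for m n
  proof -
    have "mode_integral w F m n = integral (cbox 0 (\<chi> i. 2 * pi)) (\<lambda>x. \<bar>det (matrix (?D x))\<bar> *\<^sub>R
       (w (G x) * cis (real_vec m \<bullet> F (G x)) * cis (- (real_vec n \<bullet> G x))))"
      unfolding mode_integral_def
      by (rule periodic_change_of_variables[OF bij' torus_lift_proj[OF G] dG mode_integrand[OF w F]])
    \<comment> \<open>cis (m\<bullet>F(G x)) = cis (m\<bullet>x) becomes the Fourier factor with
      frequency -m, and cis (- n\<bullet>G x) the factor composed with \<open>G\<close>, with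
      frequency -n.\<close>
    also have "\<dots> = mode_integral w' G (- n) (- m)"
      unfolding mode_integral_def
      by (rule integral_cong)
         (simp add: w'_def J_def real_vec_uminus cis_int_inner_periodic[OF FG] scaleR_conv_of_real mult_ac)
    finally show ?thesis .
  qed
  with w'1 w'2 show ?thesis by (rule that)
qed

text \<open>The first coordinate has no zero, so connectedness fixes its sign; compactness then
  upgrades the strict inequalities to a uniform margin.\<close>

lemma sign_margin:
  fixes f :: "real^2 \<Rightarrow> real^2"
  assumes Q: "compact Q" "connected Q" "Q \<noteq> {}" and f: "continuous_on Q f" and d: "\<And>i. 0 \<le> d$i"
    and ex: "\<And>x. x \<in> Q \<Longrightarrow> \<exists>\<epsilon>\<in>{1, -1}. \<forall>i. \<epsilon> * f x $ i > d $ i"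
  obtains \<kappa> \<epsilon> :: real where "\<kappa> > 0" "\<epsilon> \<in> {1, -1}" "\<And>x i. x \<in> Q \<Longrightarrow> d $ i + \<kappa> \<le> \<epsilon> * f x $ i"
proof -
  have nz: "f x $ 1 \<noteq> 0" if x: "x \<in> Q" for x
  proof -
    obtain \<epsilon> where "\<epsilon> * f x $ 1 > d $ 1" using ex[OF x] by blast
    then show ?thesis using d[of 1] by auto
  qed
  have conn: "connected ((\<lambda>x. f x $ 1) ` Q)"
    by (intro connected_continuous_image continuous_intros f Q)
  have "(\<forall>x\<in>Q. f x $ 1 > 0) \<or> (\<forall>x\<in>Q. f x $ 1 < 0)"
  proof (rule ccontr)
    assume "\<not> ?thesis"
    then obtain x y where xy: "x \<in> Q" "y \<in> Q" "f x $ 1 \<le> 0" "f y $ 1 \<ge> 0"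
      unfolding de_Morgan_disj Set.ball_simps not_less by blast
    have "0 \<in> (\<lambda>x. f x $ 1) ` Q"
      by (rule connectedD_interval[OF conn imageI[OF xy(1)] imageI[OF xy(2)] xy(3,4)])
    then show False using nz by auto
  qed
  then have "\<exists>\<epsilon>\<in>{1, -1}. \<forall>x\<in>Q. \<epsilon> * f x $ 1 > 0" by auto
  then obtain \<epsilon> :: real where \<epsilon>: "\<epsilon> \<in> {1, -1}" "\<And>x. x \<in> Q \<Longrightarrow> \<epsilon> * f x $ 1 > 0" by blast
  \<comment> \<open>The sign given at \<open>x\<close> is the global one, since both make the first
    coordinate positive.\<close>
  have gt: "\<epsilon> * f x $ i > d $ i" if x: "x \<in> Q" for x i
  proof -
    obtain \<epsilon>' where \<epsilon>': "\<epsilon>' \<in> {1, -1}" "\<forall>i. \<epsilon>' * f x $ i > d $ i" using ex[OF x] by blast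
    then have "\<epsilon>' * f x $ 1 > 0" using d[of 1] by (meson le_less_trans)
    then have "\<epsilon>' = \<epsilon>" using \<epsilon>'(1) \<epsilon>(1) \<epsilon>(2)[OF x] by auto
    then show ?thesis using \<epsilon>'(2) by blast
  qed
  have "\<exists>\<kappa>>0. \<forall>x\<in>Q. d $ i + \<kappa> \<le> \<epsilon> * f x $ i" for i
  proof -
    have "continuous_on Q (\<lambda>x. \<epsilon> * f x $ i)" by (intro continuous_intros f)
    then obtain x0 where x0: "x0 \<in> Q" "\<And>x. x \<in> Q \<Longrightarrow> \<epsilon> * f x0 $ i \<le> \<epsilon> * f x $ i"
      using continuous_attains_inf[OF Q(1,3)] by blast
    show ?thesis
      using gt[OF x0(1), of i] x0(2) by (intro exI[of _ "\<epsilon> * f x0 $ i - d $ i"]) auto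
  qed
  then obtain \<kappa> where \<kappa>: "\<And>i. \<kappa> i > 0" "\<And>i x. x \<in> Q \<Longrightarrow> d $ i + \<kappa> i \<le> \<epsilon> * f x $ i" by metis
  have "d $ i + min (\<kappa> 1) (\<kappa> 2) \<le> \<epsilon> * f x $ i" if "x \<in> Q" for x i
    using \<kappa>(2)[OF that, of i] exhaust_2[of i] by auto
  then show ?thesis using \<kappa>(1) \<epsilon>(1) by (intro that[of "min (\<kappa> 1) (\<kappa> 2)" \<epsilon>]) auto
qed

text \<open>\<open>signs 1\<close> consists of (1,1) and (-1,-1), so in the coordinates of
  \<open>P\<close> the cone is a shifted quadrant and its opposite: one sign serves both
  coordinates.\<close>

lemma unstable_cone_memD:
  assumes "v \<in> unstable_cone P d" and Pinv: "Pinv ** P = mat 1"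
  shows "\<exists>\<epsilon>\<in>{1, -1}. \<forall>i. \<epsilon> * (Pinv *v v) $ i > d $ i"
proof -
  obtain \<sigma> y where \<sigma>: "\<sigma> \<in> signs 1" and y: "y \<in> pos_vecs" and v: "v = (P ** sign_matrix \<sigma>) *v (y + d)"
    using assms(1) by (auto simp: unstable_cone_def shifted_sector_def)
  have s: "\<sigma> $ 1 \<in> {-1, 1}" "\<sigma> $ 2 = \<sigma> $ 1"
    using \<sigma> by (auto simp: signs_def forall_2)
  have "Pinv *v v = sign_matrix \<sigma> *v (y + d)"
    unfolding v by (simp add: matrix_vector_mul_assoc matrix_mul_assoc Pinv)
  also have "\<dots> = \<sigma> $ 1 *\<^sub>R (y + d)"
    using s(2) by (simp add: vec_eq_iff forall_2 matrix_vector_mult_def sign_matrix_def sum_2)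
  finally have eq: "Pinv *v v = \<sigma> $ 1 *\<^sub>R (y + d)" .
  have "\<sigma> $ 1 * (Pinv *v v) $ i > d $ i" for i
    unfolding eq using s(1) y by (auto simp: pos_vecs_def)
  then show ?thesis using s(1) by (intro bexI[of _ "\<sigma> $ 1"]) auto
qed

lemma inner_matrix_vector: "(m :: real^2) \<bullet> (P *v z) = (transpose P *v m) \<bullet> z"
  by (metis dot_lmul_matrix transpose_matrix_vector)

lemma sign_of_product_nonneg:
  fixes a b :: real assumes "0 \<le> a * b"
  obtains \<tau> :: real where "\<tau> \<in> {1, -1}" "\<tau> * a = \<bar>a\<bar>" "\<tau> * b = \<bar>b\<bar>"
proof (cases "a \<ge> 0 \<and> b \<ge> 0")
  case True then show ?thesis by (intro that[of 1]) auto
next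
  case False
  then have "a \<le> 0 \<and> b \<le> 0" using assms by (auto simp: zero_le_mult_iff)
  then show ?thesis by (intro that[of "-1"]) auto
qed

definition weighted_l1 :: "real^2 \<Rightarrow> real^2 \<Rightarrow> real" where
  "weighted_l1 d q = d$1 * \<bar>q$1\<bar> + d$2 * \<bar>q$2\<bar>"

text \<open>The quadratic error of a shift is measured in m, the gain in the transformed frequency;
  this comparison lets the gain absorb the error.\<close>

lemma l1_le_transpose:
  fixes P :: "real^2^2"
  assumes Pinv: "P ** Pinv = mat 1"
  obtains c where "c > 0" "\<And>m. l1 m \<le> c * l1 (transpose P *v m)"
proof -
  obtain B where B: "B > 0" "\<And>q. norm (transpose Pinv *v q) \<le> B * norm q"
    using linear_bounded_pos[OF matrix_vector_mul_linear[of "transpose Pinv"]] by blast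
  have "l1 m \<le> (2 * B) * l1 (transpose P *v m)" for m
  proof -
    let ?q = "transpose P *v m"
    have "transpose Pinv ** transpose P = mat 1"
      by (simp add: matrix_transpose_mul[symmetric] Pinv transpose_mat)
    then have "transpose Pinv *v ?q = m"
      by (simp only: matrix_vector_mul_assoc matrix_vector_mul_lid)
    then have "norm m \<le> B * norm ?q" using B(2)[of ?q] by simp
    also have "\<dots> \<le> B * l1 ?q"
      using norm_le_l1_cart[of ?q] B(1) by (intro mult_left_mono) (auto simp: sum_2)
    finally show ?thesis using component_le_norm_cart[of m 1] component_le_norm_cart[of m 2] by simp
  qed
  then show ?thesis using B(1) by (intro that[of "2 * B"]) auto
qed


section \<open>Decay from cone conditions on an abstract derivative\<close>

context
  fixes Q :: "(real^2) set" and D :: "real^2 \<Rightarrow> real^2 \<Rightarrow> real^2" and P Pinv :: "real^2^2"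
    and M :: "(real^2) set" and I :: "real^2 \<Rightarrow> real^2 \<Rightarrow> real"
  assumes Q: "compact Q" "connected Q" "Q \<noteq> {}"
    and lin: "\<And>x. linear (D x)" and cont: "\<And>v. continuous_on Q (\<lambda>x. D x v)"
    and Pinv: "Pinv ** P = mat 1" "P ** Pinv = mat 1"
    and shift: "shift_bound Q M D I"
begin

private abbreviation (input) "co m \<equiv> transpose P *v m"

lemma continuous_on_conjugate: "continuous_on Q (\<lambda>x. Pinv *v D x v)"
  by (rule linear_continuous_on_compose[OF cont matrix_vector_mul_linear])

lemma inner_conjugate: "m \<bullet> D x v = co m \<bullet> (Pinv *v D x v)"
proof -
  have "D x v = P *v (Pinv *v D x v)" by (simp add: matrix_vector_mul_assoc Pinv)
  then show ?thesis by (metis inner_matrix_vector)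
qed

text \<open>Shift along \<eta> = P v by t = s \<epsilon> \<tau>. Here \<epsilon> makes the
  coordinates of \<open>Pinv *v D x (P *v v)\<close> positive and \<tau> those of
  \<open>co m\<close> nonnegative, so t (m\<bullet>D x \<eta>) is at least s times
  \<open>weighted_l1 e (co m)\<close> for all x at once. The factor 1 - s A pays for the quadratic
  error.\<close>

lemma one_sided_shift:
  assumes e: "\<And>i. 0 < e $ i" and \<epsilon>: "\<epsilon> \<in> {1, -1}"
    and marg: "\<And>x i. x \<in> Q \<Longrightarrow> e $ i \<le> \<epsilon> * (Pinv *v D x (P *v v)) $ i"
  shows "\<exists>C A t0. 0 \<le> C \<and> 0 \<le> A \<and> 0 < t0 \<and> (\<forall>s m n \<tau>. 0 < s \<longrightarrow> s \<le> t0 \<longrightarrow> m \<in> M \<longrightarrow> n \<in> M \<longrightarrow>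
    \<tau> \<in> {1, -1} \<longrightarrow> \<tau> * co m $ 1 = \<bar>co m $ 1\<bar> \<longrightarrow> \<tau> * co m $ 2 = \<bar>co m $ 2\<bar> \<longrightarrow>
    I m n \<le> C * exp (s * \<epsilon> * \<tau> * (co n \<bullet> v) - s * (1 - s * A) * weighted_l1 e (co m)))"
proof -
  obtain C K t0 where t0: "0 < t0" and C: "0 \<le> C" and K: "0 \<le> K" and bd: "\<And>t m n B. m \<in> M \<Longrightarrow> n \<in> M \<Longrightarrow> \<bar>t\<bar> \<le> t0 \<Longrightarrow>
      (\<And>x. x \<in> Q \<Longrightarrow> - t * (m \<bullet> D x (P *v v)) \<le> B) \<Longrightarrow>
      I m n \<le> C * exp (t * (n \<bullet> (P *v v)) + B + K * t\<^sup>2 * l1 m)"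
    using shift[unfolded shift_bound_def, rule_format, of "P *v v"] by metis
  obtain c where c: "c > 0" "\<And>m. l1 m \<le> c * l1 (co m)"
    using l1_le_transpose[OF Pinv(2)] by blast
  define e0 where "e0 = min (e $ 1) (e $ 2)"
  have e0: "e0 > 0" using e by (simp add: e0_def)
  have l1_le: "l1 q \<le> weighted_l1 e q / e0" for q
  proof -
    have "e0 * l1 q \<le> weighted_l1 e q"
      unfolding weighted_l1_def distrib_left by (intro add_mono mult_right_mono) (auto simp: e0_def)
    then show ?thesis using e0 by (simp add: pos_le_divide_eq mult.commute)
  qed
  \<comment> \<open>From l1 m <= c l1 (co m) and e0 l1 (co m) <=
    \<open>weighted_l1 e (co m)\<close>.\<close>
  define A where "A = K * c / e0"
  have A: "A \<ge> 0" using K c e0 by (simp add: A_def)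
  have "I m n \<le> C * exp (s * \<epsilon> * \<tau> * (co n \<bullet> v) - s * (1 - s * A) * weighted_l1 e (co m))"
    if s: "0 < s" "s \<le> t0" and mn: "m \<in> M" "n \<in> M"
      and \<tau>: "\<tau> \<in> {1, -1}" "\<tau> * co m $ 1 = \<bar>co m $ 1\<bar>" "\<tau> * co m $ 2 = \<bar>co m $ 2\<bar>" for s m n \<tau>
  proof -
    define t where "t = s * \<epsilon> * \<tau>"
    have tabs: "\<bar>t\<bar> = s" "t\<^sup>2 = s\<^sup>2" using s \<epsilon> \<tau>(1) by (auto simp: t_def)
    let ?W = "weighted_l1 e (co m)"
    have "I m n \<le> C * exp (t * (n \<bullet> (P *v v)) + - s * ?W + K * t\<^sup>2 * l1 m)"
    proof (rule bd[OF mn])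
      show "\<bar>t\<bar> \<le> t0" using tabs s by simp
      fix x assume x: "x \<in> Q"
      let ?f = "Pinv *v D x (P *v v)"
      have ic: "m \<bullet> D x (P *v v) = co m $ 1 * ?f $ 1 + co m $ 2 * ?f $ 2"
        unfolding inner_conjugate[of m] by (simp add: inner_vec_def sum_2)
      have "?W = \<bar>co m $ 1\<bar> * e $ 1 + \<bar>co m $ 2\<bar> * e $ 2" by (simp add: weighted_l1_def mult.commute)
      also have "\<dots> \<le> \<bar>co m $ 1\<bar> * (\<epsilon> * ?f $ 1) + \<bar>co m $ 2\<bar> * (\<epsilon> * ?f $ 2)"
        by (intro add_mono mult_left_mono marg[OF x]) auto
      also have "\<dots> = \<epsilon> * \<tau> * (m \<bullet> D x (P *v v))"
        unfolding ic \<tau>(2,3)[symmetric] by (simp add: algebra_simps)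
      finally have "s * ?W \<le> s * (\<epsilon> * \<tau> * (m \<bullet> D x (P *v v)))"
        using s by (intro mult_left_mono) auto
      then show "- t * (m \<bullet> D x (P *v v)) \<le> - s * ?W" by (simp add: t_def mult_ac)
    qed
    also have "\<dots> \<le> C * exp (t * (co n \<bullet> v) - s * (1 - s * A) * ?W)"
    proof (intro mult_left_mono C)
      have "K * t\<^sup>2 * l1 m \<le> K * s\<^sup>2 * (c * (?W / e0))"
        unfolding tabs
        by (intro mult_left_mono order_trans[OF c(2)[of m]] l1_le mult_nonneg_nonneg K zero_le_power2 less_imp_le[OF c(1)])
      also have "\<dots> = s * (s * A) * ?W" by (simp add: A_def power2_eq_square)
      finally have "K * t\<^sup>2 * l1 m \<le> s * (s * A) * ?W" .
      moreover have "s * (1 - s * A) * ?W = s * ?W - s * (s * A) * ?W" by (simp add: algebra_simps)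
      ultimately show "exp (t * (n \<bullet> (P *v v)) + - s * ?W + K * t\<^sup>2 * l1 m)
          \<le> exp (t * (co n \<bullet> v) - s * (1 - s * A) * ?W)"
        unfolding inner_matrix_vector by simp
    qed
    finally show ?thesis unfolding t_def .
  qed
  with C A t0 show ?thesis by blast
qed

lemma same_cone_decay:
  assumes \<delta>: "\<delta> \<in> pos_vecs" and sec: "\<And>x. D x (P *v \<delta>) \<in> unstable_cone P \<delta>"
  obtains \<kappa> s1 C where "\<kappa> > 0" "s1 > 0" "C \<ge> 0"
    "\<And>s m n. 0 < s \<Longrightarrow> s \<le> s1 \<Longrightarrow> m \<in> M \<Longrightarrow> n \<in> M \<Longrightarrow> 0 \<le> co m $ 1 * co m $ 2 \<Longrightarrow>
       I m n \<le> C * exp (s * weighted_l1 \<delta> (co n) - s * (1 + \<kappa>) * weighted_l1 \<delta> (co m))"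
proof -
  have dpos: "0 < \<delta> $ i" for i using \<delta> by (simp add: pos_vecs_def)
  obtain \<kappa>0 \<epsilon> where k0: "\<kappa>0 > 0" and \<epsilon>: "\<epsilon> \<in> {1, -1}"
    and marg: "\<And>x i. x \<in> Q \<Longrightarrow> \<delta> $ i + \<kappa>0 \<le> \<epsilon> * (Pinv *v D x (P *v \<delta>)) $ i"
    using sign_margin[OF Q continuous_on_conjugate less_imp_le[OF dpos] unstable_cone_memD[OF sec Pinv(1)]]
    by metis
  \<comment> \<open>Makes (1 + 2 \<kappa>) \<delta> <= \<delta> + \<kappa>0 in each coordinate, a
    multiplicative form of the margin. One of the two \<kappa> is spent on the quadratic
    error.\<close>
  define \<kappa> where "\<kappa> = \<kappa>0 / (2 * (\<delta> $ 1 + \<delta> $ 2))"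
  have k: "\<kappa> > 0" using k0 dpos[of 1] dpos[of 2] by (simp add: \<kappa>_def)
  have k2: "\<kappa> * (2 * (\<delta> $ 1 + \<delta> $ 2)) = \<kappa>0"
    unfolding \<kappa>_def by (rule nonzero_eq_divide_eq[THEN iffD1, OF _ refl]) (use dpos[of 1] dpos[of 2] in simp)
  define e where "e = (1 + 2 * \<kappa>) *\<^sub>R \<delta>"
  have e_le: "e $ i \<le> \<delta> $ i + \<kappa>0" for i
  proof -
    have "\<delta> $ i \<le> \<delta> $ 1 + \<delta> $ 2" using dpos[of 1] dpos[of 2] exhaust_2[of i] by auto
    from mult_left_mono[OF this, of "2 * \<kappa>"] show ?thesis
      using k k2 by (simp add: e_def algebra_simps)
  qed
  have "0 < e $ i" for i using k dpos[of i] by (simp add: e_def)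
  from one_sided_shift[OF this \<epsilon> order_trans[OF e_le marg]]
  obtain C A t0 where C: "0 \<le> C" and A: "0 \<le> A" and t0: "0 < t0" and bd: "\<And>s m n \<tau>. 0 < s \<Longrightarrow> s \<le> t0 \<Longrightarrow> m \<in> M \<Longrightarrow> n \<in> M \<Longrightarrow>
    \<tau> \<in> {1, -1} \<Longrightarrow> \<tau> * co m $ 1 = \<bar>co m $ 1\<bar> \<Longrightarrow> \<tau> * co m $ 2 = \<bar>co m $ 2\<bar> \<Longrightarrow>
    I m n \<le> C * exp (s * \<epsilon> * \<tau> * (co n \<bullet> \<delta>) - s * (1 - s * A) * weighted_l1 e (co m))"
    by metis
  \<comment> \<open>Guarantees (1 - s A) (1 + 2 \<kappa>) >= 1 + \<kappa> for s <=
    \<open>s1\<close>; the summand 1 covers A = 0.\<close>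
  define s1 where "s1 = min t0 (\<kappa> / ((1 + 2 * \<kappa>) * (A + 1)))"
  have s1: "s1 > 0" using t0 k A by (simp add: s1_def)
  have "I m n \<le> C * exp (s * weighted_l1 \<delta> (co n) - s * (1 + \<kappa>) * weighted_l1 \<delta> (co m))"
    if s: "0 < s" "s \<le> s1" and mn: "m \<in> M" "n \<in> M" and pr: "0 \<le> co m $ 1 * co m $ 2" for s m n
  proof -
    obtain \<tau> :: real where \<tau>: "\<tau> \<in> {1, -1}" "\<tau> * co m $ 1 = \<bar>co m $ 1\<bar>" "\<tau> * co m $ 2 = \<bar>co m $ 2\<bar>"
      using sign_of_product_nonneg[OF pr] by blast
    let ?W = "weighted_l1 \<delta> (co m)"
    have "s \<le> t0" using s by (simp add: s1_def)
    note bd[OF s(1) this mn \<tau>]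
    also have "C * exp (s * \<epsilon> * \<tau> * (co n \<bullet> \<delta>) - s * (1 - s * A) * weighted_l1 e (co m))
      \<le> C * exp (s * weighted_l1 \<delta> (co n) - s * (1 + \<kappa>) * ?W)"
    proof (intro mult_left_mono C)
      have "s * (\<epsilon> * \<tau> * (co n \<bullet> \<delta>)) \<le> s * \<bar>co n \<bullet> \<delta>\<bar>"
        using s(1) \<epsilon> \<tau>(1) by (intro mult_left_mono) auto
      also have "\<bar>co n \<bullet> \<delta>\<bar> \<le> weighted_l1 \<delta> (co n)"
        using dpos[of 1] dpos[of 2] abs_triangle_ineq[of "co n $ 1 * \<delta> $ 1" "co n $ 2 * \<delta> $ 2"]
        by (simp add: inner_vec_def sum_2 weighted_l1_def abs_mult mult.commute)
      finally have 1: "s * \<epsilon> * \<tau> * (co n \<bullet> \<delta>) \<le> s * weighted_l1 \<delta> (co n)"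
        using s(1) by (simp add: mult.assoc)
      have "s * ((1 + 2 * \<kappa>) * (A + 1)) \<le> \<kappa>"
        using s(2) k A by (simp add: s1_def pos_le_divide_eq)
      moreover have "0 \<le> s * (1 + 2 * \<kappa>)" using s(1) k by simp
      ultimately have "1 + \<kappa> \<le> (1 - s * A) * (1 + 2 * \<kappa>)" by (simp add: algebra_simps)
      then have "s * (1 + \<kappa>) * ?W \<le> s * ((1 - s * A) * (1 + 2 * \<kappa>)) * ?W"
        using s(1) dpos[of 1] dpos[of 2] by (intro mult_right_mono mult_left_mono) (auto simp: weighted_l1_def)
      moreover have "s * ((1 - s * A) * (1 + 2 * \<kappa>)) * ?W = s * (1 - s * A) * weighted_l1 e (co m)"
        by (simp add: weighted_l1_def e_def algebra_simps)
      ultimately show "exp (s * \<epsilon> * \<tau> * (co n \<bullet> \<delta>) - s * (1 - s * A) * weighted_l1 e (co m))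
          \<le> exp (s * weighted_l1 \<delta> (co n) - s * (1 + \<kappa>) * ?W)"
        unfolding exp_le_cancel_iff using 1 by linarith
    qed
    finally show ?thesis .
  qed
  with k s1 C show ?thesis by (rule that)
qed

text \<open>Both edges \<open>P *v axis j 1\<close> are mapped into the open cone with a uniform
  margin, so a shift along either one gains in \<open>m\<close>; which edge is used depends on
  \<open>n\<close>.\<close>

lemma cross_cone_decay:
  assumes inv: "\<And>x z. (\<And>i. 0 \<le> z $ i) \<Longrightarrow> z \<noteq> 0 \<Longrightarrow> D x (P *v z) \<in> unstable_cone P 0"
  obtains c C where "c > 0" "C \<ge> 0"
    "\<And>m n. m \<in> M \<Longrightarrow> n \<in> M \<Longrightarrow> 0 \<le> co m $ 1 * co m $ 2 \<Longrightarrow> co n $ 1 * co n $ 2 \<le> 0 \<Longrightarrow>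
       I m n \<le> C * exp (- c * l1 (co m))"
proof -
  define f where "f j x = Pinv *v D x (P *v axis j 1)" for j x
  have "\<exists>\<kappa>>0. \<exists>\<epsilon>\<in>{1, -1}. \<forall>x\<in>Q. \<forall>i. \<kappa> \<le> \<epsilon> * f j x $ i" for j :: 2
  proof -
    obtain \<kappa>0 \<epsilon> :: real where "\<kappa>0 > 0" "\<epsilon> \<in> {1, -1}"
      "\<And>x i. x \<in> Q \<Longrightarrow> (0 :: real^2) $ i + \<kappa>0 \<le> \<epsilon> * f j x $ i"
    proof (rule sign_margin[OF Q, of "f j" 0])
      show "continuous_on Q (f j)" unfolding f_def by (rule continuous_on_conjugate)
      show "0 \<le> (0 :: real^2) $ i" for i by simp
      show "\<exists>\<epsilon>\<in>{1, -1}. \<forall>i. \<epsilon> * f j x $ i > (0 :: real^2) $ i" for x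
        unfolding f_def by (rule unstable_cone_memD[OF inv Pinv(1)]) (auto simp: axis_def vec_eq_iff)
    qed blast
    then show ?thesis by (simp only: zero_index add_0) blast
  qed
  then obtain \<kappa>' \<epsilon>' where k': "\<And>j. \<kappa>' j > 0" and e': "\<And>j. \<epsilon>' j \<in> {1, -1 :: real}"
    and marg: "\<And>j x i. x \<in> Q \<Longrightarrow> \<kappa>' j \<le> \<epsilon>' j * f j x $ i" by metis
  \<comment> \<open>With different signs, a positive combination z of the edges would have an image
    with vanishing first coordinate, which does not lie in the open cone.\<close>
  have same: "\<epsilon>' 1 = \<epsilon>' 2"
  proof (rule ccontr)
    assume ne: "\<epsilon>' 1 \<noteq> \<epsilon>' 2"
    then have e21: "\<epsilon>' 2 = - \<epsilon>' 1" using e'[of 1] e'[of 2] by auto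
    obtain x where x: "x \<in> Q" using Q by blast
    define a b where "a = \<epsilon>' 1 * f 1 x $ 1" and "b = \<epsilon>' 2 * f 2 x $ 1"
    have ab: "a > 0" "b > 0"
      using marg[OF x, of 1 1] marg[OF x, of 2 1] k'[of 1] k'[of 2] unfolding a_def b_def by linarith+
    define z :: "real^2" where "z = b *\<^sub>R axis 1 1 + a *\<^sub>R axis 2 1"
    have z: "z $ 1 = b" "z $ 2 = a" by (simp_all add: z_def axis_def)
    have "0 \<le> z $ i" for i using ab exhaust_2[of i] z by auto
    moreover have "z \<noteq> 0" using ab z(1) by auto
    ultimately have "D x (P *v z) \<in> unstable_cone P 0" by (rule inv)
    from unstable_cone_memD[OF this Pinv(1)]
    obtain e :: real where "e * (Pinv *v D x (P *v z)) $ 1 > (0 :: real^2) $ 1" by blast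
    then have "(Pinv *v D x (P *v z)) $ 1 \<noteq> 0" by auto
    moreover have "Pinv *v D x (P *v z) = b *\<^sub>R f 1 x + a *\<^sub>R f 2 x"
    proof -
      have L: "linear (\<lambda>v. Pinv *v D x (P *v v))"
        using linear_compose[OF linear_compose[OF matrix_vector_mul_linear[of P] lin] matrix_vector_mul_linear[of Pinv]]
        by (simp add: o_def)
      show ?thesis unfolding z_def f_def linear_add[OF L] linear_cmul[OF L] by (rule refl)
    qed
    moreover have "b * f 1 x $ 1 + a * f 2 x $ 1 = 0"
      using e'[of 1] by (auto simp: a_def b_def e21)
    ultimately show False by simp
  qed
  define \<epsilon> where "\<epsilon> = \<epsilon>' 1"
  define \<kappa> where "\<kappa> = min (\<kappa>' 1) (\<kappa>' 2)"
  have \<epsilon>: "\<epsilon> \<in> {1, -1}" using e'[of 1] by (simp add: \<epsilon>_def)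
  have k: "\<kappa> > 0" using k' by (simp add: \<kappa>_def)
  have marg': "(\<chi> i. \<kappa>) $ i \<le> \<epsilon> * (Pinv *v D x (P *v axis j 1)) $ i" if "x \<in> Q" for j x i
    using marg[OF that, of j i] exhaust_2[of j] same by (auto simp: \<epsilon>_def \<kappa>_def f_def)
  have ek: "0 < ((\<chi> i. \<kappa>) :: real^2) $ i" for i using k by simp
  have W: "weighted_l1 (\<chi> i. \<kappa>) q = \<kappa> * l1 q" for q
    by (simp add: weighted_l1_def distrib_left)
  have "\<exists>C A t0. 0 \<le> C \<and> 0 \<le> A \<and> 0 < t0 \<and> (\<forall>s m n \<tau>. 0 < s \<longrightarrow> s \<le> t0 \<longrightarrow> m \<in> M \<longrightarrow> n \<in> M \<longrightarrow>
    \<tau> \<in> {1, -1} \<longrightarrow> \<tau> * co m $ 1 = \<bar>co m $ 1\<bar> \<longrightarrow> \<tau> * co m $ 2 = \<bar>co m $ 2\<bar> \<longrightarrow>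
    I m n \<le> C * exp (s * \<epsilon> * \<tau> * (co n \<bullet> axis j 1) - s * (1 - s * A) * (\<kappa> * l1 (co m))))" for j
    using one_sided_shift[OF ek \<epsilon> marg', of j] unfolding W .
  then obtain C' A' t' where C': "\<And>j. 0 \<le> C' j" and A': "\<And>j. 0 \<le> A' j" and t': "\<And>j. 0 < t' j"
    and bd: "\<And>j s m n \<tau>. 0 < s \<Longrightarrow> s \<le> t' j \<Longrightarrow> m \<in> M \<Longrightarrow> n \<in> M \<Longrightarrow>
    \<tau> \<in> {1, -1} \<Longrightarrow> \<tau> * co m $ 1 = \<bar>co m $ 1\<bar> \<Longrightarrow> \<tau> * co m $ 2 = \<bar>co m $ 2\<bar> \<Longrightarrow>
    I m n \<le> C' j * exp (s * \<epsilon> * \<tau> * (co n \<bullet> axis j 1) - s * (1 - s * A' j) * (\<kappa> * l1 (co m)))"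
    by metis
  define C where "C = C' 1 + C' 2"
  have C: "0 \<le> C" "C' j \<le> C" for j using C'[of 1] C'[of 2] exhaust_2[of j] by (auto simp: C_def)
  define A where "A = A' 1 + A' 2"
  have A: "0 \<le> A" "A' j \<le> A" for j using A'[of 1] A'[of 2] exhaust_2[of j] by (auto simp: A_def)
  \<comment> \<open>Ensures s A <= 1/2, so that half of the gain survives the quadratic
    error.\<close>
  define s where "s = min (min (t' 1) (t' 2)) (1 / (2 * (A + 1)))"
  have s: "s > 0" "s \<le> t' j" for j using t' A(1) exhaust_2[of j] by (auto simp: s_def)
  have sA: "s * A' j \<le> 1 / 2" for j
  proof -
    have "s * (2 * (A + 1)) \<le> 1" using A(1) by (simp add: s_def pos_le_divide_eq[symmetric])
    moreover have "s * A' j \<le> s * A" using A(2) s(1) by (intro mult_left_mono) auto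
    moreover have "s * (2 * (A + 1)) = 2 * (s * A) + 2 * s" by (simp add: algebra_simps)
    ultimately show ?thesis using s(1) by linarith
  qed
  have "I m n \<le> C * exp (- (s * \<kappa> / 2) * l1 (co m))"
    if mn: "m \<in> M" "n \<in> M" and pr: "0 \<le> co m $ 1 * co m $ 2" "co n $ 1 * co n $ 2 \<le> 0" for m n
  proof -
    obtain \<tau> :: real where \<tau>: "\<tau> \<in> {1, -1}" "\<tau> * co m $ 1 = \<bar>co m $ 1\<bar>" "\<tau> * co m $ 2 = \<bar>co m $ 2\<bar>"
      using sign_of_product_nonneg[OF pr(1)] by blast
    define t where "t = s * \<epsilon> * \<tau>"
    \<comment> \<open>The coordinates of \<open>co n\<close> do not share a strict sign, so for
      either sign of \<open>t\<close> the shift along one of the edges costs nothing in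
      \<open>n\<close>.\<close>
    have "\<exists>j. t * co n $ j \<le> 0"
    proof (rule ccontr)
      assume "\<not> ?thesis"
      then have "0 < (t * co n $ 1) * (t * co n $ 2)" by (simp add: not_le)
      also have "\<dots> = t\<^sup>2 * (co n $ 1 * co n $ 2)" by (simp add: power2_eq_square)
      also have "\<dots> \<le> 0" by (rule mult_nonneg_nonpos[OF zero_le_power2 pr(2)])
      finally show False by simp
    qed
    then obtain j where j: "t * co n $ j \<le> 0" by blast
    let ?W = "l1 (co m)"
    note bd[OF s mn \<tau>, of j]
    also have "C' j * exp (s * \<epsilon> * \<tau> * (co n \<bullet> axis j 1) - s * (1 - s * A' j) * (\<kappa> * ?W)) \<le> C * exp (- (s * \<kappa> / 2) * ?W)"
    proof (intro mult_mono C)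
      have "s * \<epsilon> * \<tau> * (co n \<bullet> axis j 1) \<le> 0" using j by (simp add: t_def inner_axis)
      moreover have "s * (1 / 2) * (\<kappa> * ?W) \<le> s * (1 - s * A' j) * (\<kappa> * ?W)"
        using s(1) sA[of j] k by (intro mult_right_mono mult_left_mono) auto
      moreover have "s * (1 / 2) * (\<kappa> * ?W) = - (- (s * \<kappa> / 2) * ?W)" by simp
      ultimately show "exp (s * \<epsilon> * \<tau> * (co n \<bullet> axis j 1) - s * (1 - s * A' j) * (\<kappa> * ?W)) \<le> exp (- (s * \<kappa> / 2) * ?W)"
        unfolding exp_le_cancel_iff by linarith
    qed auto
    finally show ?thesis .
  qed
  with s k C(1) show ?thesis by (intro that[of "s * \<kappa> / 2" C]) auto
qed

end

section \<open>Weights that compensate the losses\<close>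

lemma shift_bound_const:
  assumes "shift_bound Q M D I"
  obtains C where "0 \<le> C" "\<And>m n. m \<in> M \<Longrightarrow> n \<in> M \<Longrightarrow> I m n \<le> C"
proof -
  obtain C K t0 where 1: "0 < t0" "0 \<le> C" and bd: "\<And>t m n B. m \<in> M \<Longrightarrow> n \<in> M \<Longrightarrow> \<bar>t\<bar> \<le> t0 \<Longrightarrow>
      (\<And>x. x \<in> Q \<Longrightarrow> - t * (m \<bullet> D x 0) \<le> B) \<Longrightarrow>
      I m n \<le> C * exp (t * (n \<bullet> 0) + B + K * t\<^sup>2 * l1 m)"
    using assms[unfolded shift_bound_def, rule_format, of 0] by metis
  have "I m n \<le> C" if "m \<in> M" "n \<in> M" for m n
    using bd[OF that, of 0 0] 1 by simp
  with 1(2) show ?thesis by (rule that)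
qed

text \<open>\<open>uu\<close> and \<open>cross1\<close> will come from \<open>T\<close>,
  \<open>ss\<close> and \<open>cross2\<close> from its inverse. The quantifiers matter:
  \<open>uu\<close> and \<open>ss\<close> hold for every small s with one \<kappa>, and
  \<open>c\<close> does not depend on s. Weak inequalities in all hypotheses cover the edges of the
  cones.\<close>

lemma weighted_entry_decay:
  fixes I :: "'n \<Rightarrow> 'n \<Rightarrow> real" and co :: "'n \<Rightarrow> real^2"
  assumes \<delta>: "\<delta> \<in> pos_vecs" and \<delta>': "\<delta>' \<in> pos_vecs" and k: "\<kappa> > 0" and s1: "s1 > 0" and c: "c > 0" and C: "C \<ge> 0"
    and uu: "\<And>s m n. 0 < s \<Longrightarrow> s \<le> s1 \<Longrightarrow> 0 \<le> co m $ 1 * co m $ 2 \<Longrightarrow>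
       I m n \<le> C * exp (s * weighted_l1 \<delta> (co n) - s * (1 + \<kappa>) * weighted_l1 \<delta> (co m))"
    and ss: "\<And>s m n. 0 < s \<Longrightarrow> s \<le> s1 \<Longrightarrow> co n $ 1 * co n $ 2 \<le> 0 \<Longrightarrow>
       I m n \<le> C * exp (s * weighted_l1 \<delta>' (co m) - s * (1 + \<kappa>) * weighted_l1 \<delta>' (co n))"
    and cross1: "\<And>m n. 0 \<le> co m $ 1 * co m $ 2 \<Longrightarrow> co n $ 1 * co n $ 2 \<le> 0 \<Longrightarrow>
       I m n \<le> C * exp (- c * l1 (co m))"
    and cross2: "\<And>m n. 0 \<le> co m $ 1 * co m $ 2 \<Longrightarrow> co n $ 1 * co n $ 2 \<le> 0 \<Longrightarrow>
       I m n \<le> C * exp (- c * l1 (co n))"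
    and triv: "\<And>m n. I m n \<le> C"
  defines "V \<equiv> \<lambda>\<alpha> \<gamma> k. if 0 \<le> co k $ 1 * co k $ 2 then exp (- weighted_l1 \<alpha> (co k)) else exp (weighted_l1 \<gamma> (co k))"
  shows "\<exists>\<alpha>\<in>pos_vecs. \<exists>\<gamma>\<in>pos_vecs. \<exists>c1>0. \<forall>m n. I m n * V \<alpha> \<gamma> n / V \<alpha> \<gamma> m \<le>
      C * exp (- c1 * ((l1 (co n)) + (l1 (co m))))"
proof -
  have dpos: "0 < \<delta> $ i" "0 < \<delta>' $ i" for i using \<delta> \<delta>' by (auto simp: pos_vecs_def)
  define dm where "dm = min (min (\<delta> $ 1) (\<delta> $ 2)) (min (\<delta>' $ 1) (\<delta>' $ 2))"
  define dM where "dM = max (max (\<delta> $ 1) (\<delta> $ 2)) (max (\<delta>' $ 1) (\<delta>' $ 2))"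
  have dm: "dm > 0" using dpos by (simp add: dm_def)
  have dM: "dM > 0" using dpos[of 1] by (simp add: dM_def less_max_iff_disj)
  define N where "N q = l1 q" for q :: "real^2"
  have N: "0 \<le> N q" for q by (simp add: N_def)
  have low: "dm * N q \<le> weighted_l1 \<delta> q" "dm * N q \<le> weighted_l1 \<delta>' q" for q
    unfolding N_def weighted_l1_def distrib_left by (intro add_mono mult_right_mono; simp add: dm_def)+
  have high: "weighted_l1 \<delta> q \<le> dM * N q" "weighted_l1 \<delta>' q \<le> dM * N q" for q
    unfolding N_def weighted_l1_def distrib_left by (intro add_mono mult_right_mono; simp add: dM_def)+
  define u where "u = (1 + \<kappa> / 2) * dM"
  have u: "u > 0" using k dM by (simp add: u_def)
  \<comment> \<open>Limits the growth of the weights: r dM = s u is at most c/4, while entries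
    crossing between the cones decay at rate c/2 in the sum of both norms.\<close>
  define s where "s = min s1 (c / (4 * u))"
  have s: "s > 0" "s \<le> s1" using s1 c u by (auto simp: s_def)
  \<comment> \<open>When both frequencies lie in the same cone, the rates s, s (1 + \<kappa>) and r
    combine to - s \<kappa>/2 on each of them.\<close>
  define r where "r = s * (1 + \<kappa> / 2)"
  have r: "r > 0" using s k by (simp add: r_def)
  have rM: "r * dM \<le> c / 4"
  proof -
    have "s * u \<le> c / (4 * u) * u"
      using u by (intro mult_right_mono) (auto simp: s_def)
    also have "\<dots> = c / 4" using u by simp
    finally show ?thesis by (simp add: r_def u_def mult_ac)
  qed
  have weighted_l1_scale: "weighted_l1 (r *\<^sub>R d) q = r * weighted_l1 d q" for d q by (simp add: weighted_l1_def algebra_simps)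
  \<comment> \<open>The rates of the three situations: equal cones, growing weights, and decay from
    the weights alone.\<close>
  define c1 where "c1 = min (min (s * (\<kappa> / 2) * dm) (c / 4)) (r * dm)"
  have c1: "c1 > 0" using s k dm c r by (simp add: c1_def)
  have c1_le: "c1 \<le> s * (\<kappa> / 2) * dm" "c1 \<le> c / 4" "c1 \<le> r * dm" by (simp_all add: c1_def)
  let ?V = "V (r *\<^sub>R \<delta>) (r *\<^sub>R \<delta>')"
  have V: "?V k = (if 0 \<le> co k $ 1 * co k $ 2 then exp (- (r * weighted_l1 \<delta> (co k))) else exp (r * weighted_l1 \<delta>' (co k)))" for k
    by (simp add: V_def weighted_l1_scale)
  have main: "I m n * ?V n / ?V m \<le> C * exp (- c1 * (N (co n) + N (co m)))" for m n
  proof -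
    let ?p = "co n" and ?q = "co m"
    have gen: "I m n * exp a / exp b \<le> C * exp (- c1 * (N ?p + N ?q))"
      if "I m n \<le> C * exp e" "e + a - b \<le> - c1 * (N ?p + N ?q)" for a b e
    proof -
      have "I m n * exp a / exp b = I m n * exp (a - b)" by (simp add: exp_diff)
      also have "\<dots> \<le> C * exp e * exp (a - b)" using that(1) by (intro mult_right_mono) auto
      also have "\<dots> = C * exp (e + (a - b))" by (simp add: exp_add)
      also have "\<dots> \<le> C * exp (- c1 * (N ?p + N ?q))" using that(2) C by (intro mult_left_mono) auto
      finally show ?thesis .
    qed
    have lowc: "c1 * N q \<le> s * (\<kappa> / 2) * weighted_l1 \<delta> q" "c1 * N q \<le> s * (\<kappa> / 2) * weighted_l1 \<delta>' q"
       "c1 * N q \<le> r * weighted_l1 \<delta> q" "c1 * N q \<le> r * weighted_l1 \<delta>' q" for q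
    proof -
      have 1: "c1 * N q \<le> s * (\<kappa> / 2) * (dm * N q)" "c1 * N q \<le> r * (dm * N q)"
        using mult_right_mono[OF c1_le(1) N[of q]] mult_right_mono[OF c1_le(3) N[of q]] by (simp_all add: mult.assoc)
      have 2: "s * (\<kappa> / 2) * (dm * N q) \<le> s * (\<kappa> / 2) * weighted_l1 d q" "r * (dm * N q) \<le> r * weighted_l1 d q"
        if "dm * N q \<le> weighted_l1 d q" for d
        using that s k r by (auto intro!: mult_left_mono)
      show "c1 * N q \<le> s * (\<kappa> / 2) * weighted_l1 \<delta> q" "c1 * N q \<le> s * (\<kappa> / 2) * weighted_l1 \<delta>' q"
       "c1 * N q \<le> r * weighted_l1 \<delta> q" "c1 * N q \<le> r * weighted_l1 \<delta>' q"
        using 1 2[OF low(1)] 2[OF low(2)] by linarith+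
    qed
    have highc: "r * weighted_l1 \<delta> q \<le> c / 4 * N q" "r * weighted_l1 \<delta>' q \<le> c / 4 * N q" for q
    proof -
      have 1: "r * (dM * N q) \<le> c / 4 * N q" using mult_right_mono[OF rM N[of q]] by (simp add: mult.assoc)
      show "r * weighted_l1 \<delta> q \<le> c / 4 * N q" "r * weighted_l1 \<delta>' q \<le> c / 4 * N q"
        using mult_left_mono[OF high(1)[of q], of r] mult_left_mono[OF high(2)[of q], of r] r 1 by linarith+
    qed
    have rs: "r * x = s * x + s * (\<kappa> / 2) * x" for x by (simp add: r_def algebra_simps)
    have rs2: "s * (1 + \<kappa>) * x = s * x + 2 * (s * (\<kappa> / 2) * x)" for x by (simp add: algebra_simps)
    have ce: "- c1 * (N ?p + N ?q) = - (c1 * N ?p) - c1 * N ?q" by (simp add: algebra_simps)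
    consider "0 \<le> ?p $ 1 * ?p $ 2" "0 \<le> ?q $ 1 * ?q $ 2" | "\<not> 0 \<le> ?p $ 1 * ?p $ 2" "0 \<le> ?q $ 1 * ?q $ 2"
      | "0 \<le> ?p $ 1 * ?p $ 2" "\<not> 0 \<le> ?q $ 1 * ?q $ 2" | "\<not> 0 \<le> ?p $ 1 * ?p $ 2" "\<not> 0 \<le> ?q $ 1 * ?q $ 2" by blast
    then show ?thesis
    proof cases
      case 1
      have "s * weighted_l1 \<delta> ?p - s * (1 + \<kappa>) * weighted_l1 \<delta> ?q + - (r * weighted_l1 \<delta> ?p) - - (r * weighted_l1 \<delta> ?q) \<le> - c1 * (N ?p + N ?q)"
        unfolding rs rs2 ce using lowc(1)[of ?p] lowc(1)[of ?q] by linarith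
      from gen[OF uu[OF s 1(2)] this] show ?thesis unfolding V using 1 by simp
    next
      case 2
      \<comment> \<open>Two bounds, each in one frequency, give decay in the maximum of the norms,
        and hence at half the rate in their sum.\<close>
      have le: "I m n \<le> C * exp (- (c / 2) * (N ?p + N ?q))"
      proof -
        have p: "?p $ 1 * ?p $ 2 \<le> 0" using 2 by simp
        have 4: "I m n \<le> C * exp (- c * max (N ?p) (N ?q))"
          using cross1[OF 2(2) p] cross2[OF 2(2) p] unfolding N_def[symmetric] by (simp add: max_def)
        have "N ?p + N ?q \<le> 2 * max (N ?p) (N ?q)" by (simp add: max_def)
        from mult_left_mono[OF this, of "c / 2"] c
        have "exp (- c * max (N ?p) (N ?q)) \<le> exp (- (c / 2) * (N ?p + N ?q))" by simp
        from mult_left_mono[OF this C] 4 show ?thesis by linarith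
      qed
      have "- (c / 2) * (N ?p + N ?q) + r * weighted_l1 \<delta>' ?p - - (r * weighted_l1 \<delta> ?q) \<le> - c1 * (N ?p + N ?q)"
        using highc(2)[of ?p] highc(1)[of ?q] mult_right_mono[OF c1_le(2) N[of ?p]] mult_right_mono[OF c1_le(2) N[of ?q]]
        by (simp add: algebra_simps)
      from gen[OF le this] show ?thesis unfolding V using 2 by simp
    next
      case 3
      have "0 + - (r * weighted_l1 \<delta> ?p) - r * weighted_l1 \<delta>' ?q \<le> - c1 * (N ?p + N ?q)"
        using lowc(3)[of ?p] lowc(4)[of ?q] by (simp add: algebra_simps)
      moreover have "I m n \<le> C * exp 0" using triv by simp
      ultimately show ?thesis unfolding V using gen[of 0 "- (r * weighted_l1 \<delta> ?p)" "r * weighted_l1 \<delta>' ?q"] 3 by simp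
    next
      case 4
      then have p: "?p $ 1 * ?p $ 2 \<le> 0" by simp
      have "s * weighted_l1 \<delta>' ?q - s * (1 + \<kappa>) * weighted_l1 \<delta>' ?p + r * weighted_l1 \<delta>' ?p - r * weighted_l1 \<delta>' ?q \<le> - c1 * (N ?p + N ?q)"
        unfolding rs rs2 ce using lowc(2)[of ?p] lowc(2)[of ?q] by linarith
      from gen[OF ss[OF s p] this] show ?thesis unfolding V using 4 by simp
    qed
  qed
  moreover have "r *\<^sub>R \<delta> \<in> pos_vecs" "r *\<^sub>R \<delta>' \<in> pos_vecs" using dpos r by (auto simp: pos_vecs_def)
  ultimately show ?thesis using c1 unfolding N_def by blast
qed

text \<open>Two closed sectors carry the first formula, edges included. The other two are open and
  receive the kernel of \<open>transpose P\<close> in addition, because a \<open>cone\<close> is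
  closed under scaling by 0; on the kernel both formulas give 0.\<close>

lemma cone_wise_exponential_cone_weight: "cone_wise_exponential (cone_weight P \<alpha> \<beta>)"
proof -
  define co where "co x = transpose P *v x" for x :: "real^2"
  have lin: "linear co" unfolding co_def by (rule matrix_vector_mul_linear)
  have co_0: "co 0 = 0" by (rule linear_0[OF lin])
  have co_add: "co (x + y) = co x + co y" and co_scale: "co (r *\<^sub>R x) = r *\<^sub>R co x" for x y r
    using lin by (simp_all add: linear_add linear_cmul)
  define f where "f x = (if 0 \<le> co x $ 1 * co x $ 2 then - (\<alpha> \<bullet> (\<chi> i. \<bar>co x $ i\<bar>)) else - (\<beta> \<bullet> (\<chi> i. \<bar>co x $ i\<bar>)))" for x
  define S where "S a b = {x. co x = 0 \<or> 0 < a * co x $ 1 \<and> 0 < b * co x $ 2}" for a b :: real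
  define U where "U a b = {x. 0 \<le> a * co x $ 1 \<and> 0 \<le> b * co x $ 2}" for a b :: real
  define L where "L \<theta> a b x = - (\<theta> $ 1 * (a * co x $ 1) + \<theta> $ 2 * (b * co x $ 2))" for \<theta> :: "real^2" and a b and x :: "real^2"
  have linL: "linear (L \<theta> a b)" for \<theta> a b
    by (rule linearI) (simp_all add: L_def co_add co_scale algebra_simps)
  have coneU: "cone (U a b)" and convU: "convex (U a b)" for a b
  proof -
    have 1: "0 \<le> a * (u * y)" if "0 \<le> u" "0 \<le> a * y" for a u y :: real
      using mult_nonneg_nonneg[OF that] by (simp add: mult.left_commute)
    show "cone (U a b)" unfolding cone_def U_def by (auto simp: co_scale 1)
    show "convex (U a b)" unfolding convex_def U_def
      by (auto simp: co_add co_scale distrib_left intro!: add_nonneg_nonneg 1)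
  qed
  have coneS: "cone (S a b)" and convS: "convex (S a b)" for a b
  proof -
    have 1: "0 < a * (u * y)" if "0 < u" "0 < a * y" for a u y :: real
      using mult_pos_pos[OF that] by (simp add: mult.left_commute)
    show "cone (S a b)" unfolding cone_def
    proof (intro ballI allI impI)
      fix x and r :: real assume "x \<in> S a b" "0 \<le> r"
      then show "r *\<^sub>R x \<in> S a b"
        by (cases "r = 0") (auto simp: S_def co_scale co_0 1)
    qed
    show "convex (S a b)"
    proof (rule convexI)
      fix x y and u v :: real
      assume x: "x \<in> S a b" and y: "y \<in> S a b" and uv: "0 \<le> u" "0 \<le> v" "u + v = 1"
      show "u *\<^sub>R x + v *\<^sub>R y \<in> S a b"
      proof (cases "co x = 0 \<or> co y = 0 \<or> u = 0 \<or> v = 0")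
        case True
        then show ?thesis using x y uv
          by (cases "u = 0"; cases "v = 0") (auto simp: S_def co_add co_scale 1)
      next
        case False
        then show ?thesis using x y uv
          by (auto simp: S_def co_add co_scale distrib_left intro!: add_pos_pos 1)
      qed
    qed
  qed
  have fU: "f x = L \<alpha> a a x" if "x \<in> U a a" "a \<in> {1, -1}" for a x
  proof -
    have "0 \<le> co x $ 1 * co x $ 2" "\<bar>co x $ 1\<bar> = a * co x $ 1" "\<bar>co x $ 2\<bar> = a * co x $ 2"
      using that by (auto simp: U_def mult_nonpos_nonpos)
    then show ?thesis by (simp add: f_def L_def inner_vec_def sum_2)
  qed
  have fS: "f x = L \<beta> a (- a) x" if x: "x \<in> S a (- a)" and a: "a \<in> {1, -1}" for a x
  proof (cases "co x = 0")
    case True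
    then show ?thesis by (simp add: f_def L_def inner_vec_def)
  next
    case False
    then have "\<not> 0 \<le> co x $ 1 * co x $ 2" "\<bar>co x $ 1\<bar> = a * co x $ 1" "\<bar>co x $ 2\<bar> = (- a) * co x $ 2"
      using x a by (auto simp: S_def not_le mult_pos_neg mult_neg_pos)
    then show ?thesis by (simp add: f_def L_def inner_vec_def sum_2)
  qed
  have cover: "x \<in> U 1 1 \<union> U (- 1) (- 1) \<union> S 1 (- 1) \<union> S (- 1) 1" for x
    unfolding U_def S_def by auto
  have "piecewise_linear_on_cones f"
    unfolding piecewise_linear_on_cones_def
  proof (intro exI[of _ "{U 1 1, U (- 1) (- 1), S 1 (- 1), S (- 1) 1}"] conjI ballI)
    show "\<Union> {U 1 1, U (- 1) (- 1), S 1 (- 1), S (- 1) 1} = UNIV" using cover by auto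
    fix C assume C: "C \<in> {U 1 1, U (- 1) (- 1), S 1 (- 1), S (- 1) 1}"
    show "cone C" "convex C" using C coneU convU coneS convS by auto
    consider a where "a \<in> {1, -1}" "C = U a a" | a where "a \<in> {1, -1}" "C = S a (- a)" using C by fastforce
    then show "\<exists>g. linear g \<and> (\<forall>x\<in>C. f x = g x)"
    proof cases
      case 1
      then show ?thesis using linL fU by blast
    next
      case 2
      then show ?thesis using linL fS by blast
    qed
  qed simp
  moreover have "cone_weight P \<alpha> \<beta> n = exp (f (real_vec n))" for n
    unfolding cone_weight_def f_def co_def Let_def by simp
  ultimately show ?thesis unfolding cone_wise_exponential_def by blast
qed

text \<open>Multiplying \<open>P\<close> by this matrix turns stable cones into unstable ones, so that the estimates for \<open>T\<close> apply
  to the inverse of \<open>T\<close>.\<close>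

definition flip_matrix :: "real^2^2" where
  "flip_matrix = sign_matrix (\<chi> i. if i = 1 then 1 else - 1)"

lemma flip_matrix_mult: "flip_matrix *v v = (\<chi> i. if i = 1 then v $ 1 else - v $ 2)"
  by (simp add: flip_matrix_def sign_matrix_def matrix_vector_mult_def vec_eq_iff forall_2 sum_2)

lemma flip_matrix_square: "flip_matrix ** flip_matrix = mat 1"
  by (simp add: flip_matrix_def sign_matrix_def matrix_matrix_mult_def vec_eq_iff forall_2 sum_2 mat_def)

lemma flip_matrix_sign_matrix:
  "flip_matrix ** sign_matrix \<sigma> = sign_matrix (\<chi> i. if i = 1 then \<sigma> $ 1 else - \<sigma> $ 2)"
  by (simp add: flip_matrix_def sign_matrix_def matrix_matrix_mult_def vec_eq_iff forall_2 sum_2)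

lemma stable_cone_eq: "stable_cone P d = unstable_cone (P ** flip_matrix) d"
proof -
  define h :: "real^2 \<Rightarrow> real^2" where "h \<sigma> = (\<chi> i. if i = 1 then \<sigma> $ 1 else - \<sigma> $ 2)" for \<sigma>
  have "h ` signs 1 = signs (- 1)"
  proof (intro equalityI subsetI)
    fix \<sigma> assume "\<sigma> \<in> signs (- 1)"
    then have "h \<sigma> \<in> signs 1" "\<sigma> = h (h \<sigma>)" by (auto simp: signs_def h_def forall_2 vec_eq_iff)
    then show "\<sigma> \<in> h ` signs 1" by blast
  qed (auto simp: signs_def h_def forall_2)
  moreover have "shifted_sector P d (h \<sigma>) = shifted_sector (P ** flip_matrix) d \<sigma>" for \<sigma>
    by (simp add: shifted_sector_def h_def matrix_mul_assoc[symmetric] flip_matrix_sign_matrix)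
  ultimately show ?thesis unfolding stable_cone_def unstable_cone_def by (metis (no_types, lifting) SUP_cong image_image)
qed

lemma sign_matrix_scale: "\<sigma> $ 2 = \<sigma> $ 1 \<Longrightarrow> sign_matrix \<sigma> *v v = \<sigma> $ 1 *\<^sub>R v"
  by (simp add: vec_eq_iff forall_2 matrix_vector_mult_def sign_matrix_def sum_2)

lemma unstable_cone_uminus:
  assumes "v \<in> unstable_cone P d" shows "- v \<in> unstable_cone P d"
proof -
  obtain \<sigma> y where *: "\<sigma> \<in> signs 1" "y \<in> pos_vecs" "v = (P ** sign_matrix \<sigma>) *v (y + d)"
    using assms by (auto simp: unstable_cone_def shifted_sector_def)
  have "sign_matrix (- \<sigma>) *v u = - (sign_matrix \<sigma> *v u)" for u
    by (simp add: sign_matrix_def matrix_vector_mult_def vec_eq_iff forall_2 sum_2)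
  then have "- v = (P ** sign_matrix (- \<sigma>)) *v (y + d)"
    unfolding *(3) matrix_vector_mul_assoc[symmetric] by (simp add: linear_neg[OF matrix_vector_mul_linear])
  moreover have "- \<sigma> \<in> signs 1" using *(1) by (auto simp: signs_def)
  ultimately show ?thesis using *(2) unfolding unstable_cone_def shifted_sector_def by blast
qed

text \<open>The apexes for \<open>signs 1\<close> are plus and minus \<open>P *v \<delta>\<close>,
  and the cone is symmetric about 0, so the choice of the apex in (sec) does not matter.\<close>

lemma unstable_cone_apex:
  assumes D: "linear D" and \<sigma>: "\<sigma> \<in> signs 1" and mem: "D (cone_apex P \<delta> \<sigma>) \<in> unstable_cone P d"
  shows "D (P *v \<delta>) \<in> unstable_cone P d"
proof -
  have s: "\<sigma> $ 1 \<in> {1, -1}" "\<sigma> $ 2 = \<sigma> $ 1" using \<sigma> by (auto simp: signs_def forall_2)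
  have "cone_apex P \<delta> \<sigma> = \<sigma> $ 1 *\<^sub>R (P *v \<delta>)"
    unfolding cone_apex_def matrix_vector_mul_assoc[symmetric] sign_matrix_scale[OF s(2)]
    by (simp add: matrix_vector_mult_scaleR)
  then have "\<sigma> $ 1 *\<^sub>R D (P *v \<delta>) \<in> unstable_cone P d" using mem linear_cmul[OF D] by metis
  then show ?thesis using s(1) unstable_cone_uminus by force
qed

text \<open>The cone condition is stated on the closure; this is how it reaches the edges, as limits
  of vectors with positive coordinates.\<close>

lemma nonneg_in_closure_unstable_cone:
  assumes z: "\<And>i. 0 \<le> z $ i" shows "P *v z \<in> closure (unstable_cone P 0)"
proof -
  define e :: "nat \<Rightarrow> real^2" where "e n = z + inverse (real (Suc n)) *\<^sub>R (\<chi> i. 1)" for n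
  have mem: "P *v e n \<in> unstable_cone P 0" for n
  proof -
    have "P *v e n = (P ** sign_matrix (\<chi> i. 1)) *v (e n + 0)"
      by (simp add: matrix_vector_mul_assoc[symmetric] sign_matrix_scale)
    moreover have "e n \<in> pos_vecs"
      using z by (auto simp: pos_vecs_def e_def intro: add_nonneg_pos)
    moreover have "(\<chi> i. 1) \<in> signs 1" by (simp add: signs_def)
    ultimately show ?thesis unfolding unstable_cone_def shifted_sector_def by blast
  qed
  have "(\<lambda>n. P *v e n) \<longlonglongrightarrow> P *v (z + 0 *\<^sub>R (\<chi> i. 1))"
    unfolding e_def
    by (intro bounded_linear.tendsto[OF matrix_vector_mul_bounded_linear] tendsto_intros LIMSEQ_inverse_real_of_nat)
  then have "(\<lambda>n. P *v e n) \<longlonglongrightarrow> P *v z" by simp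
  with mem show ?thesis unfolding closure_sequential by (intro exI[of _ "\<lambda>n. P *v e n"] conjI allI)
qed

lemma cone_weight_eq:
  "cone_weight P \<alpha> (- \<gamma>) n = (if 0 \<le> (transpose P *v real_vec n) $ 1 * (transpose P *v real_vec n) $ 2
     then exp (- weighted_l1 \<alpha> (transpose P *v real_vec n)) else exp (weighted_l1 \<gamma> (transpose P *v real_vec n)))"
  by (simp add: cone_weight_def Let_def weighted_l1_def inner_vec_def sum_2)

section \<open>The matrix of the operator in the Fourier basis\<close>

lemma cis_power_int: "cis x powi k = cis (of_int k * x)"
proof (cases k)
  case (nonneg n)
  then show ?thesis by (simp add: Complex.DeMoivre)
next
  case (neg n)
  have "cis x powi k = inverse (cis x ^ Suc n)" unfolding neg by (simp only: power_int_minus power_int_of_nat)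
  also have "\<dots> = cis (- (real (Suc n) * x))" by (simp only: Complex.DeMoivre cis_inverse)
  also have "- (real (Suc n) * x) = of_int k * x" unfolding neg by (simp add: algebra_simps)
  finally show ?thesis .
qed

lemma torus_monomial:
  assumes F: "torus_lift T F"
  shows "T (torus_proj x) $ 1 powi (m $ 1) * T (torus_proj x) $ 2 powi (m $ 2) = cis (real_vec m \<bullet> F x)"
proof -
  have "T (torus_proj x) $ i = cis (F x $ i)" for i
    unfolding torus_lift_proj[OF F] by (simp add: torus_proj_def)
  then show ?thesis
    by (simp add: cis_power_int cis_mult inner_vec_def sum_2 real_vec_def)
qed

lemma weighted_comp_laurent:
  assumes F: "torus_lift T F" and w: "extends_holo (w \<circ> torus_proj)" and f: "laurent_poly f"
  shows "weighted_comp w T f n =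
    (\<Sum>m | f m \<noteq> 0. complex_of_real (1 / (2 * pi)\<^sup>2) * mode_integral (w \<circ> torus_proj) F m n * f m)"
proof -
  let ?Q = "cbox 0 (\<chi> i. 2 * pi) :: (real^2) set"
  let ?\<Phi> = "\<lambda>m x. (w \<circ> torus_proj) x * cis (real_vec m \<bullet> F x) * cis (- (real_vec n \<bullet> x))"
  have fin: "finite {m. f m \<noteq> 0}" using f by (simp add: laurent_poly_def)
  have per: "(w \<circ> torus_proj) x = (w \<circ> torus_proj) y" if "torus_proj x = torus_proj y" for x y
    using that by simp
  have int: "?\<Phi> m integrable_on ?Q" for m
    by (rule integrable_continuous, rule continuous_on_subset[OF mode_integrand(1)[OF w per F]]) auto
  have pt: "w (torus_proj x) * (\<Sum>m | f m \<noteq> 0. f m * cis (real_vec m \<bullet> F x)) * cis (- (real_vec n \<bullet> x))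
      = (\<Sum>m | f m \<noteq> 0. f m * ?\<Phi> m x)" for x
    unfolding sum_distrib_left sum_distrib_right by (intro sum.cong refl) (simp add: mult_ac)
  have "weighted_comp w T f n = complex_of_real (1 / (2 * pi)\<^sup>2) * integral ?Q (\<lambda>x. \<Sum>m | f m \<noteq> 0. f m * ?\<Phi> m x)"
    unfolding weighted_comp_def fourier_coeff_def laurent_eval_def torus_monomial[OF F]
    pt by (rule refl)
  also have "integral ?Q (\<lambda>x. \<Sum>m | f m \<noteq> 0. f m * ?\<Phi> m x) = (\<Sum>m | f m \<noteq> 0. integral ?Q (\<lambda>x. f m * ?\<Phi> m x))"
    by (rule integral_sum[OF fin]) (rule integrable_on_mult_right[OF int])
  also have "\<dots> = (\<Sum>m | f m \<noteq> 0. f m * mode_integral (w \<circ> torus_proj) F m n)"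
    unfolding mode_integral_def by (intro sum.cong refl integral_mult_right)
  finally show ?thesis by (simp only: sum_distrib_left mult_ac)
qed

section \<open>The estimates for the map and its inverse combined\<close>

lemma norm_mode_integral: "norm (mode_integral w F m n) = mode_norm w F (real_vec m) (real_vec n)"
  by (simp add: mode_integral_def mode_norm_def)

text \<open>Formulated for one map and one matrix because it is applied twice: to \<open>T\<close>
  with \<open>P\<close>, and to the inverse with \<open>P ** flip_matrix\<close>. A single
  \<open>C\<close> dominates the three constants.\<close>

lemma mode_decay:
  assumes T: "torus_analytic T" and F: "torus_lift T F"
    and w: "extends_holo w" "\<And>x y. torus_proj x = torus_proj y \<Longrightarrow> w x = w y"
    and Pinv: "Pinv ** P = mat 1" "P ** Pinv = mat 1"
    and \<delta>: "\<delta> \<in> pos_vecs" and sec: "\<And>x. tangent_map F x (P *v \<delta>) \<in> unstable_cone P \<delta>"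
    and inv: "\<And>x z. (\<And>i. 0 \<le> z $ i) \<Longrightarrow> z \<noteq> 0 \<Longrightarrow> tangent_map F x (P *v z) \<in> unstable_cone P 0"
  defines "co \<equiv> \<lambda>m. transpose P *v real_vec m"
  shows "\<exists>\<kappa> s1 c C. \<kappa> > 0 \<and> s1 > 0 \<and> c > 0 \<and> C \<ge> 0 \<and>
    (\<forall>s m n. 0 < s \<longrightarrow> s \<le> s1 \<longrightarrow> 0 \<le> co m $ 1 * co m $ 2 \<longrightarrow>
       norm (mode_integral w F m n) \<le> C * exp (s * weighted_l1 \<delta> (co n) - s * (1 + \<kappa>) * weighted_l1 \<delta> (co m))) \<and>
    (\<forall>m n. 0 \<le> co m $ 1 * co m $ 2 \<longrightarrow> co n $ 1 * co n $ 2 \<le> 0 \<longrightarrow>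
       norm (mode_integral w F m n) \<le> C * exp (- c * l1 (co m))) \<and>
    (\<forall>m n. norm (mode_integral w F m n) \<le> C)"
proof -
  let ?Q = "cbox 0 (\<chi> i. 2 * pi) :: (real^2) set"
  let ?M = "range real_vec"
  have "0 \<in> ?Q" by (simp add: mem_box_cart)
  then have Q: "compact ?Q" "connected ?Q" "?Q \<noteq> {}"
    by (blast intro: compact_cbox convex_connected convex_box)+
  have lin: "linear (tangent_map F x)" for x
    by (rule linear_frechet_derivative[OF torus_lift_differentiable[OF F]])
  have cont: "continuous_on ?Q (\<lambda>x. tangent_map F x v)" for v
    by (rule continuous_on_frechet_component[OF torus_lift_differentiable[OF F] extends_holo_torus_lift[OF T F]])
  note shift = mode_shift_bound[OF T F w]
  obtain \<kappa> s1 C1 where 1: "\<kappa> > 0" "s1 > 0" "C1 \<ge> 0"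
    "\<And>s m n. 0 < s \<Longrightarrow> s \<le> s1 \<Longrightarrow> m \<in> ?M \<Longrightarrow> n \<in> ?M \<Longrightarrow>
       0 \<le> (transpose P *v m) $ 1 * (transpose P *v m) $ 2 \<Longrightarrow>
       mode_norm w F m n \<le> C1 * exp (s * weighted_l1 \<delta> (transpose P *v n) - s * (1 + \<kappa>) * weighted_l1 \<delta> (transpose P *v m))"
    using same_cone_decay[OF Q lin cont Pinv shift \<delta> sec] by blast
  obtain c C2 where 2: "c > 0" "C2 \<ge> 0"
    "\<And>m n. m \<in> ?M \<Longrightarrow> n \<in> ?M \<Longrightarrow>
       0 \<le> (transpose P *v m) $ 1 * (transpose P *v m) $ 2 \<Longrightarrow> (transpose P *v n) $ 1 * (transpose P *v n) $ 2 \<le> 0 \<Longrightarrow>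
       mode_norm w F m n \<le> C2 * exp (- c * l1 (transpose P *v m))"
    using cross_cone_decay[OF Q lin cont Pinv shift inv] by blast
  obtain C3 where 3: "0 \<le> C3" "\<And>m n. m \<in> ?M \<Longrightarrow> n \<in> ?M \<Longrightarrow> mode_norm w F m n \<le> C3"
    using shift_bound_const[OF shift] by metis
  define C where "C = C1 + C2 + C3"
  have C: "C1 \<le> C" "C2 \<le> C" "C3 \<le> C" "C \<ge> 0" using 1(3) 2(2) 3(1) by (auto simp: C_def)
  have up: "x \<le> C * exp e" if "x \<le> A * exp e" "A \<le> C" for x A e
    by (rule order_trans[OF that(1) mult_right_mono[OF that(2)]]) simp
  show ?thesis
    unfolding co_def norm_mode_integral
  proof (rule exI[of _ \<kappa>], rule exI[of _ s1], rule exI[of _ c], rule exI[of _ C], intro conjI allI impI)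
    show "\<kappa> > 0" "s1 > 0" "c > 0" "C \<ge> 0" by (fact 1(1) 1(2) 2(1) C(4))+
  next
    fix s m n assume "0 < s" "s \<le> s1" "0 \<le> (transpose P *v real_vec m) $ 1 * (transpose P *v real_vec m) $ 2"
    from up[OF 1(4)[OF this(1,2) rangeI rangeI this(3)] C(1)]
    show "mode_norm w F (real_vec m) (real_vec n) \<le> C * exp (s * weighted_l1 \<delta> (transpose P *v real_vec n)
        - s * (1 + \<kappa>) * weighted_l1 \<delta> (transpose P *v real_vec m))" .
  next
    fix m n assume "0 \<le> (transpose P *v real_vec m) $ 1 * (transpose P *v real_vec m) $ 2"
      "(transpose P *v real_vec n) $ 1 * (transpose P *v real_vec n) $ 2 \<le> 0"
    from up[OF 2(3)[OF rangeI rangeI this] C(2)]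
    show "mode_norm w F (real_vec m) (real_vec n)
        \<le> C * exp (- c * l1 (transpose P *v real_vec m))" .
  next
    show "mode_norm w F (real_vec m) (real_vec n) \<le> C" for m n
      by (rule order_trans[OF 3(2)[OF rangeI rangeI] C(3)])
  qed
qed

text \<open>The cone condition alone leaves D v = 0 possible; expansion of the norm rules it
  out.\<close>

lemma expanding_image_in_cone:
  assumes N: "norm_family N" and l: "1 < l" and D: "D ` closure K \<subseteq> K \<union> {0}"
    and ex: "\<forall>v\<in>closure K - {0}. N y (D v) > l * N x v" and v: "v \<in> closure K" "v \<noteq> 0"
  shows "D v \<in> K"
proof -
  have "0 \<le> N x v" and N0: "N y 0 = 0" using N unfolding norm_family_def by blast+
  then have "0 \<le> l * N x v" using l by simp
  moreover have "l * N x v < N y (D v)" using ex v by blast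
  ultimately have "D v \<noteq> 0" using N0 by auto
  then show ?thesis using D v by blast
qed

lemma cone_apex_flip:
  assumes "\<sigma> \<in> signs (- 1)"
  obtains \<sigma>' where "\<sigma>' \<in> signs 1" "cone_apex P \<delta> \<sigma> = cone_apex (P ** flip_matrix) \<delta> \<sigma>'"
proof -
  define \<sigma>' :: "real^2" where "\<sigma>' = (\<chi> i. if i = 1 then \<sigma> $ 1 else - \<sigma> $ 2)"
  have "\<sigma>' \<in> signs 1" using assms by (auto simp: \<sigma>'_def signs_def forall_2)
  moreover have "flip_matrix ** sign_matrix \<sigma>' = sign_matrix \<sigma>"
    unfolding flip_matrix_sign_matrix by (rule arg_cong[of _ _ sign_matrix]) (simp add: \<sigma>'_def vec_eq_iff forall_2)
  then have "cone_apex P \<delta> \<sigma> = cone_apex (P ** flip_matrix) \<delta> \<sigma>'"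
    by (simp add: cone_apex_def matrix_mul_assoc[symmetric])
  ultimately show ?thesis by (rule that)
qed

text \<open>The dual estimate has negated frequencies. Together with the reflection this negates the
  first coordinate only: the product of the coordinates changes sign, which exchanges the cones,
  while \<open>weighted_l1\<close> and \<open>l1\<close> are unchanged.\<close>

lemma transpose_flip:
  "(transpose (P ** flip_matrix) *v (- v)) $ 1 = - (transpose P *v v) $ 1"
  "(transpose (P ** flip_matrix) *v (- v)) $ 2 = (transpose P *v v) $ 2"
proof -
  have "transpose flip_matrix = flip_matrix"
    by (simp add: flip_matrix_def sign_matrix_def transpose_def vec_eq_iff forall_2)
  then have "transpose (P ** flip_matrix) *v (- v) = flip_matrix *v (transpose P *v (- v))"
    by (simp only: matrix_transpose_mul matrix_vector_mul_assoc)
  also have "transpose P *v (- v) = - (transpose P *v v)"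
    by (rule linear_neg[OF matrix_vector_mul_linear])
  finally have "transpose (P ** flip_matrix) *v (- v) = flip_matrix *v (- (transpose P *v v))" .
  then show "(transpose (P ** flip_matrix) *v (- v)) $ 1 = - (transpose P *v v) $ 1"
    "(transpose (P ** flip_matrix) *v (- v)) $ 2 = (transpose P *v v) $ 2"
    by (simp_all only: flip_matrix_mult vec_lambda_beta) simp_all
qed

text \<open>Both applications of \<open>mode_decay\<close> are brought to common constants, the
  minimum of the rates and the sum of the bounds, so that they fit
  \<open>weighted_entry_decay\<close>.\<close>

lemma mode_integral_weighted_decay:
  fixes P :: "real^2^2"
  assumes T: "torus_analytic_diffeo T" and P: "invertible P" and sec: "sec_condition P T"
    and w: "extends_holo w" "\<And>x y. torus_proj x = torus_proj y \<Longrightarrow> w x = w y"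
  obtains F \<alpha> \<gamma> c C where "torus_lift T F" "\<alpha> \<in> pos_vecs" "\<gamma> \<in> pos_vecs" "c > 0" "C \<ge> 0"
    "\<And>m n. norm (mode_integral w F m n) * cone_weight P \<alpha> (- \<gamma>) n / cone_weight P \<alpha> (- \<gamma>) m
       \<le> C * exp (- c * (int_l1 n + int_l1 m))"
proof -
  obtain F G \<delta> \<delta>' \<sigma> \<sigma>' where F: "torus_lift T F" and G: "torus_lift (torus_inv T) G"
    and cones: "induced_cone_fields P F G" and \<delta>: "\<delta> \<in> pos_vecs" and \<delta>': "\<delta>' \<in> pos_vecs"
    and \<sigma>: "\<sigma> \<in> signs 1" and \<sigma>': "\<sigma>' \<in> signs (- 1)"
    and apex: "\<And>x. tangent_map F x (cone_apex P \<delta> \<sigma>) \<in> unstable_cone P \<delta>"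
      "\<And>x. tangent_map G x (cone_apex P \<delta>' \<sigma>') \<in> stable_cone P \<delta>'"
    using sec unfolding sec_condition_def by metis
  obtain N l where N: "norm_family N" and l: "1 < l"
    and Fu: "\<And>x. tangent_map F x ` closure (unstable_cone P 0) \<subseteq> unstable_cone P 0 \<union> {0}"
    and Gs: "\<And>x. tangent_map G x ` closure (stable_cone P 0) \<subseteq> stable_cone P 0 \<union> {0}"
    and Fe: "\<And>x. \<forall>v\<in>closure (unstable_cone P 0) - {0}. N (F x) (tangent_map F x v) > l * N x v"
    and Ge: "\<And>x. \<forall>v\<in>closure (stable_cone P 0) - {0}. N (G x) (tangent_map G x v) > l * N x v"
    using cones unfolding induced_cone_fields_def anosov_const_cones_def by metis
  obtain Pinv where Pinv: "Pinv ** P = mat 1" "P ** Pinv = mat 1"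
    using P unfolding invertible_def by blast
  define P' where "P' = P ** flip_matrix"
  define Pinv' where "Pinv' = flip_matrix ** Pinv"
  have Pinv': "Pinv' ** P' = mat 1" "P' ** Pinv' = mat 1"
  proof -
    have "Pinv' ** P' = flip_matrix ** (Pinv ** P) ** flip_matrix"
      unfolding P'_def Pinv'_def by (simp only: matrix_mul_assoc)
    then show "Pinv' ** P' = mat 1" by (simp add: Pinv flip_matrix_square)
    have "P' ** Pinv' = P ** (flip_matrix ** flip_matrix) ** Pinv"
      unfolding P'_def Pinv'_def by (simp only: matrix_mul_assoc)
    then show "P' ** Pinv' = mat 1" by (simp add: Pinv flip_matrix_square)
  qed
  have anT: "torus_analytic T" and anI: "torus_analytic (torus_inv T)"
    using T by (auto simp: torus_analytic_diffeo_def)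
  have linF: "linear (tangent_map F x)" and linG: "linear (tangent_map G x)" for x
    using linear_frechet_derivative torus_lift_differentiable F G by blast+
  have nz: "R *v z \<noteq> 0" if "S ** R = mat 1" "z \<noteq> 0" for R S :: "real^2^2" and z
  proof
    assume "R *v z = 0"
    then have "S *v (R *v z) = 0" by simp
    then show False using that by (simp add: matrix_vector_mul_assoc)
  qed
  have secF: "tangent_map F x (P *v \<delta>) \<in> unstable_cone P \<delta>" for x
    by (rule unstable_cone_apex[OF linF \<sigma> apex(1)])
  obtain \<tau> where \<tau>: "\<tau> \<in> signs 1" "cone_apex P \<delta>' \<sigma>' = cone_apex P' \<delta>' \<tau>"
    using cone_apex_flip[OF \<sigma>'] unfolding P'_def by blast
  have secG: "tangent_map G x (P' *v \<delta>') \<in> unstable_cone P' \<delta>'" for x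
    by (rule unstable_cone_apex[OF linG \<tau>(1)]) (use apex(2)[of x] in \<open>simp add: \<tau>(2) stable_cone_eq P'_def\<close>)
  have invF: "tangent_map F x (P *v z) \<in> unstable_cone P 0" if "\<And>i. 0 \<le> z $ i" "z \<noteq> 0" for x z
    by (rule expanding_image_in_cone[OF N l Fu Fe nonneg_in_closure_unstable_cone[OF that(1)] nz[OF Pinv(1) that(2)]])
  have invG: "tangent_map G x (P' *v z) \<in> unstable_cone P' 0" if "\<And>i. 0 \<le> z $ i" "z \<noteq> 0" for x z
    by (rule expanding_image_in_cone[OF N l Gs[unfolded stable_cone_eq, folded P'_def]
          Ge[unfolded stable_cone_eq, folded P'_def] nonneg_in_closure_unstable_cone[OF that(1)] nz[OF Pinv'(1) that(2)]])
  obtain w' where w': "extends_holo w'" "\<And>x y. torus_proj x = torus_proj y \<Longrightarrow> w' x = w' y"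
    and dual: "\<And>m n. mode_integral w F m n = mode_integral w' G (- n) (- m)"
    by (rule mode_integral_inverse[OF T F G w], assumption, rule that)
  define co where "co m = transpose P *v real_vec m" for m
  let ?I = "\<lambda>m n. norm (mode_integral w F m n)"
  obtain \<kappa>1 s1 c1 C1 where 1: "\<kappa>1 > 0" "s1 > 0" "c1 > 0" "C1 \<ge> 0"
    "\<And>s m n. 0 < s \<Longrightarrow> s \<le> s1 \<Longrightarrow> 0 \<le> co m $ 1 * co m $ 2 \<Longrightarrow>
       ?I m n \<le> C1 * exp (s * weighted_l1 \<delta> (co n) - s * (1 + \<kappa>1) * weighted_l1 \<delta> (co m))"
    "\<And>m n. 0 \<le> co m $ 1 * co m $ 2 \<Longrightarrow> co n $ 1 * co n $ 2 \<le> 0 \<Longrightarrow>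
       ?I m n \<le> C1 * exp (- c1 * l1 (co m))"
    "\<And>m n. ?I m n \<le> C1"
    using mode_decay[OF anT F w Pinv \<delta> secF invF] unfolding co_def by blast
  define co' where "co' m = transpose P' *v real_vec m" for m
  have co': "co' (- n) $ 1 = - co n $ 1" "co' (- n) $ 2 = co n $ 2" for n
    unfolding co'_def co_def P'_def real_vec_uminus by (rule transpose_flip)+
  obtain \<kappa>2 s2 c2 C2 where 2: "\<kappa>2 > 0" "s2 > 0" "c2 > 0" "C2 \<ge> 0"
    "\<And>s m n. 0 < s \<Longrightarrow> s \<le> s2 \<Longrightarrow> 0 \<le> co' m $ 1 * co' m $ 2 \<Longrightarrow>
       norm (mode_integral w' G m n) \<le> C2 * exp (s * weighted_l1 \<delta>' (co' n) - s * (1 + \<kappa>2) * weighted_l1 \<delta>' (co' m))"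
    "\<And>m n. 0 \<le> co' m $ 1 * co' m $ 2 \<Longrightarrow> co' n $ 1 * co' n $ 2 \<le> 0 \<Longrightarrow>
       norm (mode_integral w' G m n) \<le> C2 * exp (- c2 * l1 (co' m))"
    using mode_decay[OF anI G w' Pinv' \<delta>' secG invG] unfolding co'_def by blast
  have weighted_l1_flip: "weighted_l1 d (co' (- n)) = weighted_l1 d (co n)" for d n by (simp add: weighted_l1_def co')
  define \<kappa> s0 c C where "\<kappa> = min \<kappa>1 \<kappa>2" and "s0 = min s1 s2" and "c = min c1 c2" and "C = C1 + C2"
  have pos: "\<kappa> > 0" "s0 > 0" "c > 0" "C \<ge> 0" "C1 \<le> C" "C2 \<le> C"
    using 1(1-4) 2(1-4) by (auto simp: \<kappa>_def s0_def c_def C_def)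
  have up: "x \<le> C * exp e'" if "x \<le> A * exp e" "A \<le> C" "e \<le> e'" for x A e e'
    by (rule order_trans[OF that(1) mult_mono[OF that(2)]]) (use that(3) pos in auto)
  have weighted_l1_nonneg: "0 \<le> weighted_l1 d q" if "d \<in> pos_vecs" for d q
    using that by (auto simp: weighted_l1_def pos_vecs_def less_imp_le intro!: add_nonneg_nonneg mult_nonneg_nonneg)
  have mono: "a - s * (1 + k') * W \<le> a - s * (1 + \<kappa>) * W" if "\<kappa> \<le> k'" "0 < s" "0 \<le> W" for a s k' W
    using that by (intro diff_left_mono mult_right_mono mult_left_mono) auto
  have monoc: "- c' * W \<le> - c * W" if "c \<le> c'" "0 \<le> W" for c' W
    using mult_right_mono[OF that] by simp
  have "\<exists>\<alpha>\<in>pos_vecs. \<exists>\<gamma>\<in>pos_vecs. \<exists>c0>0. \<forall>m n. ?I m n *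
      (if 0 \<le> co n $ 1 * co n $ 2 then exp (- weighted_l1 \<alpha> (co n)) else exp (weighted_l1 \<gamma> (co n))) /
      (if 0 \<le> co m $ 1 * co m $ 2 then exp (- weighted_l1 \<alpha> (co m)) else exp (weighted_l1 \<gamma> (co m)))
      \<le> C * exp (- c0 * ((l1 (co n)) + (l1 (co m))))"
  proof (rule weighted_entry_decay[OF \<delta> \<delta>' pos(1-4)])
    show "?I m n \<le> C * exp (s * weighted_l1 \<delta> (co n) - s * (1 + \<kappa>) * weighted_l1 \<delta> (co m))"
      if "0 < s" "s \<le> s0" "0 \<le> co m $ 1 * co m $ 2" for s m n
      by (rule up[OF 1(5) pos(5) mono]) (use that weighted_l1_nonneg[OF \<delta>] in \<open>auto simp: s0_def \<kappa>_def\<close>)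
    show "?I m n \<le> C * exp (s * weighted_l1 \<delta>' (co m) - s * (1 + \<kappa>) * weighted_l1 \<delta>' (co n))"
      if s: "0 < s" "s \<le> s0" and n: "co n $ 1 * co n $ 2 \<le> 0" for s m n
    proof -
      have "s \<le> s2" "0 \<le> co' (- n) $ 1 * co' (- n) $ 2" using s n by (auto simp: s0_def co')
      \<comment> \<open>By duality the entry (m, n) of \<open>F\<close> is the entry (-n, -m) of
        \<open>G\<close>, and \<open>weighted_l1_flip\<close> translates the bound back to
        \<open>co\<close>.\<close>
      from 2(5)[OF s(1) this, of "- m"]
      have "?I m n \<le> C2 * exp (s * weighted_l1 \<delta>' (co m) - s * (1 + \<kappa>2) * weighted_l1 \<delta>' (co n))"
        unfolding weighted_l1_flip dual[symmetric] .
      then show ?thesis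
        by (rule up[OF _ pos(6) mono]) (use s weighted_l1_nonneg[OF \<delta>'] in \<open>auto simp: \<kappa>_def\<close>)
    qed
    show "?I m n \<le> C * exp (- c * l1 (co m))"
      if "0 \<le> co m $ 1 * co m $ 2" "co n $ 1 * co n $ 2 \<le> 0" for m n
      by (rule up[OF 1(6)[OF that] pos(5) monoc]) (auto simp: c_def)
    show "?I m n \<le> C * exp (- c * l1 (co n))"
      if "0 \<le> co m $ 1 * co m $ 2" "co n $ 1 * co n $ 2 \<le> 0" for m n
    proof -
      have "0 \<le> co' (- n) $ 1 * co' (- n) $ 2" "co' (- m) $ 1 * co' (- m) $ 2 \<le> 0" using that by (auto simp: co')
      from 2(6)[OF this] have "?I m n \<le> C2 * exp (- c2 * l1 (co n))"
        unfolding dual[symmetric] co' abs_minus_cancel .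
      then show ?thesis by (rule up[OF _ pos(6) monoc]) (auto simp: c_def)
    qed
    show "?I m n \<le> C" for m n by (rule order_trans[OF 1(7) pos(5)])
  qed
  then obtain \<alpha> \<gamma> c0 where \<alpha>: "\<alpha> \<in> pos_vecs" and \<gamma>: "\<gamma> \<in> pos_vecs" and c0: "c0 > 0"
    and dec: "\<And>m n. ?I m n * cone_weight P \<alpha> (- \<gamma>) n / cone_weight P \<alpha> (- \<gamma>) m
      \<le> C * exp (- c0 * ((l1 (co n)) + (l1 (co m))))"
    unfolding cone_weight_eq co_def by blast
  obtain b where b: "b > 0" "\<And>m. l1 m \<le> b * l1 (transpose P *v m)"
    using l1_le_transpose[OF Pinv(2)] by blast
  \<comment> \<open>Returns from the coordinates of \<open>P\<close> to the lattice, where sums are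
    taken; the rate is divided by \<open>b\<close>.\<close>
  have l1: "int_l1 n \<le> b * l1 (co n)" for n
    using b(2)[of "real_vec n"] unfolding co_def int_l1_def real_vec_def by simp
  have "?I m n * cone_weight P \<alpha> (- \<gamma>) n / cone_weight P \<alpha> (- \<gamma>) m \<le> C * exp (- (c0 / b) * (int_l1 n + int_l1 m))" for m n
  proof (rule order_trans[OF dec])
    have "int_l1 n + int_l1 m \<le> b * ((l1 (co n)) + (l1 (co m)))"
      using l1[of n] l1[of m] unfolding distrib_left by linarith
    then have "(c0 / b) * (int_l1 n + int_l1 m) \<le> (c0 / b) * (b * ((l1 (co n)) + (l1 (co m))))"
      using c0 b(1) by (intro mult_left_mono) auto
    also have "\<dots> = c0 * ((l1 (co n)) + (l1 (co m)))"
      using b(1) by simp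
    finally show "C * exp (- c0 * ((l1 (co n)) + (l1 (co m))))
        \<le> C * exp (- (c0 / b) * (int_l1 n + int_l1 m))"
      using pos(4) by (intro mult_left_mono) auto
  qed
  moreover have "c0 / b > 0" using c0 b by simp
  ultimately show ?thesis using F \<alpha> \<gamma> pos(4) by (intro that[of F \<alpha> \<gamma> "c0 / b" C])
qed

text \<open>That the operator is well defined is expressed by existence together with agreement of
  all continuous extensions on \<open>wspace\<close>, the only place where the values of a
  \<open>coeff_op\<close> matter.\<close>

theorem theorem1p1:
  fixes T :: "complex^2 \<Rightarrow> complex^2" and w :: "complex^2 \<Rightarrow> complex" and P :: "real^2^2"
  assumes "torus_analytic_diffeo T"
    and "invertible P"
    and "sec_condition P T"
    and "torus_analytic w"
  shows "\<exists>\<alpha>\<in>pos_vecs. \<exists>\<gamma>\<in>pos_vecs.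
           cone_wise_exponential (cone_weight P \<alpha> (- \<gamma>)) \<and>
           (\<exists>A. continuous_extension (cone_weight P \<alpha> (- \<gamma>)) (weighted_comp w T) A \<and>
                (\<forall>B. continuous_extension (cone_weight P \<alpha> (- \<gamma>)) (weighted_comp w T) B \<longrightarrow>
                     (\<forall>f\<in>wspace (cone_weight P \<alpha> (- \<gamma>)). B f = A f)) \<and>
                trace_class (cone_weight P \<alpha> (- \<gamma>)) A)"
proof -
  have w: "extends_holo (w \<circ> torus_proj)"
    using assms(4) by (intro real_analytic_imp_extends_holo) (simp add: torus_analytic_def)
  have per: "(w \<circ> torus_proj) x = (w \<circ> torus_proj) y" if "torus_proj x = torus_proj y" for x y
    using that by simp
  obtain F \<alpha> \<gamma> c C where F: "torus_lift T F" and \<alpha>: "\<alpha> \<in> pos_vecs" and \<gamma>: "\<gamma> \<in> pos_vecs"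
    and c: "c > 0" and C: "C \<ge> 0"
    and dec: "\<And>m n. norm (mode_integral (w \<circ> torus_proj) F m n) * cone_weight P \<alpha> (- \<gamma>) n / cone_weight P \<alpha> (- \<gamma>) m
       \<le> C * exp (- c * (int_l1 n + int_l1 m))"
    by (rule mode_integral_weighted_decay[OF assms(1-3) w per], assumption, rule that)
  define \<nu> where "\<nu> = cone_weight P \<alpha> (- \<gamma>)"
  define k where "k = 1 / (2 * pi)\<^sup>2"
  \<comment> \<open>The row index \<open>n\<close> is the output frequency and comes first here,
    whereas \<open>mode_integral\<close> takes the input frequency \<open>m\<close> first.\<close>
  define a where "a n m = complex_of_real k * mode_integral (w \<circ> torus_proj) F m n" for n m
  have pos: "0 < \<nu> n" for n by (simp add: \<nu>_def cone_weight_eq)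
  have k: "0 \<le> k" by (simp add: k_def)
  have bound: "cmod (a n m) * \<nu> n / \<nu> m \<le> (k * C) * exp (- c * (int_l1 n + int_l1 m))" for n m
    using mult_left_mono[OF dec[of m n] k] k by (simp add: a_def \<nu>_def norm_mult mult.assoc)
  have kC: "0 \<le> k * C" using k C by simp
  let ?A = "matrix_op a UNIV"
  have ext: "continuous_extension \<nu> (weighted_comp w T) ?A"
    by (rule continuous_extension_matrix_op[OF pos kC c bound])
       (simp add: weighted_comp_laurent[OF F w] a_def k_def)
  have "\<forall>B. continuous_extension \<nu> (weighted_comp w T) B \<longrightarrow> (\<forall>f\<in>wspace \<nu>. B f = ?A f)"
    using continuous_extension_unique[OF pos ext] by blast
  moreover have "trace_class \<nu> ?A" by (rule trace_class_matrix_op[OF pos kC c bound])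
  ultimately show ?thesis
    using \<alpha> \<gamma> ext cone_wise_exponential_cone_weight unfolding \<nu>_def by blast
qed

end
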